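(* Let $d\ge1$, $\nu>0$, $\beta\in(0,1)$, $\alpha\in(0,2)$, and fix $R>0$, $B=B(0,R)$. Suppose that $\sigma:\mathbb{R}\to\mathbb{R}$ is globally Lipschitz and that $b:\mathbb{R}\to\mathbb{R}$ is locally Lipschitz and there is $\eta>0$ with $b(x)\ge|x|^{1+\eta}$ for all $x\in\mathbb{R}$. Consider $$\partial_t^\beta u_t(x)=-\nu(-\Delta)^{\alpha/2}u_t(x)+I^{1-\beta}[b(u_t(x))+\sigma(u)\dot F(t,x)],\qquad t>0,\ x\in B(0,R),$$ with nonnegative bounded deterministic initial condition $u_0$, where $-(-\Delta)^{\alpha/2}$ denotes the generator of an $\alpha$-stable Lévy process killed upon exiting $B(0,R)$ and the noise $\dot F$ is either space-time white noise (in which case $d<(2\wedge\beta^{-1})\alpha$) or spatially colored as described in the context. Let $\phi_1$ be the first eigenfunction of the fractional Laplacian with Dirichlet exterior boundary condition in the ball $B$, and put $K_{u_0,\phi_1}:=\int_Bu_0(x)\phi_1(x)\,dx$. Then the equation has no (global) random field solution in each of the following cases: 1. $K_{u_0,\phi_1}>0$ and $\beta(1+\eta)\le1$; 2. $\beta(1+\eta)>1$ and $K_{u_0,\phi_1}>0$ is large enough (i.e. there is a constant $K>0$, not depending on $u_0$, such that the conclusion holds whenever $K_{u_0,\phi_1}>K$).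
   Context: $\partial_t^\beta$ is the Caputo derivative, $\partial_t^\beta u_t(x)=\frac{1}{\Gamma(1-\beta)}\int_0^t\frac{\partial u_r(x)}{\partial r}\frac{dr}{(t-r)^\beta}$, and $I^{\gamma'}h(t)=\frac{1}{\Gamma(\gamma')}\int_0^t(t-\tau)^{\gamma'-1}h(\tau)\,d\tau$ for $\gamma'>0$. $B(0,R)$ is the ball of radius $R$ centered at $0$ in $\mathbb{R}^d$. Let $X$ be the isotropic $\alpha$-stable Lévy process with generator $-\nu(-\Delta)^{\alpha/2}$ (characteristic function $e^{-t\nu|\xi|^\alpha}$), and $p_B(t,x,y)$ the transition density of $X$ killed upon exiting $B$. Let $D$ be a $\beta$-stable subordinator independent of $X$ ($\mathbb{E}e^{-\lambda D_r}=e^{-r\lambda^\beta}$), $E_t=\inf\{r:D_r>t\}$ its first passage time with density $f_{E_t}$, and $G_B(t,x,y)=\int_0^\infty p_B(s,x,y)f_{E_t}(s)\,ds$. The eigenfunctions $\{\phi_n\}_{n\ge1}$ of the Dirichlet fractional Laplacian in $B$ form an orthonormal basis of $L^2(B)$, and $\phi_1>0$ on $B$. Noise: space-time white noise means centered Gaussian with $\mathbb{E}[\dot F(s,x)\dot F(t,y)]=\delta_0(t-s)\delta_0(x-y)$. Colored noise means centered Gaussian with $\mathbb{E}[\dot F(s,x)\dot F(t,y)]=\delta_0(t-s)f(x,y)$, where $f(x,y)\le g(x-y)$ with $g$ locally integrable on $\mathbb{R}^d$, possibly singular at $0$, and $\int_{\mathbb{R}^d}\frac{\hat g(\xi)}{1+|\xi|^\alpha}\,d\xi<\infty$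 ($\hat g$ is the Fourier transform of $g$). A mild solution in the sense of Walsh is a $u$ adapted to the filtration generated by the noise with $$u_t(x)=\int_BG_B(t,x,y)u_0(y)\,dy+\int_B\int_0^tb(u_s(y))G_B(t-s,x,y)\,ds\,dy+\int_B\int_0^tG_B(t-s,x,y)\sigma(u_s(y))\,F(ds\,dy).$$ A mild solution is a random field solution on $[0,T]$ if $\sup_{x\in B}\sup_{t\in[0,T]}\mathbb{E}|u_t(x)|^k<\infty$ for all $k\in[2,\infty)$. It is global if it is defined and is a random field solution on $[0,T]$ for every $T>0$. *)

theory Defs
  imports "HOL-Probability.Probability"
begin

definition cadlag_path :: "(real \<Rightarrow> 'b::metric_space) \<Rightarrow> bool" where
  "cadlag_path x \<longleftrightarrow>
     (\<forall>t\<ge>0. (x \<longlongrightarrow> x t) (at_right t)) \<and> (\<forall>t>0. \<exists>l. (x \<longlongrightarrow> l) (at_left t))"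

text \<open>Time is represented by the whole of \<open>real\<close>; the values at negative times are irrelevant.\<close>

definition levy_process :: "'w measure \<Rightarrow> (real \<Rightarrow> 'w \<Rightarrow> 'b::euclidean_space) \<Rightarrow> bool" where
  "levy_process N X \<longleftrightarrow>
     prob_space N \<and>
     (\<forall>t\<ge>0. X t \<in> borel_measurable N) \<and>
     (AE \<omega> in N. X 0 \<omega> = 0) \<and>
     (AE \<omega> in N. cadlag_path (\<lambda>t. X t \<omega>)) \<and>
     (\<forall>s\<ge>0. \<forall>h\<ge>0.
        distr N borel (\<lambda>\<omega>. X (s + h) \<omega> - X s \<omega>) = distr N borel (X h)) \<and>
     (\<forall>(n::nat) ts. 0 \<le> ts 0 \<and> (\<forall>i<n. ts i \<le> ts (Suc i)) \<longrightarrow>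
        prob_space.indep_vars N (\<lambda>_. borel)
          (\<lambda>i \<omega>. X (ts (Suc i)) \<omega> - X (ts i) \<omega>) {..<n})"

definition isotropic_stable_process ::
  "real \<Rightarrow> real \<Rightarrow> 'w measure \<Rightarrow> (real \<Rightarrow> 'w \<Rightarrow> 'a::euclidean_space) \<Rightarrow> bool" where
  "isotropic_stable_process \<alpha> \<nu> N X \<longleftrightarrow>
     levy_process N X \<and>
     (\<forall>t\<ge>0. \<forall>\<xi>. (\<integral>\<omega>. iexp (\<xi> \<bullet> X t \<omega>) \<partial>N)
        = complex_of_real (exp (- t * \<nu> * norm \<xi> powr \<alpha>)))"

definition stable_subordinator ::
  "real \<Rightarrow> 'w measure \<Rightarrow> (real \<Rightarrow> 'w \<Rightarrow> real) \<Rightarrow> bool" where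
  "stable_subordinator \<beta> N D \<longleftrightarrow>
     levy_process N D \<and>
     (AE \<omega> in N. mono_on {0..} (\<lambda>t. D t \<omega>)) \<and>
     (\<forall>r\<ge>0. \<forall>l\<ge>0. (\<integral>\<omega>. exp (- l * D r \<omega>) \<partial>N) = exp (- r * l powr \<beta>))"

definition indep_processes ::
  "'w measure \<Rightarrow> (real \<Rightarrow> 'w \<Rightarrow> 'a::euclidean_space) \<Rightarrow> (real \<Rightarrow> 'w \<Rightarrow> real) \<Rightarrow> bool" where
  "indep_processes N X D \<longleftrightarrow>
     prob_space.indep_set N
       (sets (vimage_algebra (space N) (\<lambda>\<omega>. \<lambda>t\<in>{0..}. X t \<omega>) (\<Pi>\<^sub>M t\<in>{0..}. borel)))
       (sets (vimage_algebra (space N) (\<lambda>\<omega>. \<lambda>t\<in>{0..}. D t \<omega>) (\<Pi>\<^sub>M t\<in>{0..}. borel)))"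

definition first_passage :: "(real \<Rightarrow> 'w \<Rightarrow> real) \<Rightarrow> real \<Rightarrow> 'w \<Rightarrow> real" where
  "first_passage D t \<omega> = Inf {r. 0 \<le> r \<and> D r \<omega> > t}"

text \<open>
  Path properties hold only almost surely, and events such as \<open>{\<tau>\<^sub>B > t}\<close> are in general only
  measurable with respect to the completion of the underlying measure; hence \<^const>\<open>completion\<close>
  in the next definitions.
\<close>

definition first_passage_density ::
  "'w measure \<Rightarrow> (real \<Rightarrow> 'w \<Rightarrow> real) \<Rightarrow> (real \<Rightarrow> real \<Rightarrow> real) \<Rightarrow> bool" where
  "first_passage_density N D fE \<longleftrightarrow>
     (\<forall>t>0. (\<forall>s. 0 \<le> fE t s) \<and>
        distributed (completion N) lborel (first_passage D t) (\<lambda>s. ennreal (fE t s)))"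

definition exit_time ::
  "'a::euclidean_space set \<Rightarrow> (real \<Rightarrow> 'w \<Rightarrow> 'a) \<Rightarrow> 'a \<Rightarrow> 'w \<Rightarrow> ereal" where
  "exit_time B X x \<omega> = (INF s\<in>{s. 0 < s \<and> x + X s \<omega> \<notin> B}. ereal s)"

text \<open>
  The transition density of the killed process is its (unique) jointly continuous version.
\<close>

definition killed_transition_density ::
  "'a::euclidean_space set \<Rightarrow> 'w measure \<Rightarrow> (real \<Rightarrow> 'w \<Rightarrow> 'a) \<Rightarrow>
     (real \<Rightarrow> 'a \<Rightarrow> 'a \<Rightarrow> real) \<Rightarrow> bool" where
  "killed_transition_density B N X p \<longleftrightarrow>
     continuous_on ({0<..} \<times> B \<times> B) (\<lambda>(t, x, y). p t x y) \<and>
     (\<forall>t>0. \<forall>x\<in>B. \<forall>y\<in>B. 0 \<le> p t x y) \<and>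
     (\<forall>t>0. \<forall>x\<in>B. \<forall>A\<in>sets borel. A \<subseteq> B \<longrightarrow>
        emeasure (completion N)
          {\<omega> \<in> space N. x + X t \<omega> \<in> A \<and> ereal t < exit_time B X x \<omega>}
        = (\<integral>\<^sup>+y\<in>A. ennreal (p t x y) \<partial>lborel))"

definition green_function ::
  "(real \<Rightarrow> 'a \<Rightarrow> 'a \<Rightarrow> real) \<Rightarrow> (real \<Rightarrow> real \<Rightarrow> real) \<Rightarrow>
     real \<Rightarrow> 'a \<Rightarrow> 'a \<Rightarrow> real" where
  "green_function p fE t x y = (LINT s:{0<..}|lborel. p s x y * fE t s)"

definition L2_on :: "'a::euclidean_space set \<Rightarrow> ('a \<Rightarrow> real) \<Rightarrow> bool" where
  "L2_on B f \<longleftrightarrow>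
     set_borel_measurable lborel B f \<and> set_integrable lborel B (\<lambda>x. (f x)\<^sup>2)"

definition killed_semigroup ::
  "'a::euclidean_space set \<Rightarrow> (real \<Rightarrow> 'a \<Rightarrow> 'a \<Rightarrow> real) \<Rightarrow> real \<Rightarrow> ('a \<Rightarrow> real) \<Rightarrow> 'a \<Rightarrow> real"
  where "killed_semigroup B p t f x = (LINT y:B|lborel. p t x y * f y)"

text \<open>
  \<open>killed_generator B p f g\<close>: \<open>f\<close> lies in the domain of the \<open>L\<^sup>2(B)\<close>-generator \<open>A\<close> of the killed
  process and \<open>A f = g\<close>.
\<close>

definition killed_generator ::
  "'a::euclidean_space set \<Rightarrow> (real \<Rightarrow> 'a \<Rightarrow> 'a \<Rightarrow> real) \<Rightarrow> ('a \<Rightarrow> real) \<Rightarrow> ('a \<Rightarrow> real) \<Rightarrow> bool"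
  where
  "killed_generator B p f g \<longleftrightarrow>
     L2_on B f \<and> L2_on B g \<and>
     ((\<lambda>t. \<integral>\<^sup>+x\<in>B. ennreal (((killed_semigroup B p t f x - f x) / t - g x)\<^sup>2) \<partial>lborel)
        \<longlongrightarrow> 0) (at_right 0)"

text \<open>
  The generator of the killed process is \<open>-\<nu>(-\<Delta>)\<^bsup>\<alpha>/2\<^esup>\<close>, so \<open>\<mu> n\<close> is the \<open>n\<close>-th Dirichlet
  eigenvalue of \<open>(-\<Delta>)\<^bsup>\<alpha>/2\<^esup>\<close>; indices start at 1.
\<close>

definition dirichlet_eigenbasis ::
  "'a::euclidean_space set \<Rightarrow> (real \<Rightarrow> 'a \<Rightarrow> 'a \<Rightarrow> real) \<Rightarrow> real \<Rightarrow>
     (nat \<Rightarrow> real) \<Rightarrow> (nat \<Rightarrow> 'a \<Rightarrow> real) \<Rightarrow> bool" where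
  "dirichlet_eigenbasis B p \<nu> \<mu> \<phi> \<longleftrightarrow>
     (\<forall>n\<ge>1. killed_generator B p (\<phi> n) (\<lambda>x. - \<nu> * \<mu> n * \<phi> n x)) \<and>
     mono_on {1..} \<mu> \<and>
     (\<forall>m\<ge>1. \<forall>n\<ge>1. (LINT x:B|lborel. \<phi> m x * \<phi> n x) = (if m = n then 1 else 0)) \<and>
     (\<forall>h. L2_on B h \<and> (\<forall>n\<ge>1. (LINT x:B|lborel. h x * \<phi> n x) = 0) \<longrightarrow>
        (AE x in lborel. x \<in> B \<longrightarrow> h x = 0)) \<and>
     (\<forall>x\<in>B. 0 < \<phi> 1 x)"

fun iter_pderiv :: "'a::euclidean_space list \<Rightarrow> ('a \<Rightarrow> complex) \<Rightarrow> 'a \<Rightarrow> complex" where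
  "iter_pderiv [] f = f"
| "iter_pderiv (v # vs) f = (\<lambda>x. frechet_derivative (iter_pderiv vs f) (at x) v)"

definition schwartz_function :: "('a::euclidean_space \<Rightarrow> complex) \<Rightarrow> bool" where
  "schwartz_function \<psi> \<longleftrightarrow>
     (\<forall>vs. set vs \<subseteq> Basis \<longrightarrow>
        (\<forall>x. iter_pderiv vs \<psi> differentiable (at x)) \<and>
        (\<forall>k::nat. bounded (range (\<lambda>x. (1 + norm x) ^ k *\<^sub>R iter_pderiv vs \<psi> x))))"

definition fourier :: "('a::euclidean_space \<Rightarrow> complex) \<Rightarrow> 'a \<Rightarrow> complex" where
  "fourier \<psi> \<xi> = (\<integral>x. iexp (- (\<xi> \<bullet> x)) * \<psi> x \<partial>lborel)"

text \<open>
  A covariance such as a Riesz kernel is not integrable; its Fourier transform is taken in the sense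
  of tempered distributions and is required to be a function.
\<close>

definition has_fourier_transform ::
  "('a::euclidean_space \<Rightarrow> real) \<Rightarrow> ('a \<Rightarrow> complex) \<Rightarrow> bool" where
  "has_fourier_transform g ghat \<longleftrightarrow>
     (\<forall>\<psi>. schwartz_function \<psi> \<longrightarrow>
        integrable lborel (\<lambda>x. complex_of_real (g x) * fourier \<psi> x) \<and>
        integrable lborel (\<lambda>\<xi>. ghat \<xi> * \<psi> \<xi>) \<and>
        (\<integral>x. complex_of_real (g x) * fourier \<psi> x \<partial>lborel) = (\<integral>\<xi>. ghat \<xi> * \<psi> \<xi> \<partial>lborel))"

datatype 'a noise_kind = White | Colored "'a \<Rightarrow> 'a \<Rightarrow> real"

text \<open>
  The spatial covariance of a colored noise. The function \<open>g\<close> may be singular at 0, where its value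
  is irrelevant. Local integrability of \<open>f\<close> is what makes the covariance of the noise meaningful.
\<close>

definition colored_covariance ::
  "real \<Rightarrow> ('a::euclidean_space \<Rightarrow> 'a \<Rightarrow> real) \<Rightarrow> bool" where
  "colored_covariance \<alpha> f \<longleftrightarrow>
     (\<forall>r. set_integrable lborel (cball 0 r \<times> cball 0 r) (\<lambda>(x, y). f x y)) \<and>
     (\<exists>g ghat.
        (\<forall>x y. x \<noteq> y \<longrightarrow> f x y \<le> g (x - y)) \<and>
        (\<forall>r. set_integrable lborel (cball 0 r) g) \<and>
        has_fourier_transform g ghat \<and>
        integrable lborel (\<lambda>\<xi>. ghat \<xi> / complex_of_real (1 + norm \<xi> powr \<alpha>)))"

text \<open>
  The noise \<open>F\<close> is a random set function on the bounded Borel subsets of \<open>[0,\<infinity>) \<times> \<real>\<^sup>d\<close>,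
  \<open>F S = \<integral>\<^sub>S F(ds dy)\<close>.
\<close>

definition noise_sets :: "(real \<times> 'a::euclidean_space) set set" where
  "noise_sets = {S \<in> sets borel. bounded S \<and> S \<subseteq> {0..} \<times> UNIV}"

definition centered_gaussian :: "'w measure \<Rightarrow> ('w \<Rightarrow> real) \<Rightarrow> bool" where
  "centered_gaussian M Z \<longleftrightarrow>
     Z \<in> borel_measurable M \<and>
     ((AE \<omega> in M. Z \<omega> = 0) \<or>
      (\<exists>s>0. distributed M lborel Z (\<lambda>z. ennreal (normal_density 0 s z))))"

fun noise_covariance ::
  "'a::euclidean_space noise_kind \<Rightarrow> (real \<times> 'a) set \<Rightarrow> (real \<times> 'a) set \<Rightarrow> real" where
  "noise_covariance White S S' = measure lborel (S \<inter> S')"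
| "noise_covariance (Colored f) S S' =
     (\<integral>(t, x, y). indicator S (t, x) * indicator S' (t, y) * f x y \<partial>lborel)"

definition gaussian_noise ::
  "'w measure \<Rightarrow> 'a::euclidean_space noise_kind \<Rightarrow> ((real \<times> 'a) set \<Rightarrow> 'w \<Rightarrow> real) \<Rightarrow> bool" where
  "gaussian_noise M \<kappa> F \<longleftrightarrow>
     prob_space M \<and>
     (\<forall>J c. finite J \<and> J \<subseteq> noise_sets \<longrightarrow>
        centered_gaussian M (\<lambda>\<omega>. \<Sum>S\<in>J. c S * F S \<omega>)) \<and>
     (\<forall>S\<in>noise_sets. \<forall>S'\<in>noise_sets.
        (\<integral>\<omega>. F S \<omega> * F S' \<omega> \<partial>M) = noise_covariance \<kappa> S S')"

text \<open>The filtration generated by the noise, augmented by the null sets.\<close>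

definition noise_filtration ::
  "'w measure \<Rightarrow> ((real \<times> 'a::euclidean_space) set \<Rightarrow> 'w \<Rightarrow> real) \<Rightarrow> real \<Rightarrow> 'w measure" where
  "noise_filtration M F t = sigma (space M)
     ({F S -` U \<inter> space M | S U. S \<in> noise_sets \<and> S \<subseteq> {0..t} \<times> UNIV \<and> U \<in> sets borel}
      \<union> null_sets M)"

text \<open>
  An elementary process \<open>(a, b, A, Z)\<close> stands for \<open>Z(\<omega>) 1\<^bsub>(a,b]\<^esub>(s) 1\<^sub>A(y)\<close>; a simple process is a finite
  sum of elementary ones.
\<close>

type_synonym ('a, 'w) elementary = "real \<times> real \<times> 'a set \<times> ('w \<Rightarrow> real)"

definition elementary_process ::
  "'w measure \<Rightarrow> ((real \<times> 'a::euclidean_space) set \<Rightarrow> 'w \<Rightarrow> real) \<Rightarrow> ('a, 'w) elementary \<Rightarrow> bool"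
  where
  "elementary_process M F e \<longleftrightarrow>
     (case e of (a, b, A, Z) \<Rightarrow>
        0 \<le> a \<and> a < b \<and> A \<in> sets borel \<and> bounded A \<and>
        Z \<in> borel_measurable (noise_filtration M F a) \<and>
        (\<exists>C. \<forall>\<omega>\<in>space M. \<bar>Z \<omega>\<bar> \<le> C))"

definition simple_process ::
  "('a, 'w) elementary list \<Rightarrow> real \<Rightarrow> 'a \<Rightarrow> 'w \<Rightarrow> real" where
  "simple_process es s y \<omega> =
     (\<Sum>(a, b, A, Z)\<leftarrow>es. Z \<omega> * indicator {a<..b} s * indicator A y)"

definition simple_integral ::
  "((real \<times> 'a) set \<Rightarrow> 'w \<Rightarrow> real) \<Rightarrow> ('a, 'w) elementary list \<Rightarrow> 'w \<Rightarrow> real" where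
  "simple_integral F es \<omega> = (\<Sum>(a, b, A, Z)\<leftarrow>es. Z \<omega> * F ({a<..b} \<times> A) \<omega>)"

text \<open>The square of Walsh's norm, with \<open>\<delta>\<^sub>0(x - y)\<close> respectively \<open>\<bar>f\<bar>\<close> as dominating measure.\<close>

fun walsh_norm2 ::
  "'w measure \<Rightarrow> 'a::euclidean_space noise_kind \<Rightarrow> (real \<Rightarrow> 'a \<Rightarrow> 'w \<Rightarrow> real) \<Rightarrow> ennreal" where
  "walsh_norm2 M White h =
     (\<integral>\<^sup>+\<omega>. \<integral>\<^sup>+s. \<integral>\<^sup>+y. ennreal ((h s y \<omega>)\<^sup>2) \<partial>lborel \<partial>lborel \<partial>M)"
| "walsh_norm2 M (Colored f) h =
     (\<integral>\<^sup>+\<omega>. \<integral>\<^sup>+s. \<integral>\<^sup>+x. \<integral>\<^sup>+y. ennreal (\<bar>h s x \<omega>\<bar> * \<bar>f x y\<bar> * \<bar>h s y \<omega>\<bar>)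
        \<partial>lborel \<partial>lborel \<partial>lborel \<partial>M)"

definition has_walsh_integral ::
  "'w measure \<Rightarrow> 'a::euclidean_space noise_kind \<Rightarrow> ((real \<times> 'a) set \<Rightarrow> 'w \<Rightarrow> real) \<Rightarrow>
     (real \<Rightarrow> 'a \<Rightarrow> 'w \<Rightarrow> real) \<Rightarrow> ('w \<Rightarrow> real) \<Rightarrow> bool" where
  "has_walsh_integral M \<kappa> F h I \<longleftrightarrow>
     (\<lambda>(s, y, \<omega>). h s y \<omega>) \<in> borel_measurable (borel \<Otimes>\<^sub>M borel \<Otimes>\<^sub>M M) \<and>
     I \<in> borel_measurable M \<and>
     (\<exists>es. (\<forall>n::nat. \<forall>e\<in>set (es n). elementary_process M F e) \<and>
        ((\<lambda>n. walsh_norm2 M \<kappa> (\<lambda>s y \<omega>. h s y \<omega> - simple_process (es n) s y \<omega>))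
           \<longlonglongrightarrow> 0) \<and>
        ((\<lambda>n. \<integral>\<^sup>+\<omega>. ennreal ((I \<omega> - simple_integral F (es n) \<omega>)\<^sup>2) \<partial>M) \<longlonglongrightarrow> 0))"

text \<open>
  The parameter \<open>G\<close> is the kernel \<open>G\<^sub>B\<close>. As it is singular at time 0, the initial condition is imposed
  separately.
\<close>

definition mild_solution ::
  "'a::euclidean_space set \<Rightarrow> (real \<Rightarrow> 'a \<Rightarrow> 'a \<Rightarrow> real) \<Rightarrow> (real \<Rightarrow> real) \<Rightarrow> (real \<Rightarrow> real) \<Rightarrow>
     'w measure \<Rightarrow> 'a noise_kind \<Rightarrow> ((real \<times> 'a) set \<Rightarrow> 'w \<Rightarrow> real) \<Rightarrow>
     ('a \<Rightarrow> real) \<Rightarrow> real \<Rightarrow> (real \<Rightarrow> 'a \<Rightarrow> 'w \<Rightarrow> real) \<Rightarrow> bool" where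
  "mild_solution B G b \<sigma> M \<kappa> F u0 T u \<longleftrightarrow>
     (\<lambda>(t, x, \<omega>). u t x \<omega>)
       \<in> borel_measurable (restrict_space borel {0..T} \<Otimes>\<^sub>M restrict_space borel B \<Otimes>\<^sub>M M) \<and>
     (\<forall>t\<in>{0..T}. \<forall>x\<in>B. u t x \<in> borel_measurable (noise_filtration M F t)) \<and>
     (\<forall>x\<in>B. AE \<omega> in M. u 0 x \<omega> = u0 x) \<and>
     (\<forall>t\<in>{0<..T}. \<forall>x\<in>B.
        (\<exists>I. has_walsh_integral M \<kappa> F
               (\<lambda>s y \<omega>. indicator {0<..<t} s * indicator B y * (G (t - s) x y * \<sigma> (u s y \<omega>))) I \<and>
           (AE \<omega> in M.
              set_integrable lborel ({0<..<t} \<times> B) (\<lambda>(s, y). b (u s y \<omega>) * G (t - s) x y) \<and>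
              u t x \<omega> =
                (LINT y:B|lborel. G t x y * u0 y)
                + (LINT y:B|lborel. LINT s:{0<..<t}|lborel. b (u s y \<omega>) * G (t - s) x y)
                + I \<omega>)))"

definition random_field_solution ::
  "'a::euclidean_space set \<Rightarrow> (real \<Rightarrow> 'a \<Rightarrow> 'a \<Rightarrow> real) \<Rightarrow> (real \<Rightarrow> real) \<Rightarrow> (real \<Rightarrow> real) \<Rightarrow>
     'w measure \<Rightarrow> 'a noise_kind \<Rightarrow> ((real \<times> 'a) set \<Rightarrow> 'w \<Rightarrow> real) \<Rightarrow>
     ('a \<Rightarrow> real) \<Rightarrow> real \<Rightarrow> (real \<Rightarrow> 'a \<Rightarrow> 'w \<Rightarrow> real) \<Rightarrow> bool" where
  "random_field_solution B G b \<sigma> M \<kappa> F u0 T u \<longleftrightarrow>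
     mild_solution B G b \<sigma> M \<kappa> F u0 T u \<and>
     (\<forall>k\<ge>2. (SUP x\<in>B. SUP t\<in>{0..T}. \<integral>\<^sup>+\<omega>. ennreal (\<bar>u t x \<omega>\<bar> powr k) \<partial>M) < \<infinity>)"

definition global_random_field_solution ::
  "'a::euclidean_space set \<Rightarrow> (real \<Rightarrow> 'a \<Rightarrow> 'a \<Rightarrow> real) \<Rightarrow> (real \<Rightarrow> real) \<Rightarrow> (real \<Rightarrow> real) \<Rightarrow>
     'w measure \<Rightarrow> 'a noise_kind \<Rightarrow> ((real \<times> 'a) set \<Rightarrow> 'w \<Rightarrow> real) \<Rightarrow>
     ('a \<Rightarrow> real) \<Rightarrow> (real \<Rightarrow> 'a \<Rightarrow> 'w \<Rightarrow> real) \<Rightarrow> bool" where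
  "global_random_field_solution B G b \<sigma> M \<kappa> F u0 u \<longleftrightarrow>
     (\<forall>T>0. random_field_solution B G b \<sigma> M \<kappa> F u0 T u)"

definition initial_condition :: "'a::euclidean_space set \<Rightarrow> ('a \<Rightarrow> real) \<Rightarrow> bool" where
  "initial_condition B u0 \<longleftrightarrow>
     set_borel_measurable lborel B u0 \<and> (\<forall>x\<in>B. 0 \<le> u0 x) \<and> bounded (u0 ` B)"

end

theory Submission
  imports Defs
begin

text \<open>
  A Walsh integral has mean zero, so the mean \<open>v\<close> of a solution satisfies, by Jensen's inequality,
  \<open>v t x \<ge> \<integral> G t x y * u0 y dy + \<integral>\<integral> G (t - s) x y * \<bar>v s y\<bar> powr (1 + \<eta>) dy ds\<close>. Integrate this against
  \<open>\<phi> 1\<close>: since \<open>\<phi> 1\<close> is an eigenfunction of the adjoint of the killed semigroup, with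
  \<open>l = \<nu> * \<mu> 1\<close> the Green function contributes the factor \<open>E (exp (- l * E\<^sub>t))\<close>, which is at least
  \<open>exp (- \<bar>l\<bar>) * P (D\<^sub>1 > t) \<ge> c * (1 + t) powr (- \<beta>)\<close>. With Jensen's inequality again,
  \<open>k t = \<integral> \<phi> 1 x * \<bar>v t x\<bar> dx\<close> satisfies
  \<open>(1 + t) powr \<beta> * k t \<ge> c * K + C * \<integral> k s powr (1 + \<eta>) ds\<close>, and a solution of this inequality cannot
  stay finite beyond the time at which \<open>\<eta> * C * \<integral> (1 + s) powr (- \<beta> * (1 + \<eta>)) ds\<close> reaches
  \<open>(c * K) powr (- \<eta>)\<close>. That integral diverges if and only if \<open>\<beta> * (1 + \<eta>) \<le> 1\<close>.

  Neither quasi-left-continuity nor symmetry of the killed process is needed: for almost every starting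
  point the survival event is determined by the dyadic times, and the adjoint eigenvalue equation follows
  from the completeness of the eigenfunctions.
\<close>

section \<open>Walsh integrals have mean zero\<close>

text \<open>The noise is given only through the laws of its finite linear combinations, while the
  coefficients of a simple process are arbitrary bounded variables of the augmented past. What has
  to be shown is thus that a future increment of the noise is orthogonal to all of these;
  characteristic functions provide it. The killed density is prescribed at single times only, so its
  semigroup law must be recovered from the paths. Discretisation along dyadic times yields the exact
  rule for doubling a time, and doubling suffices: an eigenfunction of the generator obeys the
  exponential law up to o(t) in L2 as t tends to 0, and repeated doubling carries this to any fixed
  time. The price is that identities hold for almost every starting point only, which is harmless
  after integration against \<open>\<phi> 1\<close>. Most integrals take values in [0, infinity], so
  that Tonelli applies before any finiteness is known. Finiteness enters late, through the moment
  bound of a solution, and it is this bound that the blow-up contradicts.\<close>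

lemma centered_gaussian_char:
  assumes "prob_space M" "centered_gaussian M Z"
  shows "integrable M (\<lambda>\<omega>. (Z \<omega>)\<^sup>2)"
    and "(\<integral>\<omega>. iexp (Z \<omega>) \<partial>M) = complex_of_real (exp (- (\<integral>\<omega>. (Z \<omega>)\<^sup>2 \<partial>M) / 2))"
proof -
  interpret prob_space M by fact
  have Z[measurable]: "Z \<in> borel_measurable M"
    using assms(2) by (simp add: centered_gaussian_def)
  have "integrable M (\<lambda>\<omega>. (Z \<omega>)\<^sup>2) \<and>
    (\<integral>\<omega>. iexp (Z \<omega>) \<partial>M) = complex_of_real (exp (- (\<integral>\<omega>. (Z \<omega>)\<^sup>2 \<partial>M) / 2))"
  proof (cases "AE \<omega> in M. Z \<omega> = 0")
    case True
    have 1: "AE \<omega> in M. (Z \<omega>)\<^sup>2 = 0" "AE \<omega> in M. iexp (Z \<omega>) = 1"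
      using True by auto
    have "integrable M (\<lambda>\<omega>. (Z \<omega>)\<^sup>2)" using 1(1)
      by (subst integrable_cong_AE[where g="\<lambda>_. 0"]) auto
    moreover have "(\<integral>\<omega>. (Z \<omega>)\<^sup>2 \<partial>M) = (\<integral>\<omega>. 0 \<partial>M)"
      using 1(1) by (intro integral_cong_AE) auto
    moreover have "(\<integral>\<omega>. iexp (Z \<omega>) \<partial>M) = (\<integral>\<omega>. 1 \<partial>M)"
      using 1(2) by (intro integral_cong_AE) auto
    ultimately show ?thesis by (simp add: prob_space)
  next
    case False
    then obtain s where s: "s > 0"
      and d: "distributed M lborel Z (\<lambda>z. ennreal (normal_density 0 s z))"
      using assms(2) by (auto simp: centered_gaussian_def)
    have d': "distributed M lborel (\<lambda>\<omega>. (Z \<omega> - 0) / s) (\<lambda>z. ennreal (std_normal_density z))"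
      using normal_standard_normal_convert[OF s, of Z 0] d by simp
    have i2: "integrable M (\<lambda>\<omega>. (Z \<omega>)\<^sup>2)"
      using distributed_integrable[OF d, of "\<lambda>x. x\<^sup>2"] integrable_normal_moment[OF s, of 0 2] by simp
    have v2: "(\<integral>\<omega>. (Z \<omega>)\<^sup>2 \<partial>M) = s\<^sup>2"
    proof -
      have "variance Z = s\<^sup>2" "expectation Z = 0"
        using normal_distributed_variance[OF s d] normal_distributed_expectation[OF s d] by auto
      then show ?thesis by simp
    qed
    have "std_normal_distribution = distr M lborel (\<lambda>\<omega>. (Z \<omega> - 0) / s)"
      using distributed_distr_eq_density[OF d'] by simp
    then have "char std_normal_distribution s = (CLINT x|distr M lborel (\<lambda>\<omega>. (Z \<omega> - 0) / s). iexp (s * x))"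
      unfolding char_def by (simp only:)
    also have "\<dots> = (\<integral>\<omega>. iexp (s * ((Z \<omega> - 0) / s)) \<partial>M)"
      by (rule integral_distr) simp_all
    finally have "(\<integral>\<omega>. iexp (s * ((Z \<omega> - 0) / s)) \<partial>M) = char std_normal_distribution s" by (rule sym)
    also have "\<dots> = complex_of_real (exp (- s\<^sup>2 / 2))"
      by (simp add: char_std_normal_distribution)
    finally have "(\<integral>\<omega>. iexp (s * ((Z \<omega> - 0) / s)) \<partial>M) = complex_of_real (exp (- s\<^sup>2 / 2))" .
    moreover have "s * ((Z \<omega> - 0) / s) = Z \<omega>" for \<omega> using s by simp
    ultimately show ?thesis using i2 v2 by (simp only:)
  qed
  then show "integrable M (\<lambda>\<omega>. (Z \<omega>)\<^sup>2)"
    "(\<integral>\<omega>. iexp (Z \<omega>) \<partial>M) = complex_of_real (exp (- (\<integral>\<omega>. (Z \<omega>)\<^sup>2 \<partial>M) / 2))"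
    by auto
qed

text \<open>The positive and negative parts of \<open>Y\<close>, normalised by their common mass
  \<open>c\<close>, are densities of two probability measures under which \<open>V\<close> has the
  same characteristic function; Levy's uniqueness theorem identifies the two laws of
  \<open>V\<close>. Frequency 0 makes the masses equal, and \<open>c = 0\<close> is treated apart
  because of the normalisation.\<close>

lemma (in prob_space) fourier_zero_imp_set_zero_real:
  fixes Y V :: "'a \<Rightarrow> real"
  assumes Y: "integrable M Y" and V[measurable]: "V \<in> borel_measurable M"
    and z: "\<And>t. (\<integral>\<omega>. complex_of_real (Y \<omega>) * iexp (t * V \<omega>) \<partial>M) = 0"
    and U[measurable]: "U \<in> sets borel"
  shows "(\<integral>\<omega>. Y \<omega> * indicator (V -` U) \<omega> \<partial>M) = 0"
proof -
  have Ym[measurable]: "Y \<in> borel_measurable M" using Y by auto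
  define Yp where "Yp = (\<lambda>\<omega>. max 0 (Y \<omega>))"
  define Yn where "Yn = (\<lambda>\<omega>. max 0 (- Y \<omega>))"
  have [measurable]: "Yp \<in> borel_measurable M" "Yn \<in> borel_measurable M"
    unfolding Yp_def Yn_def by auto
  have ip: "integrable M Yp" "integrable M Yn" unfolding Yp_def Yn_def using Y by auto
  have pos: "0 \<le> Yp \<omega>" "0 \<le> Yn \<omega>" "Y \<omega> = Yp \<omega> - Yn \<omega>" for \<omega>
    by (auto simp: Yp_def Yn_def)
  have int_exp: "integrable M (\<lambda>\<omega>. complex_of_real (W \<omega>) * iexp (t * V \<omega>))"
    if "integrable M W" for W and t
  proof -
    have "W \<in> borel_measurable M" using that by auto
    then show ?thesis
      by (intro Bochner_Integration.integrable_bound[OF that]) (auto simp: norm_mult)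
  qed
  have eqe: "(\<integral>\<omega>. complex_of_real (Yp \<omega>) * iexp (t * V \<omega>) \<partial>M)
      = (\<integral>\<omega>. complex_of_real (Yn \<omega>) * iexp (t * V \<omega>) \<partial>M)" for t
  proof -
    have "0 = (\<integral>\<omega>. complex_of_real (Yp \<omega>) * iexp (t * V \<omega>)
        - complex_of_real (Yn \<omega>) * iexp (t * V \<omega>) \<partial>M)"
      using z[of t] by (simp add: pos(3) left_diff_distrib)
    then show ?thesis using int_exp[OF ip(1)] int_exp[OF ip(2)] by simp
  qed
  define c where "c = (\<integral>\<omega>. Yp \<omega> \<partial>M)"
  have cn: "c = (\<integral>\<omega>. Yn \<omega> \<partial>M)"
  proof -
    have "complex_of_real (\<integral>\<omega>. Yp \<omega> \<partial>M) = complex_of_real (\<integral>\<omega>. Yn \<omega> \<partial>M)"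
      using eqe[of 0] by simp
    then show ?thesis unfolding c_def using of_real_eq_iff by blast
  qed
  have c0: "0 \<le> c" unfolding c_def using pos by simp
  show ?thesis
  proof (cases "c = 0")
    case True
    have "AE \<omega> in M. Yp \<omega> = 0" "AE \<omega> in M. Yn \<omega> = 0"
      using True c_def cn integral_nonneg_eq_0_iff_AE[OF ip(1)] integral_nonneg_eq_0_iff_AE[OF ip(2)]
        pos by auto
    then have "AE \<omega> in M. Y \<omega> * indicator (V -` U) \<omega> = 0" by eventually_elim (simp add: pos(3))
    then show ?thesis by (rule integral_eq_zero_AE)
  next
    case False
    then have cp: "0 < c" using c0 by simp
    define Q where "Q W = distr (density M (\<lambda>\<omega>. ennreal (W \<omega> / c))) borel V" for W
    have Q: "real_distribution (Q W)"
        "char (Q W) t = (\<integral>\<omega>. complex_of_real (W \<omega>) * iexp (t * V \<omega>) \<partial>M) / c"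
        "measure (Q W) U = (\<integral>\<omega>. W \<omega> * indicator (V -` U) \<omega> \<partial>M) / c"
      if W: "integrable M W" and [measurable]: "W \<in> borel_measurable M" and Wp: "\<And>\<omega>. 0 \<le> W \<omega>"
        and cW: "c = (\<integral>\<omega>. W \<omega> \<partial>M)" for W t
    proof -
      have "(\<integral>\<^sup>+\<omega>. ennreal (W \<omega> / c) \<partial>M) = ennreal (\<integral>\<omega>. W \<omega> / c \<partial>M)"
        using W Wp cp by (intro nn_integral_eq_integral) auto
      also have "(\<integral>\<omega>. W \<omega> / c \<partial>M) = 1" using cW cp by simp
      finally have "prob_space (density M (\<lambda>\<omega>. ennreal (W \<omega> / c)))"
        by (intro prob_spaceI) (simp add: emeasure_density cong: nn_integral_cong)
      then interpret D: prob_space "density M (\<lambda>\<omega>. ennreal (W \<omega> / c))" .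
      show "real_distribution (Q W)" unfolding Q_def by (intro D.real_distribution_distr) simp
      show "char (Q W) t = (\<integral>\<omega>. complex_of_real (W \<omega>) * iexp (t * V \<omega>) \<partial>M) / c"
        unfolding char_def Q_def using Wp cp
        by (simp add: integral_distr integral_density scaleR_conv_of_real)
      have "measure (Q W) U = (\<integral>x. indicator U x \<partial>Q W)" by (simp add: Q_def)
      also have "\<dots> = (\<integral>\<omega>. indicator U (V \<omega>) \<partial>density M (\<lambda>\<omega>. ennreal (W \<omega> / c)))"
        unfolding Q_def by (rule integral_distr) simp_all
      also have "\<dots> = (\<integral>\<omega>. (W \<omega> / c) *\<^sub>R indicator U (V \<omega>) \<partial>M)"
        using Wp cp by (intro integral_density) auto
      also have "\<dots> = (\<integral>\<omega>. W \<omega> * indicator (V -` U) \<omega> / c \<partial>M)"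
        by (intro Bochner_Integration.integral_cong) (auto split: split_indicator)
      finally show "measure (Q W) U = (\<integral>\<omega>. W \<omega> * indicator (V -` U) \<omega> \<partial>M) / c" by simp
    qed
    have "Q Yp = Q Yn"
      using Q[OF ip(1)] Q[OF ip(2)] pos c_def cn eqe by (intro Levy_uniqueness ext) auto
    then have "(\<integral>\<omega>. Yp \<omega> * indicator (V -` U) \<omega> \<partial>M) = (\<integral>\<omega>. Yn \<omega> * indicator (V -` U) \<omega> \<partial>M)"
      using Q(3)[OF ip(1)] Q(3)[OF ip(2)] pos c_def cn cp by simp
    moreover have "integrable M (\<lambda>\<omega>. W \<omega> * indicator (V -` U) \<omega>)" if "integrable M W" for W :: "'a \<Rightarrow> real"
    proof -
      have [measurable]: "W \<in> borel_measurable M" using that by auto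
      have "(\<lambda>\<omega>. W \<omega> * indicator U (V \<omega>)) \<in> borel_measurable M" by measurable
      then have "(\<lambda>\<omega>. W \<omega> * indicator (V -` U) \<omega>) \<in> borel_measurable M"
        by (simp add: indicator_def)
      then show ?thesis
        by (intro Bochner_Integration.integrable_bound[OF that]) (auto split: split_indicator)
    qed
    ultimately show ?thesis using ip by (simp add: pos(3) left_diff_distrib)
  qed
qed

text \<open>Conjugating the hypothesis at frequency \<open>- t\<close> gives it for
  \<open>cnj Y\<close>, so the real and imaginary parts of \<open>Y\<close> inherit it and the real
  case applies to each.\<close>

lemma (in prob_space) fourier_zero_imp_set_zero:
  fixes Y :: "'a \<Rightarrow> complex" and V :: "'a \<Rightarrow> real"
  assumes Y: "integrable M Y" and V[measurable]: "V \<in> borel_measurable M"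
    and z: "\<And>t. (\<integral>\<omega>. Y \<omega> * iexp (t * V \<omega>) \<partial>M) = 0"
    and U: "U \<in> sets borel"
  shows "(\<integral>\<omega>. Y \<omega> * indicator (V -` U) \<omega> \<partial>M) = 0"
proof -
  have Ym[measurable]: "Y \<in> borel_measurable M" using Y by auto
  have int_exp: "integrable M (\<lambda>\<omega>. W \<omega> * iexp (t * V \<omega>))"
    if "integrable M W" for W :: "'a \<Rightarrow> complex" and t
  proof -
    have "W \<in> borel_measurable M" using that by auto
    then show ?thesis
      by (intro Bochner_Integration.integrable_bound[OF that]) (auto simp: norm_mult)
  qed
  have icnj: "integrable M (\<lambda>\<omega>. cnj (Y \<omega>))" using Y by simp
  have zc: "(\<integral>\<omega>. cnj (Y \<omega>) * iexp (t * V \<omega>) \<partial>M) = 0" for t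
  proof -
    have "(\<integral>\<omega>. cnj (Y \<omega>) * iexp (t * V \<omega>) \<partial>M) = (\<integral>\<omega>. cnj (Y \<omega> * iexp (- t * V \<omega>)) \<partial>M)"
      by (intro Bochner_Integration.integral_cong) (auto simp: exp_cnj)
    also have "\<dots> = cnj (\<integral>\<omega>. Y \<omega> * iexp (- t * V \<omega>) \<partial>M)" by (rule Bochner_Integration.integral_cnj)
    finally show ?thesis using z[of "- t"] by simp
  qed
  have re: "(\<integral>\<omega>. Re (Y \<omega>) * indicator (V -` U) \<omega> \<partial>M) = 0"
  proof (rule fourier_zero_imp_set_zero_real[OF _ V _ U])
    fix t
    have "(\<integral>\<omega>. complex_of_real (Re (Y \<omega>)) * iexp (t * V \<omega>) \<partial>M)
      = (\<integral>\<omega>. (Y \<omega> * iexp (t * V \<omega>) + cnj (Y \<omega>) * iexp (t * V \<omega>)) / 2 \<partial>M)"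
      by (intro Bochner_Integration.integral_cong refl)
         (simp add: distrib_right[symmetric] complex_add_cnj)
    also have "\<dots> = 0" using int_exp[OF Y] int_exp[OF icnj] z zc by simp
    finally show "(\<integral>\<omega>. complex_of_real (Re (Y \<omega>)) * iexp (t * V \<omega>) \<partial>M) = 0" .
  qed (use Y in auto)
  have im: "(\<integral>\<omega>. Im (Y \<omega>) * indicator (V -` U) \<omega> \<partial>M) = 0"
  proof (rule fourier_zero_imp_set_zero_real[OF _ V _ U])
    fix t
    have "(\<integral>\<omega>. complex_of_real (Im (Y \<omega>)) * iexp (t * V \<omega>) \<partial>M)
      = (\<integral>\<omega>. (Y \<omega> * iexp (t * V \<omega>) - cnj (Y \<omega>) * iexp (t * V \<omega>)) / (2 * \<i>) \<partial>M)"
    proof (intro Bochner_Integration.integral_cong refl)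
      fix \<omega>
      have "complex_of_real (Im (Y \<omega>)) = (Y \<omega> - cnj (Y \<omega>)) / (2 * \<i>)"
        by (simp add: complex_eq_iff)
      then show "complex_of_real (Im (Y \<omega>)) * iexp (t * V \<omega>) =
          (Y \<omega> * iexp (t * V \<omega>) - cnj (Y \<omega>) * iexp (t * V \<omega>)) / (2 * \<i>)"
        by (simp only: left_diff_distrib[symmetric] times_divide_eq_left)
    qed
    also have "\<dots> = 0" using int_exp[OF Y] int_exp[OF icnj] z zc by simp
    finally show "(\<integral>\<omega>. complex_of_real (Im (Y \<omega>)) * iexp (t * V \<omega>) \<partial>M) = 0" .
  qed (use Y in auto)
  have iI: "integrable M (\<lambda>\<omega>. Y \<omega> * indicator (V -` U) \<omega>)"
  proof -
    have "(\<lambda>\<omega>. Y \<omega> * indicator U (V \<omega>)) \<in> borel_measurable M" using U by measurable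
    then have "(\<lambda>\<omega>. Y \<omega> * indicator (V -` U) \<omega>) \<in> borel_measurable M"
      by (simp add: indicator_def)
    then show ?thesis
      by (intro Bochner_Integration.integrable_bound[OF Y]) (auto split: split_indicator)
  qed
  have s: "Re (Y \<omega> * indicator (V -` U) \<omega>) = Re (Y \<omega>) * indicator (V -` U) \<omega>"
     "Im (Y \<omega> * indicator (V -` U) \<omega>) = Im (Y \<omega>) * indicator (V -` U) \<omega>" for \<omega>
    by (auto split: split_indicator)
  show ?thesis
    using re im integral_Re[OF iI] integral_Im[OF iI] unfolding s by (simp add: complex_eq_iff)
qed

section \<open>Orthogonality of the noise after time a to the past\<close>

locale gaussian_noise_space = prob_space M for M :: "'w measure" +
  fixes \<kappa> :: "'a::euclidean_space noise_kind" and F :: "(real \<times> 'a) set \<Rightarrow> 'w \<Rightarrow> real"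
  assumes noise: "gaussian_noise M \<kappa> F"
begin

lemma combination_gaussian:
  "finite J \<Longrightarrow> J \<subseteq> noise_sets \<Longrightarrow> centered_gaussian M (\<lambda>\<omega>. \<Sum>S\<in>J. c S * F S \<omega>)"
  using noise by (auto simp: gaussian_noise_def)

lemma noise_gaussian: "S \<in> noise_sets \<Longrightarrow> centered_gaussian M (F S)"
  using combination_gaussian[of "{S}" "\<lambda>_. 1"] by simp

lemma noise_measurable[measurable]: "S \<in> noise_sets \<Longrightarrow> F S \<in> borel_measurable M"
  using noise_gaussian by (auto simp: centered_gaussian_def)

lemma noise_square_integrable: "S \<in> noise_sets \<Longrightarrow> integrable M (\<lambda>\<omega>. (F S \<omega>)\<^sup>2)"
  using centered_gaussian_char(1)[OF prob_space_axioms noise_gaussian] .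

lemma noise_prod_integrable:
  assumes S: "S \<in> noise_sets" "S' \<in> noise_sets"
  shows "integrable M (\<lambda>\<omega>. F S \<omega> * F S' \<omega>)"
proof (rule Bochner_Integration.integrable_bound)
  show "integrable M (\<lambda>\<omega>. (F S \<omega>)\<^sup>2 + (F S' \<omega>)\<^sup>2)"
    using S noise_square_integrable by auto
  show "(\<lambda>\<omega>. F S \<omega> * F S' \<omega>) \<in> borel_measurable M" using S by measurable
  show "AE \<omega> in M. norm (F S \<omega> * F S' \<omega>) \<le> norm ((F S \<omega>)\<^sup>2 + (F S' \<omega>)\<^sup>2)"
  proof (intro always_eventually allI)
    fix \<omega>
    have "2 * \<bar>F S \<omega>\<bar> * \<bar>F S' \<omega>\<bar> \<le> (F S \<omega>)\<^sup>2 + (F S' \<omega>)\<^sup>2"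
      using sum_squares_bound[of "\<bar>F S \<omega>\<bar>" "\<bar>F S' \<omega>\<bar>"] by simp
    moreover have "0 \<le> \<bar>F S \<omega>\<bar> * \<bar>F S' \<omega>\<bar>" by simp
    ultimately show "norm (F S \<omega> * F S' \<omega>) \<le> norm ((F S \<omega>)\<^sup>2 + (F S' \<omega>)\<^sup>2)"
      unfolding real_norm_def abs_mult by linarith
  qed
qed

lemma noise_integrable:
  assumes "S \<in> noise_sets" shows "integrable M (F S)"
  using square_integrable_imp_integrable[OF noise_measurable noise_square_integrable] assms
  by blast

text \<open>Since \<open>F S'\<close> is uncorrelated with the sum X, the variance of X + t
  \<open>F S'\<close>, hence its characteristic function, is even in \<open>t\<close>; writing the
  sine through exponentials leaves the difference of the values at \<open>t\<close> and
  \<open>- t\<close>. The sine keeps the integrand bounded; the unbounded factor \<open>F S'\<close>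
  arises in the next lemma by a limit.\<close>

lemma sin_orthogonal:
  assumes J: "finite J" "J \<subseteq> noise_sets" and S': "S' \<in> noise_sets"
    and unc: "\<And>S. S \<in> J \<Longrightarrow> noise_covariance \<kappa> S S' = 0"
  shows "(\<integral>\<omega>. iexp (\<Sum>S\<in>J. c S * F S \<omega>) * complex_of_real (sin (t * F S' \<omega>)) \<partial>M) = 0"
proof -
  define X where "X = (\<lambda>\<omega>. \<Sum>S\<in>J. c S * F S \<omega>)"
  have Fm: "\<And>S. S \<in> J \<Longrightarrow> F S \<in> borel_measurable M" using J by auto
  have Xm[measurable]: "X \<in> borel_measurable M" unfolding X_def using Fm by measurable
  have Wm[measurable]: "F S' \<in> borel_measurable M" using S' by auto
  have iX: "integrable M (\<lambda>\<omega>. (X \<omega>)\<^sup>2)"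
    using centered_gaussian_char(1)[OF prob_space_axioms combination_gaussian[OF J]]
    by (simp add: X_def)
  have XW: "(\<lambda>\<omega>. X \<omega> * F S' \<omega>) = (\<lambda>\<omega>. \<Sum>S\<in>J. c S * (F S \<omega> * F S' \<omega>))"
    by (simp add: X_def sum_distrib_right mult.assoc)
  have iFF: "\<And>S. S \<in> J \<Longrightarrow> integrable M (\<lambda>\<omega>. F S \<omega> * F S' \<omega>)"
    using noise_prod_integrable J S' by auto
  have iXW: "integrable M (\<lambda>\<omega>. X \<omega> * F S' \<omega>)"
    unfolding XW using iFF by auto
  have EXW: "(\<integral>\<omega>. X \<omega> * F S' \<omega> \<partial>M) = 0"
  proof -
    have "(\<integral>\<omega>. X \<omega> * F S' \<omega> \<partial>M) = (\<Sum>S\<in>J. c S * (\<integral>\<omega>. F S \<omega> * F S' \<omega> \<partial>M))"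
      unfolding XW using iFF by (subst Bochner_Integration.integral_sum) auto
    also have "\<dots> = 0"
      using noise J S' unc by (intro sum.neutral) (auto simp: gaussian_noise_def subset_iff)
    finally show ?thesis .
  qed
  have char: "(\<integral>\<omega>. iexp (X \<omega> + t * F S' \<omega>) \<partial>M) =
      complex_of_real (exp (- ((\<integral>\<omega>. (X \<omega>)\<^sup>2 \<partial>M) + t\<^sup>2 * (\<integral>\<omega>. (F S' \<omega>)\<^sup>2 \<partial>M)) / 2))" for t
  proof -
    \<comment> \<open>\<open>S'\<close> may itself belong to \<open>J\<close>, so its coefficient in
      the combination collects both contributions.\<close>
    define d where "d S = (if S \<in> J then c S else 0) + (if S = S' then t else 0)" for S
    have "(\<Sum>S\<in>insert S' J. d S * F S \<omega>) = X \<omega> + t * F S' \<omega>" for \<omega>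
    proof -
      have "(\<Sum>S\<in>insert S' J. d S * F S \<omega>) =
          (\<Sum>S\<in>insert S' J. (if S \<in> J then c S else 0) * F S \<omega>)
          + (\<Sum>S\<in>insert S' J. (if S = S' then t else 0) * F S \<omega>)"
        by (simp only: d_def distrib_right sum.distrib)
      also have "(\<Sum>S\<in>insert S' J. (if S \<in> J then c S else 0) * F S \<omega>) = X \<omega>"
        unfolding X_def using J by (intro sum.mono_neutral_cong_right) auto
      also have "(\<Sum>S\<in>insert S' J. (if S = S' then t else 0) * F S \<omega>) = t * F S' \<omega>"
        using J by (subst sum.mono_neutral_cong_right[where S="{S'}" and h="\<lambda>S. t * F S \<omega>"]) auto
      finally show ?thesis .
    qed
    then have g: "centered_gaussian M (\<lambda>\<omega>. X \<omega> + t * F S' \<omega>)"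
      using combination_gaussian[of "insert S' J" d] J S' by simp
    have "(\<integral>\<omega>. (X \<omega> + t * F S' \<omega>)\<^sup>2 \<partial>M) =
        (\<integral>\<omega>. (X \<omega>)\<^sup>2 + 2 * t * (X \<omega> * F S' \<omega>) + t\<^sup>2 * (F S' \<omega>)\<^sup>2 \<partial>M)"
      by (intro Bochner_Integration.integral_cong) (auto simp: power2_eq_square algebra_simps)
    also have "\<dots> = (\<integral>\<omega>. (X \<omega>)\<^sup>2 \<partial>M) + t\<^sup>2 * (\<integral>\<omega>. (F S' \<omega>)\<^sup>2 \<partial>M)"
      using iX iXW noise_square_integrable[OF S'] EXW by simp
    finally show ?thesis using centered_gaussian_char(2)[OF prob_space_axioms g] by simp
  qed
  have ii: "integrable M (\<lambda>\<omega>. iexp (X \<omega> + t * F S' \<omega>))" for t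
    by (intro integrable_iexp) auto
  have "(\<integral>\<omega>. iexp (X \<omega>) * complex_of_real (sin (t * F S' \<omega>)) \<partial>M) =
     (\<integral>\<omega>. (iexp (X \<omega> + t * F S' \<omega>) - iexp (X \<omega> + (- t) * F S' \<omega>)) / (2 * \<i>) \<partial>M)"
  proof (intro Bochner_Integration.integral_cong refl)
    fix \<omega>
    have eq: "complex_of_real (sin (t * F S' \<omega>)) =
        (iexp (t * F S' \<omega>) - iexp ((- t) * F S' \<omega>)) / (2 * \<i>)"
      by (simp add: sin_of_real[symmetric] sin_exp_eq)
    show "iexp (X \<omega>) * complex_of_real (sin (t * F S' \<omega>)) =
       (iexp (X \<omega> + t * F S' \<omega>) - iexp (X \<omega> + (- t) * F S' \<omega>)) / (2 * \<i>)"
      unfolding eq of_real_add distrib_left exp_add by (simp only: right_diff_distrib times_divide_eq_right)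
  qed
  also have "\<dots> = 0" using ii[of t] ii[of "- t"] char[of t] char[of "- t"] by simp
  finally show ?thesis by (simp only: X_def)
qed

text \<open>This is the sine identity differentiated at frequency 0: the variables n sin
  (\<open>F S'\<close> / n) converge to \<open>F S'\<close> and are dominated by its absolute value,
  which is integrable.\<close>

lemma exp_orthogonal:
  assumes J: "finite J" "J \<subseteq> noise_sets" and S': "S' \<in> noise_sets"
    and unc: "\<And>S. S \<in> J \<Longrightarrow> noise_covariance \<kappa> S S' = 0"
  shows "(\<integral>\<omega>. iexp (\<Sum>S\<in>J. c S * F S \<omega>) * complex_of_real (F S' \<omega>) \<partial>M) = 0"
proof -
  define X where "X = (\<lambda>\<omega>. \<Sum>S\<in>J. c S * F S \<omega>)"
  have Fm: "\<And>S. S \<in> J \<Longrightarrow> F S \<in> borel_measurable M" using J by auto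
  have Xm[measurable]: "X \<in> borel_measurable M" unfolding X_def using Fm by measurable
  have Wm[measurable]: "F S' \<in> borel_measurable M" using S' by auto
  define s where "s n \<omega> = real (Suc n) * sin (1 / real (Suc n) * F S' \<omega>)" for n \<omega>
  have [measurable]: "s n \<in> borel_measurable M" for n unfolding s_def by measurable
  have lim: "(\<lambda>n. s n \<omega>) \<longlonglongrightarrow> F S' \<omega>" for \<omega>
  proof -
    have "((\<lambda>x. sin (x * F S' \<omega>)) has_real_derivative F S' \<omega>) (at 0)"
      by (auto intro!: derivative_eq_intros)
    then have "((\<lambda>x. sin (x * F S' \<omega>) / x) \<longlongrightarrow> F S' \<omega>) (at 0)"
      by (simp add: DERIV_def)
    moreover have "filterlim (\<lambda>n. 1 / real (Suc n)) (at 0) sequentially"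
      using LIMSEQ_Suc[OF lim_1_over_n] by (auto simp: filterlim_at)
    ultimately have "((\<lambda>n. sin (1 / real (Suc n) * F S' \<omega>) / (1 / real (Suc n))) \<longlongrightarrow> F S' \<omega>) sequentially"
      by (rule filterlim_compose)
    then show ?thesis by (simp add: s_def mult.commute)
  qed
  have bd: "\<bar>s n \<omega>\<bar> \<le> \<bar>F S' \<omega>\<bar>" for n \<omega>
  proof -
    have "\<bar>s n \<omega>\<bar> \<le> real (Suc n) * \<bar>1 / real (Suc n) * F S' \<omega>\<bar>"
      unfolding s_def abs_mult[of "real (Suc n)"]
      by (intro mult_mono abs_sin_x_le_abs_x) auto
    also have "\<dots> = \<bar>F S' \<omega>\<bar>" by (simp add: abs_mult)
    finally show ?thesis .
  qed
  have "(\<lambda>n. \<integral>\<omega>. iexp (X \<omega>) * complex_of_real (s n \<omega>) \<partial>M)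
      \<longlonglongrightarrow> (\<integral>\<omega>. iexp (X \<omega>) * complex_of_real (F S' \<omega>) \<partial>M)"
  proof (rule integral_dominated_convergence[where w="\<lambda>\<omega>. \<bar>F S' \<omega>\<bar>"])
    show "integrable M (\<lambda>\<omega>. \<bar>F S' \<omega>\<bar>)" using noise_integrable[OF S'] by simp
    show "AE \<omega> in M. (\<lambda>n. iexp (X \<omega>) * complex_of_real (s n \<omega>)) \<longlonglongrightarrow> iexp (X \<omega>) * complex_of_real (F S' \<omega>)"
      using lim by (auto intro!: tendsto_intros)
    show "AE \<omega> in M. norm (iexp (X \<omega>) * complex_of_real (s n \<omega>)) \<le> \<bar>F S' \<omega>\<bar>" for n
      using bd by (simp add: norm_mult)
  qed auto
  moreover have "(\<integral>\<omega>. iexp (X \<omega>) * complex_of_real (s n \<omega>) \<partial>M) = 0" for n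
  proof -
    have "(\<integral>\<omega>. iexp (X \<omega>) * complex_of_real (s n \<omega>) \<partial>M) =
       (\<integral>\<omega>. complex_of_real (real (Suc n)) *
          (iexp (X \<omega>) * complex_of_real (sin (1 / real (Suc n) * F S' \<omega>))) \<partial>M)"
      by (intro Bochner_Integration.integral_cong refl)
         (simp only: s_def of_real_mult mult.assoc mult.left_commute)
    also have "\<dots> = complex_of_real (real (Suc n)) *
        (\<integral>\<omega>. iexp (X \<omega>) * complex_of_real (sin (1 / real (Suc n) * F S' \<omega>)) \<partial>M)"
      by (rule integral_mult_right_zero)
    also have "\<dots> = 0" unfolding X_def by (simp only: sin_orthogonal[OF J S' unc] mult_zero_right)
    finally show ?thesis .
  qed
  ultimately have "(\<lambda>n. 0) \<longlonglongrightarrow> (\<integral>\<omega>. iexp (X \<omega>) * complex_of_real (F S' \<omega>) \<partial>M)" by simp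
  then show ?thesis unfolding X_def using LIMSEQ_unique tendsto_const by blast
qed

text \<open>Multiplying by \<open>iexp (t * F S0 \<omega>)\<close> only shifts the coefficient
  \<open>c S0\<close>. The induction hypothesis for all \<open>c\<close> therefore says that the
  Fourier transform in the variable \<open>F S0\<close> vanishes, and Fourier uniqueness trades the
  exponential for an indicator, one coordinate at a time.\<close>

lemma cylinder_orthogonal_aux:
  assumes J: "finite J" "J \<subseteq> noise_sets" and S': "S' \<in> noise_sets"
    and unc: "\<And>S. S \<in> J \<Longrightarrow> noise_covariance \<kappa> S S' = 0"
    and U: "\<And>S. U S \<in> sets borel" and J1: "finite J1" "J1 \<subseteq> J"
  shows "(\<integral>\<omega>. iexp (\<Sum>S\<in>J. c S * F S \<omega>) * complex_of_real (F S' \<omega>) *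
      (\<Prod>S\<in>J1. indicator (F S -` U S) \<omega>) \<partial>M) = 0"
  using J1
proof (induction J1 arbitrary: c)
  case empty
  then show ?case using exp_orthogonal[OF J S' unc] by simp
next
  case (insert S0 J1)
  have Fm[measurable]: "\<And>S. S \<in> J \<Longrightarrow> F S \<in> borel_measurable M" using J by auto
  have Um[measurable]: "\<And>S. U S \<in> sets borel" using U by auto
  have Wm[measurable]: "F S' \<in> borel_measurable M" using S' by auto
  have S0: "S0 \<in> J" "J1 \<subseteq> J" "finite J1" using insert by auto
  define Y where "Y c \<omega> = iexp (\<Sum>S\<in>J. c S * F S \<omega>) * complex_of_real (F S' \<omega>) *
      (\<Prod>S\<in>J1. indicator (F S -` U S) \<omega>)" for c \<omega>
  have Ym: "Y c \<in> borel_measurable M" for c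
  proof -
    have pm: "(\<lambda>\<omega>. \<Prod>S\<in>J1. indicator (U S) (F S \<omega>) :: complex) \<in> borel_measurable M"
      using S0 by (intro borel_measurable_prod) auto
    have "Y c = (\<lambda>\<omega>. iexp (\<Sum>S\<in>J. c S * F S \<omega>) * complex_of_real (F S' \<omega>) *
      (\<Prod>S\<in>J1. indicator (U S) (F S \<omega>)))"
      by (auto simp: Y_def indicator_def fun_eq_iff)
    moreover have "(\<lambda>\<omega>. \<Sum>S\<in>J. c S * F S \<omega>) \<in> borel_measurable M" by measurable
    moreover have "(\<lambda>\<omega>. complex_of_real (F S' \<omega>)) \<in> borel_measurable M"
      by measurable
    ultimately show ?thesis using pm by simp
  qed
  have iY: "integrable M (Y c)" for c
  proof (rule Bochner_Integration.integrable_bound[OF noise_integrable[OF S'] Ym], intro always_eventually allI)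
    fix \<omega>
    have "norm (\<Prod>S\<in>J1. indicator (F S -` U S) \<omega> :: complex) \<le> 1"
      by (simp add: prod_norm[symmetric]) (auto intro!: prod_le_1 split: split_indicator)
    then show "norm (Y c \<omega>) \<le> norm (F S' \<omega>)"
      by (simp add: Y_def norm_mult mult_left_le)
  qed
  have "(\<integral>\<omega>. Y c \<omega> * indicator (F S0 -` U S0) \<omega> \<partial>M) = 0"
  proof (rule fourier_zero_imp_set_zero[OF iY _ _ U])
    show "F S0 \<in> borel_measurable M" using S0 by auto
    fix t
    have "(\<Sum>S\<in>J. (c(S0 := c S0 + t)) S * F S \<omega>) = (\<Sum>S\<in>J. c S * F S \<omega>) + t * F S0 \<omega>" for \<omega>
      using J S0 by (simp add: sum.remove[of J S0] algebra_simps)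
    then have "Y c \<omega> * iexp (t * F S0 \<omega>) = Y (c(S0 := c S0 + t)) \<omega>" for \<omega>
      unfolding Y_def by (simp only: of_real_add distrib_left exp_add mult_ac)
    then have "(\<integral>\<omega>. Y c \<omega> * iexp (t * F S0 \<omega>) \<partial>M) = (\<integral>\<omega>. Y (c(S0 := c S0 + t)) \<omega> \<partial>M)"
      by (simp only:)
    also have "\<dots> = 0" unfolding Y_def by (rule insert.IH[OF S0(2)])
    finally show "(\<integral>\<omega>. Y c \<omega> * iexp (t * F S0 \<omega>) \<partial>M) = 0" .
  qed
  then show ?case unfolding Y_def using insert.hyps by (simp add: mult_ac)
qed

lemma cylinder_orthogonal:
  assumes J: "finite J" "J \<subseteq> noise_sets" and S': "S' \<in> noise_sets"
    and unc: "\<And>S. S \<in> J \<Longrightarrow> noise_covariance \<kappa> S S' = 0"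
    and U: "\<And>S. U S \<in> sets borel"
  shows "(\<integral>\<omega>. indicator (space M \<inter> (\<Inter>S\<in>J. F S -` U S)) \<omega> * F S' \<omega> \<partial>M) = 0"
proof -
  have "complex_of_real (\<integral>\<omega>. indicator (space M \<inter> (\<Inter>S\<in>J. F S -` U S)) \<omega> * F S' \<omega> \<partial>M)
    = (\<integral>\<omega>. complex_of_real (indicator (space M \<inter> (\<Inter>S\<in>J. F S -` U S)) \<omega> * F S' \<omega>) \<partial>M)"
    by (rule integral_complex_of_real[symmetric])
  also have "\<dots> = (\<integral>\<omega>. iexp (\<Sum>S\<in>J. 0 * F S \<omega>) * complex_of_real (F S' \<omega>) *
      (\<Prod>S\<in>J. indicator (F S -` U S) \<omega>) \<partial>M)"
  proof (intro Bochner_Integration.integral_cong refl)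
    fix \<omega> assume "\<omega> \<in> space M"
    then have "(\<Prod>S\<in>J. indicator (F S -` U S) \<omega> :: complex) =
        complex_of_real (indicator (space M \<inter> (\<Inter>S\<in>J. F S -` U S)) \<omega>)"
      using J(1) by (auto simp: indicator_def prod_zero_iff)
    then show "complex_of_real (indicator (space M \<inter> (\<Inter>S\<in>J. F S -` U S)) \<omega> * F S' \<omega>) =
      iexp (\<Sum>S\<in>J. 0 * F S \<omega>) * complex_of_real (F S' \<omega>) * (\<Prod>S\<in>J. indicator (F S -` U S) \<omega>)"
      by simp
  qed
  also have "\<dots> = 0"
    by (rule cylinder_orthogonal_aux[OF J S' unc U J(1)]) auto
  finally show ?thesis using of_real_eq_0_iff by blast
qed

lemma filtration_generators_subset:
  "{F S -` U \<inter> space M | S U. S \<in> noise_sets \<and> S \<subseteq> {0..t} \<times> UNIV \<and> U \<in> sets borel}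
      \<union> null_sets M \<subseteq> sets M"
  using measurable_sets[OF noise_measurable] by (auto simp: null_sets_def)

lemma sets_noise_filtration:
  "sets (noise_filtration M F t) = sigma_sets (space M)
     ({F S -` U \<inter> space M | S U. S \<in> noise_sets \<and> S \<subseteq> {0..t} \<times> UNIV \<and> U \<in> sets borel}
      \<union> null_sets M)"
  unfolding noise_filtration_def
  using filtration_generators_subset sets.space_closed[of M]
  by (intro sets_measure_of) (meson order_trans)

lemma noise_filtration_subalgebra: "subalgebra M (noise_filtration M F t)"
  unfolding subalgebra_def sets_noise_filtration
  using sets.sigma_sets_subset[OF filtration_generators_subset]
  by (simp add: noise_filtration_def space_measure_of_conv)

text \<open>The past is closed at \<open>a\<close> and the future open, so no time is common to
  both; this matches the half-open intervals \<open>{a<..b}\<close> of simple processes.\<close>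

lemma noise_covariance_past_future:
  assumes "S \<subseteq> {0..a} \<times> UNIV" "S' \<subseteq> {a<..} \<times> UNIV"
  shows "noise_covariance \<kappa> S S' = 0"
proof (cases \<kappa>)
  case White
  have "S \<inter> S' = {}" using assms by fastforce
  then show ?thesis using White by simp
next
  case (Colored f)
  have "indicator S (t, x) * indicator S' (t, y) = (0::real)" for t x y
    using assms by (fastforce simp: indicator_def)
  then have "(\<lambda>(t, x, y). indicator S (t, x) * indicator S' (t, y) * f x y) = (\<lambda>_. 0::real)"
    by (auto simp: fun_eq_iff)
  then show ?thesis using Colored by simp
qed

lemma future_orthogonal_set:
  assumes S': "S' \<in> noise_sets" "S' \<subseteq> {a<..} \<times> UNIV"
    and A: "A \<in> sets (noise_filtration M F a)"
  shows "(\<integral>\<omega>. indicator A \<omega> * F S' \<omega> \<partial>M) = 0"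
proof -
  \<comment> \<open>Cylinder events over finitely many past sets form a pi-system. The null sets are
    adjoined because they generate the augmentation; intersecting with one of them gives a null set
    again, and the identity is trivial there.\<close>
  define P where "P = {space M \<inter> (\<Inter>S\<in>J. F S -` U S) | J U. finite J \<and> J \<subseteq> noise_sets \<and>
     (\<forall>S\<in>J. S \<subseteq> {0..a} \<times> UNIV) \<and> (\<forall>S. U S \<in> sets borel)} \<union> null_sets M"
  have PM: "P \<subseteq> sets M"
  proof -
    have "space M \<inter> (\<Inter>S\<in>J. F S -` U S) \<in> sets M"
      if "finite J" "J \<subseteq> noise_sets" "\<forall>S. U S \<in> sets borel" for J U
    proof (cases "J = {}")
      case False
      have "space M \<inter> (\<Inter>S\<in>J. F S -` U S) = (\<Inter>S\<in>J. F S -` U S \<inter> space M)" using False by auto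
      also have "\<dots> \<in> sets M" using that False measurable_sets[OF noise_measurable]
        by (intro sets.finite_INT) (auto simp: subset_iff)
      finally show ?thesis .
    qed simp
    then show ?thesis unfolding P_def by auto
  qed
  have stable: "Int_stable P"
  proof (rule Int_stableI)
    fix A B assume AB: "A \<in> P" "B \<in> P"
    show "A \<inter> B \<in> P"
    proof (cases "A \<in> null_sets M \<or> B \<in> null_sets M")
      case True
      have "A \<in> sets M" "B \<in> sets M" using AB PM by auto
      then have "A \<inter> B \<in> null_sets M"
        using True by (metis Int_commute null_set_Int2 null_set_Int1)
      then show ?thesis unfolding P_def by simp
    next
      case False
      then obtain J1 U1 J2 U2 where
        1: "A = space M \<inter> (\<Inter>S\<in>J1. F S -` U1 S)" "finite J1" "J1 \<subseteq> noise_sets"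
           "\<forall>S\<in>J1. S \<subseteq> {0..a} \<times> UNIV" "\<forall>S. U1 S \<in> sets borel" and
        2: "B = space M \<inter> (\<Inter>S\<in>J2. F S -` U2 S)" "finite J2" "J2 \<subseteq> noise_sets"
           "\<forall>S\<in>J2. S \<subseteq> {0..a} \<times> UNIV" "\<forall>S. U2 S \<in> sets borel"
        using AB unfolding P_def by auto
      define U where "U S = (if S \<in> J1 then U1 S else UNIV) \<inter> (if S \<in> J2 then U2 S else UNIV)" for S
      have "A \<inter> B = space M \<inter> (\<Inter>S\<in>J1 \<union> J2. F S -` U S)"
        unfolding 1 2 U_def by (auto split: if_splits)
      moreover have "\<forall>S. U S \<in> sets borel" using 1 2 by (auto simp: U_def)
      ultimately show ?thesis unfolding P_def using 1 2
        by (intro UnI1 CollectI exI[of _ "J1 \<union> J2"] exI[of _ U]) auto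
    qed
  qed
  have "A \<in> sigma_sets (space M) P"
  proof -
    have "({F S -` U \<inter> space M | S U. S \<in> noise_sets \<and> S \<subseteq> {0..a} \<times> UNIV \<and> U \<in> sets borel}
      \<union> null_sets M) \<subseteq> P"
    proof -
      have "F S -` U \<inter> space M \<in> P"
        if "S \<in> noise_sets" "S \<subseteq> {0..a} \<times> UNIV" "U \<in> sets borel" for S U
        unfolding P_def using that
        by (intro UnI1 CollectI exI[of _ "{S}"] exI[of _ "\<lambda>_. U"]) auto
      moreover have "null_sets M \<subseteq> P" unfolding P_def by auto
      ultimately show ?thesis by blast
    qed
    then show ?thesis using A sigma_sets_mono' unfolding sets_noise_filtration by blast
  qed
  have PO: "P \<subseteq> Pow (space M)" using PM sets.space_closed by blast
  have sM: "sigma_sets (space M) P \<subseteq> sets M" using PM sets.sigma_sets_subset by blast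
  have iW: "integrable M (F S')" using noise_integrable[OF S'(1)] .
  \<comment> \<open>The empty cylinder gives mean zero, on which the complement step of the
    induction rests.\<close>
  have EW: "(\<integral>\<omega>. F S' \<omega> \<partial>M) = 0"
    using exp_orthogonal[of "{}" S' "\<lambda>_. 0"] S' by simp
  have iA: "integrable M (\<lambda>\<omega>. indicator A \<omega> * F S' \<omega>)" if "A \<in> sets M" for A
    using integrable_mult_indicator[OF that iW] by simp
  show ?thesis
    using stable PO \<open>A \<in> sigma_sets (space M) P\<close>
  proof (induction rule: sigma_sets_induct_disjoint)
    case (basic A)
    show ?case
    proof (cases "A \<in> null_sets M")
      case True
      have "AE \<omega> in M. indicator A \<omega> * F S' \<omega> = 0"
        using AE_not_in[OF True] by eventually_elim auto
      then show ?thesis by (rule integral_eq_zero_AE)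
    next
      case False
      then obtain J U where
        1: "A = space M \<inter> (\<Inter>S\<in>J. F S -` U S)" "finite J" "J \<subseteq> noise_sets"
           "\<forall>S\<in>J. S \<subseteq> {0..a} \<times> UNIV" "\<forall>S. U S \<in> sets borel"
        using basic unfolding P_def by auto
      show ?thesis unfolding 1(1)
        using 1 S' noise_covariance_past_future by (intro cylinder_orthogonal) auto
    qed
  next
    case empty
    then show ?case by simp
  next
    case (compl A)
    have AM: "A \<in> sets M" using compl sM by auto
    have "(\<integral>\<omega>. indicator (space M - A) \<omega> * F S' \<omega> \<partial>M) = (\<integral>\<omega>. F S' \<omega> - indicator A \<omega> * F S' \<omega> \<partial>M)"
      by (intro Bochner_Integration.integral_cong refl) (auto split: split_indicator)
    then show ?case using compl iW iA[OF AM] EW by simp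
  next
    case (union A)
    have AM: "\<And>i. A i \<in> sets M" using union sM by auto
    have "set_integrable M (\<Union>i. A i) (F S')"
      using integrable_mult_indicator[OF sets.countable_UN[OF _] iW, of A] AM
      unfolding set_integrable_def by auto
    then have "set_lebesgue_integral M (\<Union>i. A i) (F S') = (\<Sum>i. set_lebesgue_integral M (A i) (F S'))"
      using AM union(1) by (intro lebesgue_integral_countable_add) (auto simp: disjoint_family_on_def)
    also have "\<dots> = 0" using union(3) by (simp add: set_lebesgue_integral_def)
    finally show ?case by (simp add: set_lebesgue_integral_def)
  qed
qed

text \<open>Orthogonality on events says that the conditional expectation of \<open>F S'\<close>
  given the past vanishes, and a past variable \<open>Z\<close> may be multiplied into it. Square
  integrability is recorded because the Walsh integral is a limit in L2.\<close>

lemma future_orthogonal: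
  assumes S': "S' \<in> noise_sets" "S' \<subseteq> {a<..} \<times> UNIV"
    and Z: "Z \<in> borel_measurable (noise_filtration M F a)"
    and bZ: "\<And>\<omega>. \<omega> \<in> space M \<Longrightarrow> \<bar>Z \<omega>\<bar> \<le> C"
  shows "integrable M (\<lambda>\<omega>. Z \<omega> * F S' \<omega>)" "(\<integral>\<omega>. Z \<omega> * F S' \<omega> \<partial>M) = 0"
    and "integrable M (\<lambda>\<omega>. (Z \<omega> * F S' \<omega>)\<^sup>2)"
proof -
  let ?G = "noise_filtration M F a"
  interpret finite_measure_subalgebra M ?G
    by standard (rule noise_filtration_subalgebra)
  have [measurable]: "Z \<in> borel_measurable M"
    using measurable_from_subalg[OF noise_filtration_subalgebra Z] .
  have [measurable]: "F S' \<in> borel_measurable M" using S' by auto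
  have iW: "integrable M (F S')" using noise_integrable[OF S'(1)] .
  show i: "integrable M (\<lambda>\<omega>. Z \<omega> * F S' \<omega>)"
  proof (rule Bochner_Integration.integrable_bound)
    show "integrable M (\<lambda>\<omega>. C * F S' \<omega>)" using iW by simp
    show "AE \<omega> in M. norm (Z \<omega> * F S' \<omega>) \<le> norm (C * F S' \<omega>)"
    proof (intro AE_I2)
      fix \<omega> assume "\<omega> \<in> space M"
      then have "\<bar>Z \<omega>\<bar> \<le> \<bar>C\<bar>" using bZ[of \<omega>] by linarith
      then show "norm (Z \<omega> * F S' \<omega>) \<le> norm (C * F S' \<omega>)"
        by (simp add: abs_mult mult_right_mono)
    qed
  qed auto
  show "integrable M (\<lambda>\<omega>. (Z \<omega> * F S' \<omega>)\<^sup>2)"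
  proof (rule Bochner_Integration.integrable_bound)
    show "integrable M (\<lambda>\<omega>. C\<^sup>2 * (F S' \<omega>)\<^sup>2)" using noise_square_integrable[OF S'(1)] by simp
    show "AE \<omega> in M. norm ((Z \<omega> * F S' \<omega>)\<^sup>2) \<le> norm (C\<^sup>2 * (F S' \<omega>)\<^sup>2)"
    proof (intro AE_I2)
      fix \<omega> assume "\<omega> \<in> space M"
      then have "\<bar>Z \<omega>\<bar> \<le> \<bar>C\<bar>" using bZ[of \<omega>] by linarith
      then have "(Z \<omega>)\<^sup>2 \<le> C\<^sup>2" by (simp add: abs_le_square_iff)
      then show "norm ((Z \<omega> * F S' \<omega>)\<^sup>2) \<le> norm (C\<^sup>2 * (F S' \<omega>)\<^sup>2)"
        by (simp add: power_mult_distrib mult_right_mono)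
    qed
  qed auto
  have "AE \<omega> in M. real_cond_exp M ?G (F S') \<omega> = 0"
    using future_orthogonal_set[OF S'] iW
    by (intro real_cond_exp_charact) (auto simp: set_lebesgue_integral_def)
  then have "(\<integral>\<omega>. Z \<omega> * real_cond_exp M ?G (F S') \<omega> \<partial>M) = (\<integral>\<omega>. 0 \<partial>M)"
    using Z by (intro integral_cong_AE) (auto intro: borel_measurable_cond_exp2 elim: eventually_mono)
  then show "(\<integral>\<omega>. Z \<omega> * F S' \<omega> \<partial>M) = 0"
    using real_cond_exp_intg(2)[OF i Z] by simp
qed

section \<open>From simple integrals to Walsh integrals\<close>

lemma simple_integral_mean_zero:
  assumes "\<forall>e\<in>set es. elementary_process M F e"
  shows "integrable M (simple_integral F es) \<and> (\<integral>\<omega>. simple_integral F es \<omega> \<partial>M) = 0 \<and>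
    integrable M (\<lambda>\<omega>. (simple_integral F es \<omega>)\<^sup>2)"
  using assms
proof (induction es)
  case Nil
  then show ?case by (simp add: Defs.simple_integral_def)
next
  case (Cons e es)
  obtain a b A Z where e: "e = (a, b, A, Z)" by (cases e) auto
  have ep: "0 \<le> a" "a < b" "A \<in> sets borel" "bounded A"
    and Z: "Z \<in> borel_measurable (noise_filtration M F a)"
    using Cons.prems unfolding e elementary_process_def by auto
  obtain C where C: "\<And>\<omega>. \<omega> \<in> space M \<Longrightarrow> \<bar>Z \<omega>\<bar> \<le> C"
    using Cons.prems unfolding e elementary_process_def by auto
  have "{a<..b} \<times> A \<in> noise_sets"
    using ep by (auto simp: noise_sets_def borel_prod[symmetric] intro!: bounded_Times)
  note f = future_orthogonal[OF this _ Z C]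
  have eq: "simple_integral F (e # es) = (\<lambda>\<omega>. Z \<omega> * F ({a<..b} \<times> A) \<omega> + simple_integral F es \<omega>)"
    by (simp add: Defs.simple_integral_def e fun_eq_iff)
  have IH: "integrable M (simple_integral F es)" "(\<integral>\<omega>. simple_integral F es \<omega> \<partial>M) = 0"
    "integrable M (\<lambda>\<omega>. (simple_integral F es \<omega>)\<^sup>2)" using Cons by auto
  have f': "integrable M (\<lambda>\<omega>. Z \<omega> * F ({a<..b} \<times> A) \<omega>)" "(\<integral>\<omega>. Z \<omega> * F ({a<..b} \<times> A) \<omega> \<partial>M) = 0"
     "integrable M (\<lambda>\<omega>. (Z \<omega> * F ({a<..b} \<times> A) \<omega>)\<^sup>2)" by (rule f; auto)+
  have "integrable M (\<lambda>\<omega>. (Z \<omega> * F ({a<..b} \<times> A) \<omega> + simple_integral F es \<omega>)\<^sup>2)"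
  proof (rule Bochner_Integration.integrable_bound)
    show "integrable M (\<lambda>\<omega>. 2 * (Z \<omega> * F ({a<..b} \<times> A) \<omega>)\<^sup>2 + 2 * (simple_integral F es \<omega>)\<^sup>2)"
      using f' IH by auto
    show "(\<lambda>\<omega>. (Z \<omega> * F ({a<..b} \<times> A) \<omega> + simple_integral F es \<omega>)\<^sup>2) \<in> borel_measurable M"
      using f' IH by (auto intro!: borel_measurable_power borel_measurable_add)
    have "(x + y)\<^sup>2 \<le> 2 * x\<^sup>2 + 2 * y\<^sup>2" for x y :: real
      using sum_squares_bound[of x y] by (simp add: power2_sum)
    then show "AE \<omega> in M. norm ((Z \<omega> * F ({a<..b} \<times> A) \<omega> + simple_integral F es \<omega>)\<^sup>2) \<le>
        norm (2 * (Z \<omega> * F ({a<..b} \<times> A) \<omega>)\<^sup>2 + 2 * (simple_integral F es \<omega>)\<^sup>2)" by simp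
  qed
  then show ?case unfolding eq using f' IH by simp
qed

text \<open>The approximating integrals have mean zero, so the squared mean of \<open>I\<close>
  equals the squared mean of its distance to any of them, and nonnegativity of the variance bounds
  it by \<open>Q n\<close>, which tends to 0. The distance may be infinite for early
  \<open>n\<close>, hence the restriction to finite \<open>Q n\<close>.\<close>

lemma walsh_integral_mean_zero:
  assumes "has_walsh_integral M \<kappa> F h I"
  shows "integrable M I" "(\<integral>\<omega>. I \<omega> \<partial>M) = 0"
proof -
  obtain es where Im[measurable]: "I \<in> borel_measurable M"
    and es: "\<And>n::nat. \<forall>e\<in>set (es n). elementary_process M F e"
    and lim: "(\<lambda>n. \<integral>\<^sup>+\<omega>. ennreal ((I \<omega> - simple_integral F (es n) \<omega>)\<^sup>2) \<partial>M) \<longlonglongrightarrow> 0"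
    using assms unfolding has_walsh_integral_def by blast
  define Q where "Q n = (\<integral>\<^sup>+\<omega>. ennreal ((I \<omega> - simple_integral F (es n) \<omega>)\<^sup>2) \<partial>M)" for n
  note s = simple_integral_mean_zero[OF es]
  have sm[measurable]: "simple_integral F (es n) \<in> borel_measurable M" for n using s by auto
  have key: "integrable M I \<and> \<bar>\<integral>\<omega>. I \<omega> \<partial>M\<bar>\<^sup>2 \<le> enn2real (Q n)" if "Q n < \<infinity>" for n
  proof -
    have i2: "integrable M (\<lambda>\<omega>. (I \<omega> - simple_integral F (es n) \<omega>)\<^sup>2)"
      using that by (intro integrableI_nonneg) (auto simp: Q_def)
    have i1: "integrable M (\<lambda>\<omega>. I \<omega> - simple_integral F (es n) \<omega>)"
      by (rule square_integrable_imp_integrable[OF borel_measurable_diff[OF Im sm] i2])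
    have iI: "integrable M I"
      using Bochner_Integration.integrable_add[OF i1 s[THEN conjunct1, of n]] by simp
    have eq: "(\<integral>\<omega>. I \<omega> - simple_integral F (es n) \<omega> \<partial>M) = (\<integral>\<omega>. I \<omega> \<partial>M)"
      using iI s by simp
    have "(\<integral>\<omega>. I \<omega> - simple_integral F (es n) \<omega> \<partial>M)\<^sup>2 \<le> (\<integral>\<omega>. (I \<omega> - simple_integral F (es n) \<omega>)\<^sup>2 \<partial>M)"
      using variance_positive[of "\<lambda>\<omega>. I \<omega> - simple_integral F (es n) \<omega>"] variance_eq[OF i1 i2] by simp
    also have "\<dots> = enn2real (Q n)" unfolding Q_def by (rule integral_eq_nn_integral) auto
    finally show ?thesis using iI eq by simp
  qed
  have ev: "\<forall>\<^sub>F n in sequentially. Q n < \<infinity>"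
    using order_tendstoD(2)[OF lim, of \<infinity>] by (simp add: Q_def)
  then obtain n0 where "Q n0 < \<infinity>" by (metis eventually_sequentially order_refl)
  then show "integrable M I" using key by blast
  have "(\<lambda>n. enn2real (Q n)) \<longlonglongrightarrow> 0"
    using tendsto_enn2real[of Q 0 sequentially] lim by (simp add: Q_def[abs_def])
  then have "\<bar>\<integral>\<omega>. I \<omega> \<partial>M\<bar>\<^sup>2 \<le> 0"
    using ev key by (intro tendsto_lowerbound[of _ 0 sequentially]) (auto elim!: eventually_mono)
  then show "(\<integral>\<omega>. I \<omega> \<partial>M) = 0" by simp
qed

end

section \<open>The killed process along dyadic times\<close>

lemma dyadic_between:
  fixes t r r' :: real
  assumes "0 < t" "0 \<le> r" "r < r'" "r' \<le> t"
  obtains n k :: nat where "k \<in> {1..2 ^ n}" "r < real k * t / 2 ^ n" "real k * t / 2 ^ n < r'"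
proof -
  obtain n where n: "(1/2::real) ^ n < (r' - r) / t"
    using real_arch_pow_inv[of "(r' - r) / t" "1/2"] assms by auto
  \<comment> \<open>The first point of the grid of mesh \<open>t / 2 ^ n\<close> strictly beyond
    \<open>r\<close>; as the mesh is smaller than \<open>r' - r\<close>, it still lies before
    \<open>r'\<close>.\<close>
  define k where "k = nat \<lfloor>r * 2 ^ n / t\<rfloor> + 1"
  have nn: "0 \<le> r * 2 ^ n / t" using assms by simp
  have k: "real k = of_int \<lfloor>r * 2 ^ n / t\<rfloor> + 1" using nn by (simp add: k_def)
  have 1: "r * 2 ^ n / t < real k" unfolding k by linarith
  have 2: "real k \<le> r * 2 ^ n / t + 1" unfolding k by linarith
  have a: "r < real k * t / 2 ^ n" using 1 assms by (simp add: field_simps)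
  have "real k * t / 2 ^ n \<le> (r * 2 ^ n / t + 1) * t / 2 ^ n"
    using 2 assms by (intro divide_right_mono mult_right_mono) auto
  also have "\<dots> = r + t * (1/2) ^ n" using assms by (simp add: field_simps)
  also have "\<dots> < r'" using n assms by (simp add: field_simps)
  finally have b: "real k * t / 2 ^ n < r'" .
  have "real k * t / 2 ^ n < t" using b assms by simp
  then have "real k < 2 ^ n" using assms by (simp add: field_simps)
  then have "k \<le> 2 ^ n" by (simp add: order_less_imp_le)
  moreover have "1 \<le> k" by (simp add: k_def)
  ultimately show ?thesis using that a b by auto
qed

text \<open>The farthest-distance function of a set has no local maximum, so its level set lies on the
  boundary of a convex sublevel set.\<close>

lemma negligible_farthest_distance_level:
  fixes D :: "'a::euclidean_space set"
  assumes "0 < R"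
  shows "negligible {x. (\<forall>d\<in>D. norm (x + d) \<le> R) \<and> (\<forall>\<rho><R. \<exists>d\<in>D. \<rho> < norm (x + d))}" (is "negligible ?L")
proof -
  define K where "K = (\<Inter>d\<in>D. cball (- d) R)"
  have K: "x \<in> K \<longleftrightarrow> (\<forall>d\<in>D. norm (x + d) \<le> R)" for x
    unfolding K_def by (simp add: dist_norm) (metis norm_minus_cancel minus_diff_eq diff_minus_eq_add add.commute)
  have "convex K" unfolding K_def by (intro convex_INT) auto
  moreover have "?L \<subseteq> frontier K"
  proof
    fix x assume x: "x \<in> ?L"
    then have "x \<in> K" by (simp add: K)
    moreover have "x \<notin> interior K"
    proof
      assume "x \<in> interior K"
      then obtain e where e: "e > 0" "ball x e \<subseteq> K" by (auto simp: mem_interior)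
      obtain d where d: "d \<in> D" "max 0 (R - e/2) < norm (x + d)"
        using x \<open>0 < R\<close> e(1) by (auto elim!: allE[of _ "max 0 (R - e/2)"])
      \<comment> \<open>Moving \<open>x\<close> away from \<open>- d\<close> by \<open>e / 2\<close>
        stays inside \<open>K\<close>, yet raises a distance that exceeded \<open>R - e / 2\<close>
        above \<open>R\<close>.\<close>
      define x' where "x' = x + (e / 2 / norm (x + d)) *\<^sub>R (x + d)"
      have "dist x x' = e / 2" using d e by (simp add: x'_def dist_norm)
      then have "x' \<in> K" using e by auto
      then have "norm (x' + d) \<le> R" using K d by auto
      moreover have "x' + d = (1 + e / 2 / norm (x + d)) *\<^sub>R (x + d)"
        by (simp add: x'_def algebra_simps)
      then have "norm (x' + d) = norm (x + d) + e / 2"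
        using d e by (simp add: distrib_right)
      ultimately show False using d by simp
    qed
    ultimately show "x \<in> frontier K"
      using closure_subset by (auto simp: frontier_def)
  qed
  ultimately show ?thesis
    using negligible_convex_frontier negligible_subset by blast
qed

text \<open>\<open>E'\<close> need not lie in \<open>sets M\<close>: it differs from
  \<open>E\<close> inside a null set, all of whose subsets belong to the completion. Events defined
  by the exit time are of this kind.\<close>

lemma (in prob_space) completion_emeasure_AE_eq:
  assumes "E \<in> sets M" and "AE \<omega> in M. \<omega> \<in> E' \<longleftrightarrow> \<omega> \<in> E" and "E' \<subseteq> space M"
  shows "emeasure (completion M) E' = emeasure M E"
proof -
  obtain Z where Z: "Z \<in> null_sets M" "{\<omega> \<in> space M. \<not> (\<omega> \<in> E' \<longleftrightarrow> \<omega> \<in> E)} \<subseteq> Z"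
    using assms(2) by (auto elim: AE_E simp: null_sets_def)
  have ZN: "Z \<in> null_sets (completion M)" using Z by (auto simp: null_sets_completion_iff null_sets_def)
  have "E' \<inter> Z \<in> null_sets (completion M)"
    using completion.complete2[OF _ ZN, of "E' \<inter> Z"] by auto
  moreover have "E' = (E - Z) \<union> (E' \<inter> Z)"
    using Z(2) assms sets.sets_into_space[OF assms(1)] by blast
  moreover have "E - Z \<in> sets (completion M)" using assms Z by auto
  ultimately have "E' \<in> sets (completion M)" by (metis null_setsD2 sets.Un)
  then have "emeasure (completion M) E' = emeasure (completion M) E"
    using assms by (intro emeasure_eq_AE) (auto intro: AE_completion)
  then show ?thesis using assms(1) by simp
qed

section \<open>Survival along dyadic times and the exit time\<close>

locale killed_levy = prob_space N for N :: "'v measure" +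
  fixes X :: "real \<Rightarrow> 'v \<Rightarrow> 'a::euclidean_space" and p :: "real \<Rightarrow> 'a \<Rightarrow> 'a \<Rightarrow> real" and R :: real
  assumes levy: "levy_process N X"
    and killed: "killed_transition_density (ball 0 R) N X p"
    and R: "0 < R"
begin

abbreviation "B \<equiv> ball (0::'a) R"

lemma B_sets[measurable]: "B \<in> sets borel"
  by simp

lemma X_measurable[measurable]: "0 \<le> t \<Longrightarrow> X t \<in> borel_measurable N"
  using levy by (auto simp: levy_process_def)

lemma AE_path: "AE \<omega> in N. X 0 \<omega> = 0 \<and> cadlag_path (\<lambda>t. X t \<omega>)"
  using levy by (auto simp: levy_process_def)

text \<open>Index 0 is left out because the exit time looks at positive times only;
  \<open>k = 2 ^ n\<close> is time \<open>t\<close> itself, so survival includes being in the ball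
  at the end.\<close>

definition survive :: "real \<Rightarrow> nat \<Rightarrow> 'a \<Rightarrow> 'v set" where
  "survive t n x = {\<omega> \<in> space N. \<forall>k\<in>{1..2 ^ n}. x + X (real k * t / 2 ^ n) \<omega> \<in> B}"

definition survive_all :: "real \<Rightarrow> 'a \<Rightarrow> 'v set" where
  "survive_all t x = (\<Inter>n. survive t n x)"

lemma grid_measurable[measurable]: "0 \<le> t \<Longrightarrow> X (real k * t / 2 ^ n) \<in> borel_measurable N"
  by simp

lemma survive_pair_measurable:
  assumes "0 \<le> t" shows "{z \<in> space (borel \<Otimes>\<^sub>M N). snd z \<in> survive t n (fst z)} \<in> sets (borel \<Otimes>\<^sub>M N)"
proof -
  have "{z \<in> space (borel \<Otimes>\<^sub>M N). snd z \<in> survive t n (fst z)} =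
     {z \<in> space (borel \<Otimes>\<^sub>M N). \<forall>k\<in>{1..2^n}. norm (fst z + X (real k * t / 2 ^ n) (snd z)) < R}"
    by (auto simp: survive_def space_pair_measure)
  also have "\<dots> \<in> sets (borel \<Otimes>\<^sub>M N)"
    using grid_measurable[OF assms, measurable] by measurable
  finally show ?thesis .
qed

lemma survive_indicator_measurable[measurable]:
  assumes "0 \<le> t" shows "(\<lambda>z. indicator (survive t n (fst z)) (snd z) :: ennreal) \<in> borel_measurable (borel \<Otimes>\<^sub>M N)"
proof -
  have "(\<lambda>z. indicator {z \<in> space (borel \<Otimes>\<^sub>M N). snd z \<in> survive t n (fst z)} z :: ennreal) \<in> borel_measurable (borel \<Otimes>\<^sub>M N)"
    using survive_pair_measurable[OF assms] by simp
  then show ?thesis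
    by (rule measurable_cong[THEN iffD1, rotated]) (auto simp: indicator_def)
qed

lemma survive_all_indicator_measurable[measurable]:
  assumes "0 \<le> t" shows "(\<lambda>z. indicator (survive_all t (fst z)) (snd z) :: ennreal) \<in> borel_measurable (borel \<Otimes>\<^sub>M N)"
proof -
  have "(\<Inter>n. {z \<in> space (borel \<Otimes>\<^sub>M N). snd z \<in> survive t n (fst z)}) \<in> sets (borel \<Otimes>\<^sub>M N)"
    using survive_pair_measurable[OF assms] by (intro sets.countable_INT') auto
  then have "(\<lambda>z. indicator (\<Inter>n. {z \<in> space (borel \<Otimes>\<^sub>M N). snd z \<in> survive t n (fst z)}) z :: ennreal)
      \<in> borel_measurable (borel \<Otimes>\<^sub>M N)" by simp
  then show ?thesis
    by (rule measurable_cong[THEN iffD1, rotated]) (auto simp: survive_all_def indicator_def)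
qed

lemma survive_sets[measurable]: "0 \<le> t \<Longrightarrow> survive t n x \<in> sets N"
  using sets_Pair1[OF survive_pair_measurable[of t n], of x]
  by (rule back_subst[of "\<lambda>A. A \<in> sets N"]) (auto simp: survive_def space_pair_measure)

lemma survive_all_sets[measurable]: "0 \<le> t \<Longrightarrow> survive_all t x \<in> sets N"
  unfolding survive_all_def by (intro sets.countable_INT') auto

lemma survive_antimono: "survive t (Suc n) x \<subseteq> survive t n x"
proof
  fix \<omega> assume w: "\<omega> \<in> survive t (Suc n) x"
  have "x + X (real k * t / 2 ^ n) \<omega> \<in> B" if "k \<in> {1..2 ^ n}" for k
  proof -
    have "2 * k \<in> {1..2 ^ Suc n}" using that by auto
    then have "x + X (real (2 * k) * t / 2 ^ Suc n) \<omega> \<in> B" using w unfolding survive_def by blast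
    moreover have "real (2 * k) * t / 2 ^ Suc n = real k * t / 2 ^ n" by simp
    ultimately show ?thesis by (simp only:)
  qed
  then show "\<omega> \<in> survive t n x" using w by (simp add: survive_def)
qed

lemma survive_allD: "\<omega> \<in> survive_all t x \<Longrightarrow> k \<in> {1..2 ^ n} \<Longrightarrow> x + X (real k * t / 2 ^ n) \<omega> \<in> B"
  unfolding survive_all_def survive_def by blast

text \<open>Positions inside the open ball at dyadic times only give distance at most
  \<open>R\<close> at the other times, since a limit of interior points may lie on the sphere. For a
  fixed path, the starting points whose grid positions have supremum exactly \<open>R\<close> form a
  level set of a farthest-distance function, which is negligible; exchanging the two quantifiers by
  Tonelli gives the claim for almost every starting point.\<close>

lemma AE_strictly_inside:
  assumes t: "0 < t"
  shows "AE x in lborel. AE \<omega> in N. \<omega> \<in> survive_all t x \<longrightarrow>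
     (\<exists>\<rho><R. \<forall>n. \<forall>k\<in>{1..2 ^ n}. norm (x + X (real k * t / 2 ^ n) \<omega>) \<le> \<rho>)"
proof -
  interpret NL: pair_sigma_finite N lborel ..
  \<comment> \<open>The levels \<open>R - 1 / real (Suc m)\<close> are a countable substitute for
    all \<open>\<rho> < R\<close>, which makes the set jointly measurable in path and starting
    point.\<close>
  define L where "L \<omega> = {x. (\<forall>n. \<forall>k\<in>{1..2 ^ n}. norm (x + X (real k * t / 2 ^ n) \<omega>) \<le> R) \<and>
     (\<forall>m::nat. \<exists>n. \<exists>k\<in>{1..2 ^ n}. R - 1 / real (Suc m) < norm (x + X (real k * t / 2 ^ n) \<omega>))}" for \<omega>
  have gm[measurable]: "X (real k * t / 2 ^ n) \<in> borel_measurable N" for k n using t by simp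
  have Lneg: "negligible (L \<omega>)" for \<omega>
  proof -
    define D where "D = (\<Union>n::nat. \<Union>k\<in>{1..2 ^ n}. {X (real k * t / 2 ^ n) \<omega>})"
    have "L \<omega> \<subseteq> {x. (\<forall>d\<in>D. norm (x + d) \<le> R) \<and> (\<forall>\<rho><R. \<exists>d\<in>D. \<rho> < norm (x + d))}"
    proof (intro subsetI CollectI conjI ballI allI impI)
      fix x d assume "x \<in> L \<omega>" "d \<in> D"
      then show "norm (x + d) \<le> R" unfolding L_def D_def by blast
    next
      fix x \<rho> assume x: "x \<in> L \<omega>" and "\<rho> < R"
      then obtain m :: nat where "1 / real (Suc m) < R - \<rho>" using nat_approx_posE[of "R - \<rho>"] by auto
      moreover obtain n k where "k \<in> {1..2 ^ n}" "R - 1 / real (Suc m) < norm (x + X (real k * t / 2 ^ n) \<omega>)"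
        using x unfolding L_def by blast
      ultimately have "X (real k * t / 2 ^ n) \<omega> \<in> D" "\<rho> < norm (x + X (real k * t / 2 ^ n) \<omega>)"
        unfolding D_def by (blast, linarith)
      then show "\<exists>d\<in>D. \<rho> < norm (x + d)" by blast
    qed
    then show ?thesis using negligible_farthest_distance_level[OF R] negligible_subset by blast
  qed
  have Lm: "{z \<in> space (N \<Otimes>\<^sub>M borel). snd z \<in> L (fst z)} \<in> sets (N \<Otimes>\<^sub>M borel)"
    unfolding L_def mem_Collect_eq by measurable
  have "AE x in lborel. x \<notin> L \<omega>" if "\<omega> \<in> space N" for \<omega>
  proof -
    have "Pair \<omega> -` {z \<in> space (N \<Otimes>\<^sub>M borel). snd z \<in> L (fst z)} = L \<omega>"
      using that by (auto simp: space_pair_measure)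
    then have "L \<omega> \<in> sets borel" using sets_Pair1[OF Lm, of \<omega>] by simp
    then have "L \<omega> \<in> null_sets lborel"
      using Lneg[of \<omega>] by (simp add: negligible_iff_null_sets null_sets_completion_iff)
    then show ?thesis by (rule AE_not_in)
  qed
  then have "AE \<omega> in N. AE x in lborel. x \<notin> L \<omega>" by (rule AE_I2)
  then have "AE x in lborel. AE \<omega> in N. x \<notin> L \<omega>"
  proof (subst (asm) NL.AE_commute)
    have "Measurable.pred (N \<Otimes>\<^sub>M borel) (\<lambda>z. snd z \<notin> L (fst z))"
      using Lm by (intro pred_intros_logic) (simp add: pred_def)
    then show "{x \<in> space (N \<Otimes>\<^sub>M lborel). snd x \<notin> L (fst x)} \<in> sets (N \<Otimes>\<^sub>M lborel)"
      by (simp add: pred_def space_pair_measure cong: sets_pair_measure_cong)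
  qed
  then show ?thesis
  proof eventually_elim
    case (elim x)
    then show ?case
    proof eventually_elim
      case (elim \<omega>)
      show ?case
      proof
        assume w: "\<omega> \<in> survive_all t x"
        have "\<forall>n. \<forall>k\<in>{1..2 ^ n}. norm (x + X (real k * t / 2 ^ n) \<omega>) \<le> R"
          using survive_allD[OF w] by (simp add: less_imp_le)
        then obtain m :: nat where "\<forall>n. \<forall>k\<in>{1..2 ^ n}. norm (x + X (real k * t / 2 ^ n) \<omega>) \<le> R - 1 / real (Suc m)"
          using elim unfolding L_def by (auto simp: not_less)
        then show "\<exists>\<rho><R. \<forall>n. \<forall>k\<in>{1..2 ^ n}. norm (x + X (real k * t / 2 ^ n) \<omega>) \<le> \<rho>"
          by (intro exI[of _ "R - 1 / real (Suc m)"]) simp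
      qed
    qed
  qed
qed

text \<open>The margin \<open>\<rho> < R\<close> is what survives limits: right continuity carries
  the closed bound from dyadic times to all times before \<open>t\<close>, and at \<open>t\<close>
  it keeps the path in the open ball for a short while longer, so the exit time is strictly larger
  than \<open>t\<close>.\<close>

lemma exit_time_iff_survive_all:
  assumes t: "0 < t" and path: "cadlag_path (\<lambda>t. X t \<omega>)" and w: "\<omega> \<in> space N"
    and ins: "\<omega> \<in> survive_all t x \<longrightarrow> (\<exists>\<rho><R. \<forall>n. \<forall>k\<in>{1..2 ^ n}. norm (x + X (real k * t / 2 ^ n) \<omega>) \<le> \<rho>)"
  shows "ereal t < exit_time B X x \<omega> \<longleftrightarrow> \<omega> \<in> survive_all t x"
proof
  assume l: "ereal t < exit_time B X x \<omega>"
  have "x + X s \<omega> \<in> B" if "0 < s" "s \<le> t" for s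
  proof (rule ccontr)
    assume "x + X s \<omega> \<notin> B"
    then have "exit_time B X x \<omega> \<le> ereal s" unfolding exit_time_def using that by (intro INF_lower) auto
    also have "\<dots> \<le> ereal t" using that by simp
    finally show False using l by simp
  qed
  moreover have "0 < real k * t / 2 ^ n \<and> real k * t / 2 ^ n \<le> t" if "k \<in> {1..2 ^ n}" for k n :: nat
  proof -
    have "real k \<le> 2 ^ n" using that of_nat_le_iff[of k "2^n", where 'a=real] by simp
    then show ?thesis using that t by (simp add: field_simps)
  qed
  ultimately show "\<omega> \<in> survive_all t x" using w unfolding survive_all_def survive_def by blast
next
  assume s: "\<omega> \<in> survive_all t x"
  then obtain \<rho> where \<rho>: "\<rho> < R" "\<And>n k. k \<in> {1..2 ^ n} \<Longrightarrow> norm (x + X (real k * t / 2 ^ n) \<omega>) \<le> \<rho>"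
    using ins by blast
  have rc: "((\<lambda>t. X t \<omega>) \<longlongrightarrow> X r \<omega>) (at_right r)" if "0 \<le> r" for r
    using path that by (simp add: cadlag_path_def)
  have rn: "((\<lambda>t. norm (x + X t \<omega>)) \<longlongrightarrow> norm (x + X r \<omega>)) (at_right r)" if "0 \<le> r" for r
    using rc[OF that] by (intro tendsto_intros)
  have in1: "norm (x + X r \<omega>) \<le> \<rho>" if r: "0 < r" "r < t" for r
  proof (rule ccontr)
    assume "\<not> norm (x + X r \<omega>) \<le> \<rho>"
    then have "eventually (\<lambda>s. \<rho> < norm (x + X s \<omega>)) (at_right r)"
      using order_tendstoD(1)[OF rn[of r]] r by simp
    then obtain d where d: "d > r" "\<And>s. r < s \<Longrightarrow> s < d \<Longrightarrow> \<rho> < norm (x + X s \<omega>)"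
      by (auto simp: eventually_at_right_field)
    obtain n k :: nat where "k \<in> {1..2 ^ n}" "r < real k * t / 2 ^ n" "real k * t / 2 ^ n < min d t"
      by (rule dyadic_between[of t r "min d t"]) (use t r d in auto)
    then show False using \<rho>(2)[of k n] d(2)[of "real k * t / 2 ^ n"] by simp
  qed
  have in2: "norm (x + X t \<omega>) \<le> \<rho>" using \<rho>(2)[of 1 0] by simp
  then have "eventually (\<lambda>s. norm (x + X s \<omega>) < R) (at_right t)"
    using order_tendstoD(2)[OF rn[of t]] t \<rho>(1) by simp
  then obtain d where d: "d > t" "\<And>s. t < s \<Longrightarrow> s < d \<Longrightarrow> norm (x + X s \<omega>) < R"
    by (auto simp: eventually_at_right_field)
  have "ereal t < ereal d" using d by simp
  also have "\<dots> \<le> exit_time B X x \<omega>"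
    unfolding exit_time_def
  proof (rule INF_greatest)
    fix s assume "s \<in> {s. 0 < s \<and> x + X s \<omega> \<notin> B}"
    then have s: "0 < s" "R \<le> norm (x + X s \<omega>)" by auto
    show "ereal d \<le> ereal s"
    proof (rule ccontr)
      assume "\<not> ereal d \<le> ereal s"
      then have "s < d" by simp
      then show False using s in1[of s] in2 d(2)[of s] \<rho>(1) by (cases s t rule: linorder_cases) auto
    qed
  qed
  finally show "ereal t < exit_time B X x \<omega>" .
qed

lemma AE_killed_emeasure:
  assumes t: "0 < t"
  shows "AE x in lborel. x \<in> B \<longrightarrow> (\<forall>A\<in>sets borel. A \<subseteq> B \<longrightarrow>
    (\<integral>\<^sup>+y\<in>A. ennreal (p t x y) \<partial>lborel) = emeasure N ({\<omega>\<in>space N. x + X t \<omega> \<in> A} \<inter> survive_all t x))"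
  using AE_strictly_inside[OF t]
proof eventually_elim
  case (elim x)
  show ?case
  proof (intro impI ballI)
    fix A :: "'a set" assume x: "x \<in> B" and A[measurable]: "A \<in> sets borel" and AB: "A \<subseteq> B"
    let ?E = "{\<omega>\<in>space N. x + X t \<omega> \<in> A} \<inter> survive_all t x"
    let ?E' = "{\<omega> \<in> space N. x + X t \<omega> \<in> A \<and> ereal t < exit_time B X x \<omega>}"
    have [measurable]: "X t \<in> borel_measurable N" using t by simp
    have "AE \<omega> in N. \<omega> \<in> ?E' \<longleftrightarrow> \<omega> \<in> ?E"
      using elim AE_path AE_space
    proof eventually_elim
      case (elim \<omega>)
      then show ?case using exit_time_iff_survive_all[OF t, of \<omega> x] by auto
    qed
    moreover have "?E \<in> sets N"
    proof (rule sets.Int)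
      show "{\<omega>\<in>space N. x + X t \<omega> \<in> A} \<in> sets N" by measurable
    qed (use t in simp)
    ultimately have "emeasure (completion N) ?E' = emeasure N ?E"
      by (intro completion_emeasure_AE_eq) auto
    then show "(\<integral>\<^sup>+y\<in>A. ennreal (p t x y) \<partial>lborel) = emeasure N ?E"
      using killed x A AB t unfolding killed_transition_density_def by simp
  qed
qed

text \<open>Zero extension of the density with values in [0, infinity]: it is Borel on the whole
  space, so Tonelli comes without domain conditions. It is 0 at time 0, which is why the passage
  time must later be shown to be positive.\<close>

definition q :: "real \<Rightarrow> 'a \<Rightarrow> 'a \<Rightarrow> ennreal" where
  "q t x y = (if 0 < t \<and> x \<in> B \<and> y \<in> B then ennreal (p t x y) else 0)"

lemma q_measurable_triple: "(\<lambda>(t, x, y). q t x y) \<in> borel_measurable borel"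
proof -
  have "continuous_on ({0<..} \<times> B \<times> B) (\<lambda>(t, x, y). p t x y)"
    using killed by (simp add: killed_transition_density_def)
  moreover have "({0<..} \<times> B \<times> B :: (real \<times> 'a \<times> 'a) set) \<in> sets borel"
    by (intro borel_open open_Times) auto
  ultimately have "(\<lambda>z. indicator ({0<..} \<times> B \<times> B) z *\<^sub>R (case z of (t, x, y) \<Rightarrow> p t x y)) \<in> borel_measurable borel"
    by (rule borel_measurable_continuous_on_indicator[rotated])
  then have "(\<lambda>z. ennreal (indicator ({0<..} \<times> B \<times> B) z *\<^sub>R (case z of (t, x, y) \<Rightarrow> p t x y))) \<in> borel_measurable borel"
    by measurable
  also have "(\<lambda>z. ennreal (indicator ({0<..} \<times> B \<times> B) z *\<^sub>R (case z of (t, x, y) \<Rightarrow> p t x y))) = (\<lambda>(t, x, y). q t x y)"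
    by (auto simp: q_def fun_eq_iff split: split_indicator)
  finally show ?thesis .
qed

lemma q_measurable[measurable (raw)]:
  assumes "f \<in> borel_measurable M" "g \<in> M \<rightarrow>\<^sub>M borel" "h \<in> M \<rightarrow>\<^sub>M borel"
  shows "(\<lambda>z. q (f z) (g z) (h z)) \<in> borel_measurable M"
  using measurable_compose[OF borel_measurable_Pair[OF assms(1) borel_measurable_Pair[OF assms(2,3)]] q_measurable_triple]
  by simp

text \<open>The dyadic version of the killed semigroup, read off from the paths at every starting
  point.\<close>

definition S :: "real \<Rightarrow> ('a \<Rightarrow> ennreal) \<Rightarrow> 'a \<Rightarrow> ennreal" where
  "S t g x = (\<integral>\<^sup>+\<omega>. g (x + X t \<omega>) * indicator (survive_all t x) \<omega> \<partial>N)"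

text \<open>The proof is an identity of measures tested on Borel sets, so that one null set of
  starting points serves all \<open>g\<close> at once.\<close>

lemma AE_q_eq_S:
  assumes t: "0 < t"
  shows "AE x in lborel. x \<in> B \<longrightarrow> (\<forall>g\<in>borel_measurable borel. (\<integral>\<^sup>+y. q t x y * g y \<partial>lborel) = S t g x)"
  using AE_killed_emeasure[OF t]
proof eventually_elim
  case (elim x)
  show ?case
  proof (intro impI ballI)
    fix g :: "'a \<Rightarrow> ennreal" assume x: "x \<in> B" and g[measurable]: "g \<in> borel_measurable borel"
    have [measurable]: "X t \<in> borel_measurable N" "survive_all t x \<in> sets N" using t by auto
    have "density lborel (q t x) = distr (density N (indicator (survive_all t x))) borel (\<lambda>\<omega>. x + X t \<omega>)"
    proof (rule measure_eqI)
      fix A assume "A \<in> sets (density lborel (q t x))"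
      then have A[measurable]: "A \<in> sets borel" by simp
      have "emeasure (density lborel (q t x)) A = (\<integral>\<^sup>+y. q t x y * indicator A y \<partial>lborel)"
        by (simp add: emeasure_density)
      also have "\<dots> = (\<integral>\<^sup>+y\<in>A \<inter> B. ennreal (p t x y) \<partial>lborel)"
        using t x by (intro nn_integral_cong) (auto simp: q_def split: split_indicator)
      also have "\<dots> = emeasure N ({\<omega>\<in>space N. x + X t \<omega> \<in> A \<inter> B} \<inter> survive_all t x)"
        using elim x A by (simp add: sets.Int)
      \<comment> \<open>The level 0 grid consists of time \<open>t\<close> alone, so survival
        already puts the end point in the ball.\<close>
      also have "{\<omega>\<in>space N. x + X t \<omega> \<in> A \<inter> B} \<inter> survive_all t x = {\<omega>\<in>space N. x + X t \<omega> \<in> A} \<inter> survive_all t x"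
        using survive_allD[of _ t x 1 0] by auto
      also have "emeasure N \<dots> = (\<integral>\<^sup>+\<omega>. indicator ({\<omega>\<in>space N. x + X t \<omega> \<in> A} \<inter> survive_all t x) \<omega> \<partial>N)"
        by (rule nn_integral_indicator[symmetric], rule sets.Int) measurable
      also have "\<dots> = (\<integral>\<^sup>+\<omega>. indicator (survive_all t x) \<omega> * indicator A (x + X t \<omega>) \<partial>N)"
        by (intro nn_integral_cong) (auto split: split_indicator)
      also have "\<dots> = (\<integral>\<^sup>+y. indicator A y \<partial>distr (density N (indicator (survive_all t x))) borel (\<lambda>\<omega>. x + X t \<omega>))"
        by (subst nn_integral_distr, measurable) (simp add: nn_integral_density)
      finally show "emeasure (density lborel (q t x)) A = emeasure (distr (density N (indicator (survive_all t x))) borel (\<lambda>\<omega>. x + X t \<omega>)) A"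
        by simp
    qed simp
    then have "(\<integral>\<^sup>+y. g y \<partial>density lborel (q t x)) =
       (\<integral>\<^sup>+y. g y \<partial>distr (density N (indicator (survive_all t x))) borel (\<lambda>\<omega>. x + X t \<omega>))" by simp
    then show "(\<integral>\<^sup>+y. q t x y * g y \<partial>lborel) = S t g x"
      unfolding S_def by (simp add: nn_integral_distr nn_integral_density mult.commute)
  qed
qed

end

section \<open>The dyadic walk and the Chapman-Kolmogorov identity for doubled times\<close>

context killed_levy
begin

text \<open>Transition operator of the random walk with increments distributed as
  \<open>X h\<close>, killed when it lands outside the ball.\<close>

definition walk_step :: "real \<Rightarrow> ('a \<Rightarrow> ennreal) \<Rightarrow> 'a \<Rightarrow> ennreal" where
  "walk_step h g z = (\<integral>\<^sup>+\<omega>. indicator B (z + X h \<omega>) * g (z + X h \<omega>) \<partial>N)"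

lemma walk_step_measurable[measurable]:
  assumes "0 \<le> h" and g[measurable]: "g \<in> borel_measurable borel"
  shows "walk_step h g \<in> borel_measurable borel"
proof -
  have [measurable]: "X h \<in> borel_measurable N" using assms by simp
  show ?thesis unfolding walk_step_def by measurable
qed

lemma partial_sums_increments:
  fixes Y :: "nat \<Rightarrow> 'b::ab_group_add"
  shows "(\<Sum>i<k. Y (Suc i) - Y i) = Y k - Y 0"
  by (induction k) auto

text \<open>This is the Markov property at the last step: the last increment is independent of the
  earlier ones and distributed as \<open>X h\<close>, so integrating it out amounts to one
  application of \<open>walk_step\<close>.\<close>

lemma walk_step_split:
  assumes h: "0 \<le> h" and g[measurable]: "g \<in> borel_measurable borel"
  shows "(\<integral>\<^sup>+\<omega>. g (x + X (real (Suc k) * h) \<omega>) * (\<Prod>j\<in>{1..Suc k}. indicator B (x + X (real j * h) \<omega>)) \<partial>N) =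
     (\<integral>\<^sup>+\<omega>. walk_step h g (x + X (real k * h) \<omega>) * (\<Prod>j\<in>{1..k}. indicator B (x + X (real j * h) \<omega>)) \<partial>N)"
proof -
  define Y where "Y i \<omega> = X (real (Suc i) * h) \<omega> - X (real i * h) \<omega>" for i \<omega>
  have Xm[measurable]: "X (real i * h) \<in> borel_measurable N" for i using h by simp
  have Xh[measurable]: "X h \<in> borel_measurable N" using h by simp
  have Ym[measurable]: "Y i \<in> borel_measurable N" for i unfolding Y_def by measurable
  have "indep_vars (\<lambda>_. borel) (\<lambda>i \<omega>. X (real (Suc i) * h) \<omega> - X (real i * h) \<omega>) {..<Suc k}"
  proof -
    have "0 \<le> real 0 * h \<and> (\<forall>i<Suc k. real i * h \<le> real (Suc i) * h)"
      using h by (auto intro!: mult_right_mono)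
    moreover have "\<forall>(n::nat) ts. 0 \<le> ts 0 \<and> (\<forall>i<n. ts i \<le> ts (Suc i)) \<longrightarrow>
        indep_vars (\<lambda>_. borel) (\<lambda>i \<omega>. X (ts (Suc i)) \<omega> - X (ts i) \<omega>) {..<n}"
      using levy unfolding levy_process_def by (elim conjE)
    ultimately show ?thesis by (elim allE[of _ "Suc k"] allE[of _ "\<lambda>i. real i * h"] mp)
  qed
  then have ind: "indep_vars (\<lambda>_. borel) Y {..<Suc k}" unfolding Y_def .
  have dist: "distr N borel (Y k) = distr N borel (X h)"
  proof -
    have "distr N borel (\<lambda>\<omega>. X (real k * h + h) \<omega> - X (real k * h) \<omega>) = distr N borel (X h)"
      using levy h unfolding levy_process_def by simp
    then show ?thesis by (simp add: Y_def[abs_def] algebra_simps)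
  qed
  let ?P = "PiM {..<k} (\<lambda>_. borel :: 'a measure)"
  let ?Q = "PiM {k} (\<lambda>_. borel :: 'a measure)"
  let ?y1 = "\<lambda>\<omega>. restrict (\<lambda>i. Y i \<omega>) {..<k}"
  let ?y2 = "\<lambda>\<omega>. restrict (\<lambda>i. Y i \<omega>) {k}"
  have iv: "indep_var ?P ?y1 ?Q ?y2"
    by (rule indep_var_restrict[OF ind]) auto
  have ym1[measurable]: "?y1 \<in> N \<rightarrow>\<^sub>M ?P" and ym2[measurable]: "?y2 \<in> N \<rightarrow>\<^sub>M ?Q"
    using iv by (auto dest: indep_var_rv1 indep_var_rv2)
  have wk[measurable]: "(\<lambda>w. w k) \<in> ?Q \<rightarrow>\<^sub>M borel"
    by (rule measurable_component_singleton) simp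
  \<comment> \<open>Independence is available for increments only, so the positions are rebuilt from
    them; they agree with the process almost surely, since \<open>X 0\<close> vanishes only almost
    surely.\<close>
  define pos where "pos y j = x + (\<Sum>i<j. y i)" for y :: "nat \<Rightarrow> 'a" and j :: nat
  have pos_m[measurable]: "(\<lambda>y. pos y j) \<in> ?P \<rightarrow>\<^sub>M borel" if "j \<le> k" for j
    unfolding pos_def using that
    by (intro borel_measurable_add borel_measurable_sum measurable_const measurable_component_singleton) auto
  define \<Phi> where "\<Phi> y = (\<Prod>j\<in>{1..k}. indicator B (pos y j) :: ennreal)" for y
  have \<Phi>m[measurable]: "\<Phi> \<in> borel_measurable ?P"
    unfolding \<Phi>_def
  proof (intro borel_measurable_prod_ennreal)
    fix j assume "j \<in> {1..k}"
    then have [measurable]: "(\<lambda>y. pos y j) \<in> ?P \<rightarrow>\<^sub>M borel" using pos_m by auto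
    show "(\<lambda>y. indicator B (pos y j) :: ennreal) \<in> borel_measurable ?P"
      by (rule measurable_compose[where N=borel]) (auto intro!: borel_measurable_indicator)
  qed
  have pos_k[measurable]: "(\<lambda>y. pos y k) \<in> ?P \<rightarrow>\<^sub>M borel" by (rule pos_m) simp
  have posX: "AE \<omega> in N. \<forall>j\<le>k. pos (?y1 \<omega>) j = x + X (real j * h) \<omega>"
    using AE_path
  proof eventually_elim
    case (elim \<omega>)
    show ?case
    proof (intro allI impI)
      fix j assume j: "j \<le> k"
      have "(\<Sum>i<j. ?y1 \<omega> i) = (\<Sum>i<j. X (real (Suc i) * h) \<omega> - X (real i * h) \<omega>)"
        using j by (intro sum.cong refl) (auto simp: Y_def)
      also have "\<dots> = X (real j * h) \<omega> - X (real 0 * h) \<omega>" by (rule partial_sums_increments)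
      finally show "pos (?y1 \<omega>) j = x + X (real j * h) \<omega>" using elim by (simp add: pos_def)
    qed
  qed
  have bm: "(\<lambda>z::'a. indicator B z :: ennreal) \<in> borel_measurable borel" by (auto intro!: borel_measurable_indicator)
  note [measurable] = bm
  have Yk[measurable]: "Y k \<in> borel_measurable N" by simp
  interpret D1: prob_space "distr N ?P ?y1" by (rule prob_space_distr) simp
  interpret D2: prob_space "distr N ?Q ?y2" by (rule prob_space_distr) simp
  have "(\<integral>\<^sup>+\<omega>. g (x + X (real (Suc k) * h) \<omega>) * (\<Prod>j\<in>{1..Suc k}. indicator B (x + X (real j * h) \<omega>)) \<partial>N) =
     (\<integral>\<^sup>+\<omega>. (\<lambda>(y, w). indicator B (pos y k + w k) * g (pos y k + w k) * \<Phi> y) (?y1 \<omega>, ?y2 \<omega>) \<partial>N)"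
  proof (rule nn_integral_cong_AE)
    show "AE \<omega> in N. g (x + X (real (Suc k) * h) \<omega>) * (\<Prod>j\<in>{1..Suc k}. indicator B (x + X (real j * h) \<omega>)) =
       (\<lambda>(y, w). indicator B (pos y k + w k) * g (pos y k + w k) * \<Phi> y) (?y1 \<omega>, ?y2 \<omega>)"
      using posX
    proof eventually_elim
      case (elim \<omega>)
      have 1: "pos (?y1 \<omega>) k + ?y2 \<omega> k = x + X (real (Suc k) * h) \<omega>"
        using elim by (auto simp: Y_def)
      have 2: "\<Phi> (?y1 \<omega>) = (\<Prod>j\<in>{1..k}. indicator B (x + X (real j * h) \<omega>))"
        unfolding \<Phi>_def using elim by (intro prod.cong) auto
      have 3: "(\<Prod>j\<in>{1..Suc k}. indicator B (x + X (real j * h) \<omega>) :: ennreal) =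
          indicator B (x + X (real (Suc k) * h) \<omega>) * (\<Prod>j\<in>{1..k}. indicator B (x + X (real j * h) \<omega>))"
        by (subst prod.nat_ivl_Suc') auto
      show ?case unfolding prod.case 1 2 3 by (simp only: mult_ac)
    qed
  qed
  also have "\<dots> = (\<integral>\<^sup>+z. (\<lambda>(y, w). indicator B (pos y k + w k) * g (pos y k + w k) * \<Phi> y) z
      \<partial>distr N (?P \<Otimes>\<^sub>M ?Q) (\<lambda>\<omega>. (?y1 \<omega>, ?y2 \<omega>)))"
    by (rule nn_integral_distr[symmetric]) measurable
  also have "distr N (?P \<Otimes>\<^sub>M ?Q) (\<lambda>\<omega>. (?y1 \<omega>, ?y2 \<omega>)) = distr N ?P ?y1 \<Otimes>\<^sub>M distr N ?Q ?y2"
    using iv unfolding indep_var_distribution_eq by simp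
  also have "(\<integral>\<^sup>+z. (\<lambda>(y, w). indicator B (pos y k + w k) * g (pos y k + w k) * \<Phi> y) z
      \<partial>(distr N ?P ?y1 \<Otimes>\<^sub>M distr N ?Q ?y2)) =
     (\<integral>\<^sup>+y. \<integral>\<^sup>+w. indicator B (pos y k + w k) * g (pos y k + w k) * \<Phi> y \<partial>distr N ?Q ?y2 \<partial>distr N ?P ?y1)"
    by (subst D2.nn_integral_fst[symmetric]) (auto simp: split_beta' cong: measurable_cong_sets)
  also have "\<dots> = (\<integral>\<^sup>+y. \<integral>\<^sup>+w. indicator B (pos y k + w) * g (pos y k + w) * \<Phi> y \<partial>distr N borel (X h) \<partial>distr N ?P ?y1)"
  proof (rule nn_integral_cong)
    fix y assume "y \<in> space (distr N ?P ?y1)"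
    have "(\<integral>\<^sup>+w. indicator B (pos y k + w k) * g (pos y k + w k) * \<Phi> y \<partial>distr N ?Q ?y2) =
        (\<integral>\<^sup>+\<omega>. indicator B (pos y k + ?y2 \<omega> k) * g (pos y k + ?y2 \<omega> k) * \<Phi> y \<partial>N)"
      by (rule nn_integral_distr) measurable
    also have "\<dots> = (\<integral>\<^sup>+\<omega>. indicator B (pos y k + Y k \<omega>) * g (pos y k + Y k \<omega>) * \<Phi> y \<partial>N)" by simp
    also have "\<dots> = (\<integral>\<^sup>+w. indicator B (pos y k + w) * g (pos y k + w) * \<Phi> y \<partial>distr N borel (Y k))"
    proof (rule nn_integral_distr[symmetric, OF Yk])
      note wk[measurable del]
      have "(\<lambda>w. indicator B (pos y k + w) * g (pos y k + w) * \<Phi> y) \<in> borel_measurable borel"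
        by measurable
      then show "(\<lambda>w. indicator B (pos y k + w) * g (pos y k + w) * \<Phi> y) \<in> borel_measurable (distr N borel (Y k))"
        by simp
    qed
    finally show "(\<integral>\<^sup>+w. indicator B (pos y k + w k) * g (pos y k + w k) * \<Phi> y \<partial>distr N ?Q ?y2) =
        (\<integral>\<^sup>+w. indicator B (pos y k + w) * g (pos y k + w) * \<Phi> y \<partial>distr N borel (X h))"
      unfolding dist .
  qed
  also have "\<dots> = (\<integral>\<^sup>+\<omega>. \<integral>\<^sup>+w. indicator B (pos (?y1 \<omega>) k + w) * g (pos (?y1 \<omega>) k + w) * \<Phi> (?y1 \<omega>) \<partial>distr N borel (X h) \<partial>N)"
  proof (rule nn_integral_distr)
    note wk[measurable del]
    interpret DX: prob_space "distr N borel (X h)" by (rule prob_space_distr) simp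
    have [measurable]: "(\<lambda>z. indicator B (pos (fst z) k + snd z) * g (pos (fst z) k + snd z) * \<Phi> (fst z)) \<in> borel_measurable (?P \<Otimes>\<^sub>M borel)"
      by measurable
    have "(\<lambda>y. \<integral>\<^sup>+w. indicator B (pos y k + w) * g (pos y k + w) * \<Phi> y \<partial>distr N borel (X h)) \<in> borel_measurable ?P"
      by (rule DX.borel_measurable_nn_integral) (simp add: split_beta' cong: measurable_cong_sets)
    then show "(\<lambda>y. \<integral>\<^sup>+w. indicator B (pos y k + w) * g (pos y k + w) * \<Phi> y \<partial>distr N borel (X h)) \<in> borel_measurable (distr N ?P ?y1)"
      by simp
  qed simp
  also have "\<dots> = (\<integral>\<^sup>+\<omega>. walk_step h g (pos (?y1 \<omega>) k) * \<Phi> (?y1 \<omega>) \<partial>N)"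
  proof (intro nn_integral_cong)
    note wk[measurable del]
    fix \<omega>
    have "(\<integral>\<^sup>+w. indicator B (pos (?y1 \<omega>) k + w) * g (pos (?y1 \<omega>) k + w) * \<Phi> (?y1 \<omega>) \<partial>distr N borel (X h)) =
      (\<integral>\<^sup>+w. indicator B (pos (?y1 \<omega>) k + w) * g (pos (?y1 \<omega>) k + w) \<partial>distr N borel (X h)) * \<Phi> (?y1 \<omega>)"
      by (rule nn_integral_multc) measurable
    also have "(\<integral>\<^sup>+w. indicator B (pos (?y1 \<omega>) k + w) * g (pos (?y1 \<omega>) k + w) \<partial>distr N borel (X h)) = walk_step h g (pos (?y1 \<omega>) k)"
      unfolding walk_step_def by (rule nn_integral_distr) measurable
    finally show "(\<integral>\<^sup>+w. indicator B (pos (?y1 \<omega>) k + w) * g (pos (?y1 \<omega>) k + w) * \<Phi> (?y1 \<omega>) \<partial>distr N borel (X h)) =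
       walk_step h g (pos (?y1 \<omega>) k) * \<Phi> (?y1 \<omega>)" .
  qed
  also have "\<dots> = (\<integral>\<^sup>+\<omega>. walk_step h g (x + X (real k * h) \<omega>) * (\<Prod>j\<in>{1..k}. indicator B (x + X (real j * h) \<omega>)) \<partial>N)"
  proof (rule nn_integral_cong_AE)
    show "AE \<omega> in N. walk_step h g (pos (?y1 \<omega>) k) * \<Phi> (?y1 \<omega>) =
       walk_step h g (x + X (real k * h) \<omega>) * (\<Prod>j\<in>{1..k}. indicator B (x + X (real j * h) \<omega>))"
      using posX
    proof eventually_elim
      case (elim \<omega>)
      have "\<Phi> (?y1 \<omega>) = (\<Prod>j\<in>{1..k}. indicator B (x + X (real j * h) \<omega>))"
        unfolding \<Phi>_def using elim by (intro prod.cong) auto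
      then show ?case using elim by simp
    qed
  qed
  finally show ?thesis .
qed

text \<open>Peeling off the last time step replaces \<open>g\<close> by
  \<open>walk_step h g\<close>, which is why the induction runs over all measurable
  \<open>g\<close>.\<close>

lemma walk_step_power:
  assumes h: "0 \<le> h" and "g \<in> borel_measurable borel"
  shows "(walk_step h ^^ k) g x =
     (\<integral>\<^sup>+\<omega>. g (x + X (real k * h) \<omega>) * (\<Prod>j\<in>{1..k}. indicator B (x + X (real j * h) \<omega>)) \<partial>N)"
  using assms(2)
proof (induction k arbitrary: g)
  case 0
  have "(\<integral>\<^sup>+\<omega>. g (x + X 0 \<omega>) \<partial>N) = (\<integral>\<^sup>+\<omega>. g x \<partial>N)"
    using AE_path by (intro nn_integral_cong_AE) (auto elim!: eventually_mono)
  then show ?case by (simp add: emeasure_space_1)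
next
  case (Suc k)
  have "(walk_step h ^^ Suc k) g x = (walk_step h ^^ k) (walk_step h g) x"
    by (simp only: funpow_Suc_right comp_apply)
  also have "\<dots> = (\<integral>\<^sup>+\<omega>. walk_step h g (x + X (real k * h) \<omega>) * (\<Prod>j\<in>{1..k}. indicator B (x + X (real j * h) \<omega>)) \<partial>N)"
    using Suc.prems h by (intro Suc.IH walk_step_measurable)
  also have "\<dots> = (\<integral>\<^sup>+\<omega>. g (x + X (real (Suc k) * h) \<omega>) * (\<Prod>j\<in>{1..Suc k}. indicator B (x + X (real j * h) \<omega>)) \<partial>N)"
    by (rule walk_step_split[OF h Suc.prems, symmetric])
  finally show ?case .
qed

definition Sn :: "real \<Rightarrow> nat \<Rightarrow> ('a \<Rightarrow> ennreal) \<Rightarrow> 'a \<Rightarrow> ennreal" where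
  "Sn t n g x = (\<integral>\<^sup>+\<omega>. g (x + X t \<omega>) * indicator (survive t n x) \<omega> \<partial>N)"

lemma Sn_measurable:
  assumes t: "0 \<le> t" and g[measurable]: "g \<in> borel_measurable borel"
  shows "Sn t n g \<in> borel_measurable borel"
proof -
  have [measurable]: "X t \<in> borel_measurable N" using t by simp
  have "(\<lambda>x. \<integral>\<^sup>+\<omega>. (\<lambda>z. g (fst z + X t (snd z)) * indicator (survive t n (fst z)) (snd z)) (x, \<omega>) \<partial>N) \<in> borel_measurable borel"
    using t by measurable
  then show ?thesis by (simp add: Sn_def[abs_def])
qed

lemma Sn_eq_power:
  assumes "0 \<le> t" "g \<in> borel_measurable borel"
  shows "Sn t n g x = (walk_step (t / 2 ^ n) ^^ (2 ^ n)) g x"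
proof -
  have "indicator (survive t n x) \<omega> = (\<Prod>j\<in>{1..2 ^ n}. indicator B (x + X (real j * (t / 2 ^ n)) \<omega>) :: ennreal)"
    if w: "\<omega> \<in> space N" for \<omega>
  proof (cases "\<omega> \<in> survive t n x")
    case True
    then have "(\<Prod>j\<in>{1..2 ^ n}. indicator B (x + X (real j * (t / 2 ^ n)) \<omega>) :: ennreal) = (\<Prod>j\<in>{1..(2::nat) ^ n}. 1)"
      by (intro prod.cong refl) (auto simp: survive_def indicator_def)
    then show ?thesis using True by simp
  next
    case False
    then obtain j where "j \<in> {1..(2::nat)^n}" "x + X (real j * (t / 2 ^ n)) \<omega> \<notin> B"
      using False w by (auto simp: survive_def)
    then have "(\<Prod>j\<in>{1..2 ^ n}. indicator B (x + X (real j * (t / 2 ^ n)) \<omega>) :: ennreal) = 0"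
      by (intro prod_zero) (auto intro!: bexI[of _ j] simp: indicator_def)
    then show ?thesis using False by simp
  qed
  moreover have "real (2 ^ n) * (t / 2 ^ n) = t" by simp
  ultimately show ?thesis
    unfolding Sn_def using assms
    by (subst walk_step_power) (auto intro!: nn_integral_cong)
qed

text \<open>The grid of level \<open>Suc n\<close> on [0, 2t] has the mesh of the grid of level
  \<open>n\<close> on [0, t] and twice as many steps, so the two walks compose exactly. Keeping to
  dyadic grids restricts the conclusion to doubled times.\<close>

lemma Sn_double:
  assumes t: "0 \<le> t" and g[measurable]: "g \<in> borel_measurable borel"
  shows "Sn (2 * t) (Suc n) g x = Sn t n (Sn t n g) x"
proof -
  let ?W = "walk_step (t / 2 ^ n)"
  have "Sn (2 * t) (Suc n) g x = (?W ^^ (2 ^ n + 2 ^ n)) g x"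
  proof -
    have "(2::nat) ^ Suc n = 2 ^ n + 2 ^ n" "2 * t / 2 ^ Suc n = t / 2 ^ n" by simp_all
    then show ?thesis using Sn_eq_power[of "2 * t" g "Suc n" x] t g by (simp only:)
  qed
  also have "\<dots> = (?W ^^ (2 ^ n)) ((?W ^^ (2 ^ n)) g) x" by (simp add: funpow_add)
  also have "(?W ^^ (2 ^ n)) g = Sn t n g" using t g by (intro ext Sn_eq_power[symmetric])
  also have "(?W ^^ (2 ^ n)) (Sn t n g) x = Sn t n (Sn t n g) x" using t Sn_measurable[OF t g] by (intro Sn_eq_power[symmetric])
  finally show ?thesis .
qed

lemma S_measurable[measurable]:
  assumes t: "0 \<le> t" and g[measurable]: "g \<in> borel_measurable borel"
  shows "S t g \<in> borel_measurable borel"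
proof -
  have [measurable]: "X t \<in> borel_measurable N" using t by simp
  have "(\<lambda>x. \<integral>\<^sup>+\<omega>. (\<lambda>z. g (fst z + X t (snd z)) * indicator (survive_all t (fst z)) (snd z)) (x, \<omega>) \<partial>N) \<in> borel_measurable borel"
    using t by measurable
  then show ?thesis by (simp add: S_def[abs_def])
qed

text \<open>The integrand may vary with \<open>n\<close> because in a composition of two discretised
  semigroups the inner one depends on \<open>n\<close> too. The survival events decrease, so each
  path leaves them from some level on unless it survives at all levels.\<close>

lemma Sn_tendsto_S:
  assumes t: "0 \<le> t"
    and gn[measurable]: "\<And>n. gn n \<in> borel_measurable borel" and bd: "\<And>n y. gn n y \<le> 1"
    and lim: "\<And>y. (\<lambda>n. gn n y) \<longlonglongrightarrow> g y"
  shows "(\<lambda>n. Sn t n (gn n) x) \<longlonglongrightarrow> S t g x"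
proof -
  have [measurable]: "X t \<in> borel_measurable N" using t by simp
  have gm[measurable]: "g \<in> borel_measurable borel"
    by (rule borel_measurable_LIMSEQ_order[where u=gn]) (use lim in auto)
  have sv[measurable]: "survive t n x \<in> sets N" "survive_all t x \<in> sets N" for n using t by auto
  show ?thesis unfolding Sn_def S_def
  proof (rule nn_integral_dominated_convergence[where w="\<lambda>_. 1"])
    show "AE \<omega> in N. (\<lambda>n. gn n (x + X t \<omega>) * indicator (survive t n x) \<omega>) \<longlonglongrightarrow> g (x + X t \<omega>) * indicator (survive_all t x) \<omega>"
    proof (rule AE_I2)
      fix \<omega>
      have dec: "decseq (\<lambda>n. survive t n x)" using survive_antimono by (intro decseq_SucI) auto
      show "(\<lambda>n. gn n (x + X t \<omega>) * indicator (survive t n x) \<omega>) \<longlonglongrightarrow> g (x + X t \<omega>) * indicator (survive_all t x) \<omega>"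
      proof (cases "\<omega> \<in> survive_all t x")
        case True
        then have "\<omega> \<in> survive t n x" for n by (auto simp: survive_all_def)
        then show ?thesis using lim[of "x + X t \<omega>"] True by simp
      next
        case False
        then obtain m where m: "\<omega> \<notin> survive t m x" by (auto simp: survive_all_def)
        have "\<forall>\<^sub>F n in sequentially. gn n (x + X t \<omega>) * indicator (survive t n x) \<omega> = 0"
          using eventually_ge_at_top[of m]
        proof eventually_elim
          case (elim n)
          then have "\<omega> \<notin> survive t n x" using m decseqD[OF dec elim] by auto
          then show ?case by simp
        qed
        then show ?thesis using False by (simp add: tendsto_eventually)
      qed
    qed
    show "AE \<omega> in N. gn n (x + X t \<omega>) * indicator (survive t n x) \<omega> \<le> 1" for n
      using bd by (auto split: split_indicator)
  qed (auto simp: emeasure_space_1)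
qed

lemma S_double:
  assumes t: "0 \<le> t" and g[measurable]: "g \<in> borel_measurable borel" and bd: "\<And>y. g y \<le> 1"
  shows "S (2 * t) g x = S t (S t g) x"
proof -
  have [measurable]: "X t \<in> borel_measurable N" using t by simp
  have le1: "Sn t n g y \<le> 1" for n y
  proof -
    have "Sn t n g y \<le> (\<integral>\<^sup>+\<omega>. 1 \<partial>N)"
      unfolding Sn_def using bd by (intro nn_integral_mono) (auto split: split_indicator)
    then show ?thesis by (simp add: emeasure_space_1)
  qed
  have "(\<lambda>n. Sn t n (Sn t n g) x) \<longlonglongrightarrow> S t (S t g) x"
    using Sn_tendsto_S[OF t g bd] by (intro Sn_tendsto_S[OF t Sn_measurable[OF t g] le1]) auto
  moreover have "(\<lambda>n. Sn (2 * t) (Suc n) g x) \<longlonglongrightarrow> S (2 * t) g x"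
    using t bd by (intro LIMSEQ_Suc[OF Sn_tendsto_S[of "2 * t" "\<lambda>_. g" g x]]) auto
  ultimately show ?thesis
    unfolding Sn_double[OF t g] using LIMSEQ_unique by blast
qed

text \<open>Both sides are integrals of \<open>g\<close> against measures, so it suffices to compare
  them on indicators, which satisfy the bound by 1 required for passing to the limit in the
  grid.\<close>

lemma chapman_kolmogorov:
  assumes t: "0 < t"
  shows "AE x in lborel. \<forall>g\<in>borel_measurable borel.
    (\<integral>\<^sup>+y. q (2 * t) x y * g y \<partial>lborel) = (\<integral>\<^sup>+z. q t x z * (\<integral>\<^sup>+y. q t z y * g y \<partial>lborel) \<partial>lborel)"
proof -
  have t2: "0 < 2 * t" using t by simp
  show ?thesis using AE_q_eq_S[OF t] AE_q_eq_S[OF t2]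
  proof eventually_elim
    case (elim x)
    show ?case
    proof (cases "x \<in> B")
      case False
      then show ?thesis by (simp add: q_def)
    next
      case x: True
      have ind: "(\<integral>\<^sup>+y. q (2 * t) x y * indicator A y \<partial>lborel) = (\<integral>\<^sup>+z. q t x z * (\<integral>\<^sup>+y. q t z y * indicator A y \<partial>lborel) \<partial>lborel)"
        if A[measurable]: "A \<in> sets borel" for A
      proof -
        have "(\<integral>\<^sup>+y. q (2 * t) x y * indicator A y \<partial>lborel) = S (2 * t) (indicator A) x"
          using elim x by simp
        also have "\<dots> = S t (S t (indicator A)) x"
          using t by (intro S_double) (auto split: split_indicator)
        also have "\<dots> = (\<integral>\<^sup>+z. q t x z * S t (indicator A) z \<partial>lborel)"
          using elim x t S_measurable[of t "indicator A"] by simp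
        also have "\<dots> = (\<integral>\<^sup>+z. q t x z * (\<integral>\<^sup>+y. q t z y * indicator A y \<partial>lborel) \<partial>lborel)"
        proof (rule nn_integral_cong_AE)
          \<comment> \<open>The intermediate points where \<open>S\<close> and the kernel disagree
            form a Lebesgue null set, which is invisible to a measure with density
            \<open>q t x\<close>.\<close>
          show "AE z in lborel. q t x z * S t (indicator A) z = q t x z * (\<integral>\<^sup>+y. q t z y * indicator A y \<partial>lborel)"
            using AE_q_eq_S[OF t]
          proof eventually_elim
            case (elim z)
            then show ?case by (cases "z \<in> B") (auto simp: q_def)
          qed
        qed
        finally show ?thesis .
      qed
      have swap: "(\<integral>\<^sup>+z. q t x z * (\<integral>\<^sup>+y. q t z y * g y \<partial>lborel) \<partial>lborel) =
         (\<integral>\<^sup>+y. (\<integral>\<^sup>+z. q t x z * q t z y \<partial>lborel) * g y \<partial>lborel)"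
        if [measurable]: "g \<in> borel_measurable borel" for g
      proof -
        have "(\<integral>\<^sup>+z. q t x z * (\<integral>\<^sup>+y. q t z y * g y \<partial>lborel) \<partial>lborel) =
           (\<integral>\<^sup>+z. \<integral>\<^sup>+y. q t x z * (q t z y * g y) \<partial>lborel \<partial>lborel)"
          by (simp add: nn_integral_cmult)
        also have "\<dots> = (\<integral>\<^sup>+y. \<integral>\<^sup>+z. q t x z * (q t z y * g y) \<partial>lborel \<partial>lborel)"
          by (rule lborel_pair.Fubini') measurable
        also have "\<dots> = (\<integral>\<^sup>+y. (\<integral>\<^sup>+z. q t x z * q t z y \<partial>lborel) * g y \<partial>lborel)"
          by (simp add: nn_integral_multc[symmetric] mult.assoc)
        finally show ?thesis .
      qed
      have eq: "density lborel (q (2 * t) x) = density lborel (\<lambda>y. \<integral>\<^sup>+z. q t x z * q t z y \<partial>lborel)"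
        by (rule measure_eqI) (auto simp: emeasure_density ind swap)
      show ?thesis
      proof
        fix g :: "'a \<Rightarrow> ennreal" assume [measurable]: "g \<in> borel_measurable borel"
        have "(\<integral>\<^sup>+y. g y \<partial>density lborel (q (2 * t) x)) = (\<integral>\<^sup>+y. g y \<partial>density lborel (\<lambda>y. \<integral>\<^sup>+z. q t x z * q t z y \<partial>lborel))"
          by (simp only: eq)
        then show "(\<integral>\<^sup>+y. q (2 * t) x y * g y \<partial>lborel) = (\<integral>\<^sup>+z. q t x z * (\<integral>\<^sup>+y. q t z y * g y \<partial>lborel) \<partial>lborel)"
          by (simp add: nn_integral_density swap)
      qed
    qed
  qed
qed

lemma q_mass_le_1:
  shows "(\<integral>\<^sup>+y. q t x y \<partial>lborel) \<le> 1"
proof (cases "0 < t \<and> x \<in> B")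
  case True
  interpret C: prob_space "completion N" by (rule prob_space_completion)
  have "(\<integral>\<^sup>+y. q t x y \<partial>lborel) = (\<integral>\<^sup>+y\<in>B. ennreal (p t x y) \<partial>lborel)"
    using True by (intro nn_integral_cong) (auto simp: q_def split: split_indicator)
  also have "\<dots> = emeasure (completion N) {\<omega> \<in> space N. x + X t \<omega> \<in> B \<and> ereal t < exit_time B X x \<omega>}"
  proof -
    have "\<forall>t>0. \<forall>x\<in>B. \<forall>A\<in>sets borel. A \<subseteq> B \<longrightarrow>
        emeasure (completion N) {\<omega> \<in> space N. x + X t \<omega> \<in> A \<and> ereal t < exit_time B X x \<omega>}
        = (\<integral>\<^sup>+y\<in>A. ennreal (p t x y) \<partial>lborel)"
      using killed unfolding killed_transition_density_def by blast
    then show ?thesis using True B_sets by (blast intro: sym)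
  qed
  also have "\<dots> \<le> 1" by (rule C.measure_le_1)
  finally show ?thesis .
qed (auto simp: q_def)

text \<open>Dropping the killing only enlarges the left-hand side, and the translation by
  \<open>X t\<close> preserves Lebesgue measure. This column bound complements the obvious row bound
  and makes the kernel a contraction of L2.\<close>

lemma q_dual_set_le:
  assumes t: "0 < t" and A[measurable]: "A \<in> sets borel"
  shows "(\<integral>\<^sup>+y. (\<integral>\<^sup>+x. q t x y \<partial>lborel) * indicator A y \<partial>lborel) \<le> emeasure lborel A"
proof -
  interpret NL: pair_sigma_finite N "lborel :: 'a measure" ..
  have [measurable]: "X t \<in> borel_measurable N" using t by simp
  have "(\<integral>\<^sup>+y. (\<integral>\<^sup>+x. q t x y \<partial>lborel) * indicator A y \<partial>lborel) = (\<integral>\<^sup>+y. \<integral>\<^sup>+x. q t x y * indicator A y \<partial>lborel \<partial>lborel)"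
    by (simp add: nn_integral_multc)
  also have "\<dots> = (\<integral>\<^sup>+x. \<integral>\<^sup>+y. q t x y * indicator A y \<partial>lborel \<partial>lborel)"
    by (rule lborel_pair.Fubini') measurable
  also have "\<dots> \<le> (\<integral>\<^sup>+x. \<integral>\<^sup>+\<omega>. indicator A (x + X t \<omega>) \<partial>N \<partial>lborel)"
  proof (rule nn_integral_mono_AE)
    show "AE x in lborel. (\<integral>\<^sup>+y. q t x y * indicator A y \<partial>lborel) \<le> (\<integral>\<^sup>+\<omega>. indicator A (x + X t \<omega>) \<partial>N)"
      using AE_q_eq_S[OF t]
    proof eventually_elim
      case (elim x)
      show ?case
      proof (cases "x \<in> B")
        case True
        then have "(\<integral>\<^sup>+y. q t x y * indicator A y \<partial>lborel) = S t (indicator A) x" using elim by simp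
        also have "\<dots> \<le> (\<integral>\<^sup>+\<omega>. indicator A (x + X t \<omega>) \<partial>N)"
          unfolding S_def by (intro nn_integral_mono) (auto split: split_indicator)
        finally show ?thesis .
      qed (auto simp: q_def)
    qed
  qed
  also have "\<dots> = (\<integral>\<^sup>+\<omega>. \<integral>\<^sup>+x. indicator A (x + X t \<omega>) \<partial>lborel \<partial>N)"
    by (rule NL.Fubini') measurable
  also have "\<dots> = (\<integral>\<^sup>+\<omega>. emeasure lborel A \<partial>N)"
  proof (rule nn_integral_cong)
    fix \<omega>
    have "(\<integral>\<^sup>+x. indicator A (x + X t \<omega>) \<partial>lborel) = (\<integral>\<^sup>+x. indicator A x \<partial>distr lborel borel ((+) (X t \<omega>)))"
      by (subst nn_integral_distr) (auto simp: add.commute)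
    also have "\<dots> = emeasure lborel A" by (simp add: lborel_distr_plus)
    finally show "(\<integral>\<^sup>+x. indicator A (x + X t \<omega>) \<partial>lborel) = emeasure lborel A" .
  qed
  also have "\<dots> = emeasure lborel A" by (simp add: emeasure_space_1)
  finally show ?thesis .
qed

lemma q_dual_mass_le_1:
  assumes t: "0 < t"
  shows "AE y in lborel. (\<integral>\<^sup>+x. q t x y \<partial>lborel) \<le> 1"
proof -
  define f where "f y = (\<integral>\<^sup>+x. q t x y \<partial>lborel)" for y
  have [measurable]: "f \<in> borel_measurable borel" unfolding f_def by measurable
  have "AE y in lborel. \<not> (ennreal (1 + 1 / real (Suc m)) \<le> f y \<and> norm y \<le> real m)" for m :: nat
  proof -
    \<comment> \<open>The radius \<open>real m\<close> makes the measure finite, so that multiplying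
      it by \<open>1 + 1 / real (Suc m)\<close> without increase forces it to be 0; a single index
      serves level and radius.\<close>
    let ?A = "{y. ennreal (1 + 1 / real (Suc m)) \<le> f y \<and> norm y \<le> real m}"
    have A[measurable]: "?A \<in> sets borel" by measurable
    have "emeasure lborel ?A \<le> emeasure lborel (cball (0::'a) (real m))" by (intro emeasure_mono) auto
    also have "\<dots> < \<infinity>" by (rule emeasure_bounded_finite) simp
    finally have fin: "emeasure lborel ?A < \<infinity>" .
    have "ennreal (1 + 1 / real (Suc m)) * emeasure lborel ?A = (\<integral>\<^sup>+y. ennreal (1 + 1 / real (Suc m)) * indicator ?A y \<partial>lborel)"
      by (rule nn_integral_cmult_indicator[symmetric]) simp
    also have "\<dots> \<le> (\<integral>\<^sup>+y. f y * indicator ?A y \<partial>lborel)"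
      by (intro nn_integral_mono) (auto split: split_indicator)
    also have "\<dots> \<le> emeasure lborel ?A" unfolding f_def by (intro q_dual_set_le[OF t]) (use A f_def in simp)
    finally have le: "ennreal (1 + 1 / real (Suc m)) * emeasure lborel ?A \<le> emeasure lborel ?A" .
    have "emeasure lborel ?A = 0"
    proof -
      obtain r where r: "emeasure lborel ?A = ennreal r" "0 \<le> r" using fin by (cases "emeasure lborel ?A") auto
      have "ennreal ((1 + 1 / real (Suc m)) * r) \<le> ennreal r" using le r by (simp add: ennreal_mult)
      then have "(1 + 1 / real (Suc m)) * r \<le> r" using r by (simp add: ennreal_le_iff)
      then have "r / real (Suc m) \<le> 0" by (simp add: algebra_simps)
      then have "r \<le> 0" by (simp add: divide_le_0_iff)
      then show ?thesis using r by simp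
    qed
    then show ?thesis using A by (intro AE_I'[of ?A]) (auto simp: null_sets_def)
  qed
  then have "AE y in lborel. \<forall>m::nat. \<not> (ennreal (1 + 1 / real (Suc m)) \<le> f y \<and> norm y \<le> real m)"
    by (simp add: AE_all_countable)
  then show ?thesis unfolding f_def[symmetric]
  proof eventually_elim
    case (elim y)
    show ?case
    proof (rule ccontr)
      assume "\<not> f y \<le> 1"
      then have "1 < f y" by simp
      obtain e where e: "0 < e" "ennreal (1 + e) \<le> f y"
      proof (cases "f y")
        case (real r)
        then have "1 < r" using \<open>1 < f y\<close> by (simp add: ennreal_less_iff flip: ennreal_1)
        then show ?thesis using that[of "r - 1"] real by simp
      next
        case top
        then show ?thesis using that[of 1] by simp
      qed
      obtain m1 :: nat where m1: "1 / real (Suc m1) < e" using nat_approx_posE[OF e(1)] by auto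
      define m where "m = max m1 (nat \<lceil>norm y\<rceil>)"
      have "1 / real (Suc m) \<le> 1 / real (Suc m1)" by (intro divide_left_mono) (auto simp: m_def)
      then have "ennreal (1 + 1 / real (Suc m)) \<le> f y"
        using m1 by (intro order_trans[OF _ e(2)] ennreal_leI) simp
      moreover have "norm y \<le> real m" unfolding m_def by linarith
      ultimately show False using elim by blast
    qed
  qed
qed

end

section \<open>Eigenfunctions of the killed semigroup\<close>

definition l2sq :: "('a::euclidean_space \<Rightarrow> real) \<Rightarrow> ennreal" where
  "l2sq f = (\<integral>\<^sup>+x. ennreal ((f x)\<^sup>2) \<partial>lborel)"

lemma l2sq_add_le:
  assumes [measurable]: "f \<in> borel_measurable borel" "g \<in> borel_measurable borel"
  shows "l2sq (\<lambda>x. f x + g x) \<le> 2 * l2sq f + 2 * l2sq g"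
proof -
  have "l2sq (\<lambda>x. f x + g x) \<le> (\<integral>\<^sup>+x. 2 * ennreal ((f x)\<^sup>2) + 2 * ennreal ((g x)\<^sup>2) \<partial>lborel)"
    unfolding l2sq_def
  proof (rule nn_integral_mono)
    fix x
    have "(f x + g x)\<^sup>2 \<le> 2 * (f x)\<^sup>2 + 2 * (g x)\<^sup>2"
      using sum_squares_bound[of "f x" "g x"] by (simp add: power2_sum)
    then have "ennreal ((f x + g x)\<^sup>2) \<le> ennreal (2 * (f x)\<^sup>2 + 2 * (g x)\<^sup>2)" by (rule ennreal_leI)
    also have "\<dots> = 2 * ennreal ((f x)\<^sup>2) + 2 * ennreal ((g x)\<^sup>2)"
      by (simp add: ennreal_plus ennreal_mult)
    finally show "ennreal ((f x + g x)\<^sup>2) \<le> 2 * ennreal ((f x)\<^sup>2) + 2 * ennreal ((g x)\<^sup>2)" .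
  qed
  also have "\<dots> = 2 * l2sq f + 2 * l2sq g"
    unfolding l2sq_def by (simp add: nn_integral_add nn_integral_cmult)
  finally show ?thesis .
qed

lemma l2sq_cmult:
  assumes [measurable]: "f \<in> borel_measurable borel"
  shows "l2sq (\<lambda>x. c * f x) = ennreal (c\<^sup>2) * l2sq f"
  unfolding l2sq_def by (simp add: power_mult_distrib ennreal_mult nn_integral_cmult)

lemma l2sq_prod_le:
  assumes [measurable]: "f \<in> borel_measurable borel" "g \<in> borel_measurable borel"
  shows "(\<integral>\<^sup>+x. ennreal (\<bar>f x\<bar> * \<bar>g x\<bar>) \<partial>lborel) \<le> l2sq f + l2sq g"
proof -
  have "(\<integral>\<^sup>+x. ennreal (\<bar>f x\<bar> * \<bar>g x\<bar>) \<partial>lborel) \<le> (\<integral>\<^sup>+x. ennreal ((f x)\<^sup>2) + ennreal ((g x)\<^sup>2) \<partial>lborel)"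
  proof (rule nn_integral_mono)
    fix x
    have "2 * \<bar>f x\<bar> * \<bar>g x\<bar> \<le> (f x)\<^sup>2 + (g x)\<^sup>2"
      using sum_squares_bound[of "\<bar>f x\<bar>" "\<bar>g x\<bar>"] by simp
    moreover have "0 \<le> \<bar>f x\<bar> * \<bar>g x\<bar>" by simp
    ultimately have "\<bar>f x\<bar> * \<bar>g x\<bar> \<le> (f x)\<^sup>2 + (g x)\<^sup>2" by linarith
    then have "ennreal (\<bar>f x\<bar> * \<bar>g x\<bar>) \<le> ennreal ((f x)\<^sup>2 + (g x)\<^sup>2)" by (rule ennreal_leI)
    then show "ennreal (\<bar>f x\<bar> * \<bar>g x\<bar>) \<le> ennreal ((f x)\<^sup>2) + ennreal ((g x)\<^sup>2)"
      by (simp add: ennreal_plus)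
  qed
  also have "\<dots> = l2sq f + l2sq g" unfolding l2sq_def by (simp add: nn_integral_add)
  finally show ?thesis .
qed

locale substochastic_kernel =
  fixes k :: "'a::euclidean_space \<Rightarrow> 'a \<Rightarrow> ennreal"
  assumes kernel_measurable: "(\<lambda>z. k (fst z) (snd z)) \<in> borel_measurable (borel \<Otimes>\<^sub>M borel)"
    and kernel_finite: "\<And>x y. k x y < \<infinity>"
    and mass_le_1: "AE x in lborel. (\<integral>\<^sup>+y. k x y \<partial>lborel) \<le> 1"
    and dual_mass_le_1: "AE y in lborel. (\<integral>\<^sup>+x. k x y \<partial>lborel) \<le> 1"
begin

lemma kernel_measurable'[measurable (raw)]:
  assumes "f \<in> M \<rightarrow>\<^sub>M borel" "g \<in> M \<rightarrow>\<^sub>M borel"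
  shows "(\<lambda>z. k (f z) (g z)) \<in> borel_measurable M"
  using measurable_compose[OF measurable_Pair[OF assms] kernel_measurable] by simp

text \<open>Where the integral diverges the value is the default 0; for square integrable
  \<open>f\<close> this concerns a null set of \<open>x\<close> only.\<close>

definition op :: "('a \<Rightarrow> real) \<Rightarrow> 'a \<Rightarrow> real" where
  "op f x = (\<integral>y. enn2real (k x y) * f y \<partial>lborel)"

lemma op_measurable[measurable (raw)]:
  assumes [measurable]: "f \<in> borel_measurable borel"
  shows "op f \<in> borel_measurable borel"
  unfolding op_def[abs_def] by measurable

lemma abs_op_le:
  assumes [measurable]: "f \<in> borel_measurable borel"
  shows "ennreal \<bar>op f x\<bar> \<le> (\<integral>\<^sup>+y. k x y * ennreal \<bar>f y\<bar> \<partial>lborel)"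
proof -
  have "ennreal (norm (op f x)) \<le> (\<integral>\<^sup>+y. ennreal (norm (enn2real (k x y) * f y)) \<partial>lborel)"
  proof (cases "integrable lborel (\<lambda>y. enn2real (k x y) * f y)")
    case True
    then show ?thesis unfolding op_def by (rule integral_norm_bound_ennreal)
  next
    case False
    then show ?thesis by (simp add: op_def not_integrable_integral_eq)
  qed
  also have "\<dots> = (\<integral>\<^sup>+y. k x y * ennreal \<bar>f y\<bar> \<partial>lborel)"
    using kernel_finite by (intro nn_integral_cong) (simp add: abs_mult ennreal_mult)
  finally show ?thesis by simp
qed

text \<open>Cauchy-Schwarz against the constant 1, under a measure of mass at most 1.\<close>

lemma jensen_square:
  assumes [measurable]: "f \<in> borel_measurable borel" and m: "(\<integral>\<^sup>+y. k x y \<partial>lborel) \<le> 1"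
  shows "(\<integral>\<^sup>+y. k x y * f y \<partial>lborel)\<^sup>2 \<le> (\<integral>\<^sup>+y. k x y * (f y)\<^sup>2 \<partial>lborel)"
proof -
  let ?D = "density lborel (k x)"
  have "(\<integral>\<^sup>+y. k x y * f y \<partial>lborel)\<^sup>2 = (\<integral>\<^sup>+y. f y * 1 \<partial>?D)\<^sup>2"
    by (simp add: nn_integral_density)
  also have "\<dots> \<le> (\<integral>\<^sup>+y. (f y)\<^sup>2 \<partial>?D) * (\<integral>\<^sup>+y. 1\<^sup>2 \<partial>?D)"
    by (rule Cauchy_Schwarz_nn_integral) auto
  also have "(\<integral>\<^sup>+y. 1\<^sup>2 \<partial>?D) \<le> 1" using m by (simp add: emeasure_density)
  finally show ?thesis by (simp add: nn_integral_density mult_left_mono)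
qed

text \<open>Schur's test: the row bound moves the square inside the inner integral, and after
  Tonelli the column bound removes the kernel. The absolute value stays inside, so the estimate also
  yields integrability for almost every \<open>x\<close>.\<close>

lemma l2sq_abs_le:
  assumes [measurable]: "f \<in> borel_measurable borel"
  shows "(\<integral>\<^sup>+x. (\<integral>\<^sup>+y. k x y * ennreal \<bar>f y\<bar> \<partial>lborel)\<^sup>2 \<partial>lborel) \<le> l2sq f"
proof -
  have "(\<integral>\<^sup>+x. (\<integral>\<^sup>+y. k x y * ennreal \<bar>f y\<bar> \<partial>lborel)\<^sup>2 \<partial>lborel) \<le>
      (\<integral>\<^sup>+x. \<integral>\<^sup>+y. k x y * (ennreal \<bar>f y\<bar>)\<^sup>2 \<partial>lborel \<partial>lborel)"
    using mass_le_1 by (intro nn_integral_mono_AE) (auto elim!: eventually_mono intro!: jensen_square)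
  also have "\<dots> = (\<integral>\<^sup>+y. \<integral>\<^sup>+x. k x y * (ennreal \<bar>f y\<bar>)\<^sup>2 \<partial>lborel \<partial>lborel)"
    by (rule lborel_pair.Fubini') measurable
  also have "\<dots> = (\<integral>\<^sup>+y. (\<integral>\<^sup>+x. k x y \<partial>lborel) * (ennreal \<bar>f y\<bar>)\<^sup>2 \<partial>lborel)"
    by (simp add: nn_integral_multc)
  also have "\<dots> \<le> (\<integral>\<^sup>+y. 1 * (ennreal \<bar>f y\<bar>)\<^sup>2 \<partial>lborel)"
  proof (rule nn_integral_mono_AE)
    show "AE y in lborel. (\<integral>\<^sup>+x. k x y \<partial>lborel) * (ennreal \<bar>f y\<bar>)\<^sup>2 \<le> 1 * (ennreal \<bar>f y\<bar>)\<^sup>2"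
      using dual_mass_le_1 by eventually_elim (rule mult_right_mono, simp_all)
  qed
  also have "\<dots> = l2sq f" by (simp add: l2sq_def ennreal_power)
  finally show ?thesis .
qed

lemma AE_abs_finite:
  assumes [measurable]: "f \<in> borel_measurable borel" and "l2sq f < \<infinity>"
  shows "AE x in lborel. (\<integral>\<^sup>+y. k x y * ennreal \<bar>f y\<bar> \<partial>lborel) < \<infinity>"
proof -
  have "(\<integral>\<^sup>+x. (\<integral>\<^sup>+y. k x y * ennreal \<bar>f y\<bar> \<partial>lborel)\<^sup>2 \<partial>lborel) \<noteq> \<infinity>"
    using l2sq_abs_le[OF assms(1)] assms(2) by (auto simp: top_unique)
  then have "AE x in lborel. (\<integral>\<^sup>+y. k x y * ennreal \<bar>f y\<bar> \<partial>lborel)\<^sup>2 \<noteq> \<infinity>"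
    by (rule nn_integral_PInf_AE[rotated]) measurable
  then show ?thesis
    by eventually_elim (auto simp: power2_eq_square ennreal_mult_eq_top_iff less_top[symmetric])
qed

lemma integrable_iff_abs_finite:
  assumes [measurable]: "f \<in> borel_measurable borel"
  shows "integrable lborel (\<lambda>y. enn2real (k x y) * f y) \<longleftrightarrow> (\<integral>\<^sup>+y. k x y * ennreal \<bar>f y\<bar> \<partial>lborel) < \<infinity>"
proof -
  have "(\<integral>\<^sup>+y. ennreal (norm (enn2real (k x y) * f y)) \<partial>lborel) = (\<integral>\<^sup>+y. k x y * ennreal \<bar>f y\<bar> \<partial>lborel)"
    using kernel_finite by (intro nn_integral_cong) (simp add: abs_mult ennreal_mult)
  then show ?thesis by (simp add: integrable_iff_bounded)
qed

lemma AE_integrable: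
  assumes "f \<in> borel_measurable borel" "l2sq f < \<infinity>"
  shows "AE x in lborel. integrable lborel (\<lambda>y. enn2real (k x y) * f y)"
  using AE_abs_finite[OF assms] integrable_iff_abs_finite[OF assms(1)] by simp

lemma l2sq_op_le:
  assumes [measurable]: "f \<in> borel_measurable borel"
  shows "l2sq (op f) \<le> l2sq f"
proof -
  have "l2sq (op f) \<le> (\<integral>\<^sup>+x. (\<integral>\<^sup>+y. k x y * ennreal \<bar>f y\<bar> \<partial>lborel)\<^sup>2 \<partial>lborel)"
    unfolding l2sq_def
  proof (rule nn_integral_mono)
    fix x
    have "ennreal ((op f x)\<^sup>2) = (ennreal \<bar>op f x\<bar>)\<^sup>2" by (simp add: ennreal_power)
    also have "\<dots> \<le> (\<integral>\<^sup>+y. k x y * ennreal \<bar>f y\<bar> \<partial>lborel)\<^sup>2"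
      using abs_op_le by (intro power_mono) auto
    finally show "ennreal ((op f x)\<^sup>2) \<le> (\<integral>\<^sup>+y. k x y * ennreal \<bar>f y\<bar> \<partial>lborel)\<^sup>2" .
  qed
  also have "\<dots> \<le> l2sq f" by (rule l2sq_abs_le) simp
  finally show ?thesis .
qed

lemma AE_op_linear:
  assumes "f \<in> borel_measurable borel" "l2sq f < \<infinity>" "g \<in> borel_measurable borel" "l2sq g < \<infinity>"
  shows "AE x in lborel. op (\<lambda>y. f y + c * g y) x = op f x + c * op g x"
  using AE_integrable[OF assms(1,2)] AE_integrable[OF assms(3,4)]
proof eventually_elim
  case (elim x)
  have "op (\<lambda>y. f y + c * g y) x = (\<integral>y. enn2real (k x y) * f y + c * (enn2real (k x y) * g y) \<partial>lborel)"
    unfolding op_def by (intro Bochner_Integration.integral_cong) (auto simp: algebra_simps)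
  also have "\<dots> = op f x + c * op g x" unfolding op_def using elim by simp
  finally show ?case .
qed

lemma transpose: "substochastic_kernel (\<lambda>x y. k y x)"
proof
  show "(\<lambda>z. k (snd z) (fst z)) \<in> borel_measurable (borel \<Otimes>\<^sub>M borel)" by measurable
qed (use kernel_finite mass_le_1 dual_mass_le_1 in auto)

lemma op_adjoint:
  assumes f[measurable]: "f \<in> borel_measurable borel" "l2sq f < \<infinity>"
    and g[measurable]: "g \<in> borel_measurable borel" "l2sq g < \<infinity>"
  shows "integrable lborel (\<lambda>x. f x * op g x)"
    and "(\<integral>x. f x * op g x \<partial>lborel) = (\<integral>y. substochastic_kernel.op (\<lambda>x y. k y x) f y * g y \<partial>lborel)"
proof -
  interpret T: substochastic_kernel "\<lambda>x y. k y x" by (rule transpose)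
  let ?a = "\<lambda>x. \<integral>\<^sup>+y. k x y * ennreal \<bar>g y\<bar> \<partial>lborel"
  define h where "h = (\<lambda>(x, y). f x * (enn2real (k x y) * g y))"
  have hm[measurable]: "h \<in> borel_measurable (lborel \<Otimes>\<^sub>M lborel)"
    unfolding h_def by (simp add: split_beta') 
  have "(\<integral>\<^sup>+x. \<integral>\<^sup>+y. ennreal (norm (h (x, y))) \<partial>lborel \<partial>lborel) = (\<integral>\<^sup>+x. ennreal \<bar>f x\<bar> * ?a x \<partial>lborel)"
  proof (rule nn_integral_cong)
    fix x
    have "(\<integral>\<^sup>+y. ennreal (norm (h (x, y))) \<partial>lborel) = (\<integral>\<^sup>+y. ennreal \<bar>f x\<bar> * (k x y * ennreal \<bar>g y\<bar>) \<partial>lborel)"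
      using kernel_finite by (intro nn_integral_cong) (simp add: h_def abs_mult ennreal_mult)
    then show "(\<integral>\<^sup>+y. ennreal (norm (h (x, y))) \<partial>lborel) = ennreal \<bar>f x\<bar> * ?a x"
      by (simp add: nn_integral_cmult)
  qed
  also have "\<dots> \<le> (\<integral>\<^sup>+x. ennreal ((f x)\<^sup>2) + (?a x)\<^sup>2 \<partial>lborel)"
  proof (rule nn_integral_mono)
    fix x
    \<comment> \<open>In [0, infinity] a product is at most the square of its larger factor, which
      replaces the usual expansion of a squared difference.\<close>
    show "ennreal \<bar>f x\<bar> * ?a x \<le> ennreal ((f x)\<^sup>2) + (?a x)\<^sup>2"
    proof (cases "ennreal \<bar>f x\<bar> \<le> ?a x")
      case True
      then have "ennreal \<bar>f x\<bar> * ?a x \<le> (?a x)\<^sup>2" by (simp add: power2_eq_square mult_right_mono)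
      then show ?thesis by (simp add: add_increasing)
    next
      case False
      then have "ennreal \<bar>f x\<bar> * ?a x \<le> (ennreal \<bar>f x\<bar>)\<^sup>2" by (simp add: power2_eq_square mult_left_mono)
      then show ?thesis by (simp add: ennreal_power add_increasing2)
    qed
  qed
  also have "\<dots> = l2sq f + (\<integral>\<^sup>+x. (?a x)\<^sup>2 \<partial>lborel)" unfolding l2sq_def by (rule nn_integral_add) measurable
  also have "\<dots> \<le> l2sq f + l2sq g" using l2sq_abs_le[OF g(1)] by (rule add_left_mono)
  also have "\<dots> < \<infinity>" using f g by simp
  finally have ih: "integrable (lborel \<Otimes>\<^sub>M lborel) h"
    by (intro integrableI_bounded hm) (simp add: lborel.nn_integral_fst[symmetric])
  have eq1: "(\<integral>y. h (x, y) \<partial>lborel) = f x * op g x" for x by (simp add: h_def op_def)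
  have eq2: "(\<integral>x. h (x, y) \<partial>lborel) = T.op f y * g y" for y
  proof -
    have "(\<integral>x. h (x, y) \<partial>lborel) = (\<integral>x. (enn2real (k x y) * f x) * g y \<partial>lborel)"
      by (intro Bochner_Integration.integral_cong) (auto simp: h_def)
    then show ?thesis by (simp add: T.op_def)
  qed
  show "integrable lborel (\<lambda>x. f x * op g x)"
    using lborel_pair.integrable_fst'[OF ih] by (simp add: eq1)
  have ih': "integrable (lborel \<Otimes>\<^sub>M lborel) (\<lambda>(x, y). h (x, y))" using ih by simp
  show "(\<integral>x. f x * op g x \<partial>lborel) = (\<integral>y. T.op f y * g y \<partial>lborel)"
    using lborel_pair.Fubini_integral[OF ih'] by (simp add: eq1 eq2)
qed

text \<open>A bridge from the signed operator to integrals in [0, infinity], the form in which the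
  Chapman-Kolmogorov identity is available.\<close>

lemma op_eq_diff:
  assumes [measurable]: "f \<in> borel_measurable borel" and fin: "(\<integral>\<^sup>+y. k x y * ennreal \<bar>f y\<bar> \<partial>lborel) < \<infinity>"
  shows "op f x = enn2real (\<integral>\<^sup>+y. k x y * ennreal (f y) \<partial>lborel) - enn2real (\<integral>\<^sup>+y. k x y * ennreal (- f y) \<partial>lborel)"
proof -
  have e: "ennreal (enn2real (k x y) * u) = k x y * ennreal u" for y u
    using kernel_finite[of x y] by (simp add: ennreal_mult')
  have m: "- (enn2real (k x y) * f y) = enn2real (k x y) * (- f y)" for y by simp
  have "integrable lborel (\<lambda>y. enn2real (k x y) * f y)"
    using integrable_iff_abs_finite[of f x] fin by simp
  from real_lebesgue_integral_def[OF this] show ?thesis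
    unfolding op_def m e .
qed

end

lemma ennreal_mult_divide_cancel:
  assumes "0 < c" shows "ennreal c * X / ennreal c = X"
proof -
  have "ennreal c * X / ennreal c = X * ennreal c / ennreal c" by (simp only: mult.commute)
  also have "\<dots> = X" using assms by (intro ennreal_mult_divide_eq) auto
  finally show ?thesis .
qed

section \<open>From the generator to the eigenvalue equations of the semigroup and its
  adjoint\<close>

context killed_levy
begin

lemma q_kernel: assumes "0 < t" shows "substochastic_kernel (q t)"
proof
  show "(\<lambda>z. q t (fst z) (snd z)) \<in> borel_measurable (borel \<Otimes>\<^sub>M borel)" by measurable
  show "q t x y < \<infinity>" for x y by (simp add: q_def)
qed (use q_mass_le_1 q_dual_mass_le_1[OF assms] in auto)

definition Pt :: "real \<Rightarrow> ('a \<Rightarrow> real) \<Rightarrow> 'a \<Rightarrow> real" where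
  "Pt t = substochastic_kernel.op (q t)"

lemma Pt_eq: "0 < t \<Longrightarrow> Pt t f x = (\<integral>y. enn2real (q t x y) * f y \<partial>lborel)"
  unfolding Pt_def using substochastic_kernel.op_def[OF q_kernel] by blast

lemma Pt_outside: "0 < t \<Longrightarrow> x \<notin> B \<Longrightarrow> Pt t f x = 0"
  by (simp add: Pt_eq q_def)

lemma Pt_measurable:
  assumes "0 < t" "f \<in> borel_measurable borel" shows "Pt t f \<in> borel_measurable borel"
  unfolding Pt_def using substochastic_kernel.op_measurable[OF q_kernel] assms by blast

text \<open>Chapman-Kolmogorov is applied to the positive and the negative part of \<open>f\<close>;
  subtracting the results is legitimate for almost every \<open>x\<close>, where square
  integrability makes both finite.\<close>

lemma Pt_double:
  assumes t: "0 < t" and f[measurable]: "f \<in> borel_measurable borel" and fin: "l2sq f < \<infinity>"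
  shows "AE x in lborel. Pt (2 * t) f x = Pt t (Pt t f) x"
proof -
  interpret K: substochastic_kernel "q t" by (rule q_kernel[OF t])
  have t2: "0 < 2 * t" using t by simp
  interpret K2: substochastic_kernel "q (2 * t)" by (rule q_kernel[OF t2])
  define a where "a z = (\<integral>\<^sup>+y. q t z y * ennreal (f y) \<partial>lborel)" for z
  define b where "b z = (\<integral>\<^sup>+y. q t z y * ennreal (- f y) \<partial>lborel)" for z
  have [measurable]: "a \<in> borel_measurable borel" "b \<in> borel_measurable borel"
    unfolding a_def[abs_def] b_def[abs_def] by measurable
  have ab: "AE z in lborel. a z < \<infinity> \<and> b z < \<infinity> \<and> Pt t f z = enn2real (a z) - enn2real (b z)"
    using K.AE_abs_finite[OF f fin]
  proof eventually_elim
    case (elim z)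
    have "a z \<le> (\<integral>\<^sup>+y. q t z y * ennreal \<bar>f y\<bar> \<partial>lborel)"
      unfolding a_def by (intro nn_integral_mono mult_left_mono ennreal_leI) auto
    moreover have "b z \<le> (\<integral>\<^sup>+y. q t z y * ennreal \<bar>f y\<bar> \<partial>lborel)"
      unfolding b_def by (intro nn_integral_mono mult_left_mono ennreal_leI) auto
    ultimately show ?case
      using le_less_trans[OF _ elim] K.op_eq_diff[OF f elim] by (simp only: Pt_def a_def b_def)
  qed
  have aux: "(\<integral>z. enn2real (q t x z) * enn2real (c z) \<partial>lborel) = enn2real (\<integral>\<^sup>+z. q t x z * c z \<partial>lborel)
      \<and> integrable lborel (\<lambda>z. enn2real (q t x z) * enn2real (c z))"
    if [measurable]: "c \<in> borel_measurable borel" and c: "AE z in lborel. c z < \<infinity>"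
      and cf: "(\<integral>\<^sup>+z. q t x z * c z \<partial>lborel) < \<infinity>" for x c
  proof -
    have eq: "(\<integral>\<^sup>+z. ennreal (enn2real (q t x z) * enn2real (c z)) \<partial>lborel) = (\<integral>\<^sup>+z. q t x z * c z \<partial>lborel)"
    proof (rule nn_integral_cong_AE)
      show "AE z in lborel. ennreal (enn2real (q t x z) * enn2real (c z)) = q t x z * c z"
        using c by eventually_elim (use K.kernel_finite in \<open>simp add: ennreal_mult\<close>)
    qed
    moreover have "integrable lborel (\<lambda>z. enn2real (q t x z) * enn2real (c z))"
      using eq cf by (intro integrableI_nonneg) auto
    ultimately show ?thesis by (simp add: integral_eq_nn_integral)
  qed
  show ?thesis
    using chapman_kolmogorov[OF t] K2.AE_abs_finite[OF f fin]
  proof eventually_elim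
    case (elim x)
    have fp: "(\<integral>\<^sup>+y. q (2 * t) x y * ennreal (f y) \<partial>lborel) = (\<integral>\<^sup>+z. q t x z * a z \<partial>lborel)"
      unfolding a_def using elim(1) by (elim ballE[of _ _ "\<lambda>y. ennreal (f y)"]) auto
    have fm: "(\<integral>\<^sup>+y. q (2 * t) x y * ennreal (- f y) \<partial>lborel) = (\<integral>\<^sup>+z. q t x z * b z \<partial>lborel)"
      unfolding b_def using elim(1) by (elim ballE[of _ _ "\<lambda>y. ennreal (- f y)"]) auto
    have fin1: "(\<integral>\<^sup>+z. q t x z * a z \<partial>lborel) < \<infinity>"
      unfolding fp[symmetric] by (rule le_less_trans[OF _ elim(2)]) (intro nn_integral_mono mult_left_mono ennreal_leI, auto)
    have fin2: "(\<integral>\<^sup>+z. q t x z * b z \<partial>lborel) < \<infinity>"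
      unfolding fm[symmetric] by (rule le_less_trans[OF _ elim(2)]) (intro nn_integral_mono mult_left_mono ennreal_leI, auto)
    have "Pt t (Pt t f) x = (\<integral>z. enn2real (q t x z) * Pt t f z \<partial>lborel)" using t by (simp add: Pt_eq)
    also have "\<dots> = (\<integral>z. enn2real (q t x z) * enn2real (a z) - enn2real (q t x z) * enn2real (b z) \<partial>lborel)"
    proof (rule integral_cong_AE)
      show "AE z in lborel. enn2real (q t x z) * Pt t f z = enn2real (q t x z) * enn2real (a z) - enn2real (q t x z) * enn2real (b z)"
        using ab by eventually_elim (simp add: right_diff_distrib)
      have [measurable]: "Pt t f \<in> borel_measurable borel" using Pt_measurable[OF t f] .
      show "(\<lambda>z. enn2real (q t x z) * Pt t f z) \<in> borel_measurable lborel" by measurable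
    qed measurable
    also have "\<dots> = enn2real (\<integral>\<^sup>+z. q t x z * a z \<partial>lborel) - enn2real (\<integral>\<^sup>+z. q t x z * b z \<partial>lborel)"
      using aux[of a x] aux[of b x] ab fin1 fin2 by (subst Bochner_Integration.integral_diff) auto
    also have "\<dots> = Pt (2 * t) f x"
      using K2.op_eq_diff[OF f elim(2)] by (simp add: Pt_def fp fm)
    finally show ?case by simp
  qed
qed

text \<open>P(2t) - c^2 factors as (P(t) + c)(P(t) - c), and since P(t) is a contraction the first
  factor has norm at most 1 + c.\<close>

lemma eigen_defect_double:
  assumes t: "0 < t" and f[measurable]: "f \<in> borel_measurable borel" and fin: "l2sq f < \<infinity>" and c: "0 \<le> c"
  shows "l2sq (\<lambda>x. Pt (2 * t) f x - c\<^sup>2 * f x) \<le> ennreal ((1 + c)\<^sup>2) * l2sq (\<lambda>x. Pt t f x - c * f x)"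
proof -
  interpret K: substochastic_kernel "q t" by (rule q_kernel[OF t])
  define r where "r x = Pt t f x - c * f x" for x
  have Pm[measurable]: "Pt s f \<in> borel_measurable borel" if "0 < s" for s using Pt_measurable that f by blast
  have Ptf[measurable]: "Pt t f \<in> borel_measurable borel" using t by simp
  have r[measurable]: "r \<in> borel_measurable borel" unfolding r_def[abs_def] by measurable
  have Pr[measurable]: "Pt t r \<in> borel_measurable borel" using Pt_measurable t by simp
  have Pfin: "l2sq (Pt t f) < \<infinity>" using K.l2sq_op_le[OF f] fin unfolding Pt_def by (rule le_less_trans)
  have "AE x in lborel. Pt (2 * t) f x - c\<^sup>2 * f x = Pt t r x + c * r x"
    using Pt_double[OF t f fin] K.AE_op_linear[OF Ptf Pfin f fin, of "- c"]
  proof eventually_elim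
    case (elim x)
    have "Pt t r x = Pt t (Pt t f) x - c * Pt t f x"
      using elim(2) by (simp add: Pt_def r_def[abs_def])
    then show ?case using elim(1) by (simp add: r_def power2_eq_square algebra_simps)
  qed
  then have "l2sq (\<lambda>x. Pt (2 * t) f x - c\<^sup>2 * f x) = l2sq (\<lambda>x. Pt t r x + c * r x)"
    unfolding l2sq_def by (intro nn_integral_cong_AE) (auto elim: eventually_mono)
  also have "\<dots> \<le> (\<integral>\<^sup>+x. ennreal (1 + c) * (ennreal ((Pt t r x)\<^sup>2) + ennreal c * ennreal ((r x)\<^sup>2)) \<partial>lborel)"
    unfolding l2sq_def
  proof (rule nn_integral_mono)
    fix x
    \<comment> \<open>The two sides of the next inequality differ by exactly this term.\<close>
    have "0 \<le> c * (Pt t r x - r x)\<^sup>2" using c by simp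
    then have "(Pt t r x + c * r x)\<^sup>2 \<le> (1 + c) * ((Pt t r x)\<^sup>2 + c * (r x)\<^sup>2)"
      by (simp add: power2_eq_square algebra_simps)
    then have "ennreal ((Pt t r x + c * r x)\<^sup>2) \<le> ennreal ((1 + c) * ((Pt t r x)\<^sup>2 + c * (r x)\<^sup>2))"
      by (rule ennreal_leI)
    also have "\<dots> = ennreal (1 + c) * (ennreal ((Pt t r x)\<^sup>2) + ennreal c * ennreal ((r x)\<^sup>2))"
      using c by (simp add: ennreal_mult ennreal_plus)
    finally show "ennreal ((Pt t r x + c * r x)\<^sup>2) \<le> ennreal (1 + c) * (ennreal ((Pt t r x)\<^sup>2) + ennreal c * ennreal ((r x)\<^sup>2))" .
  qed
  also have "\<dots> = ennreal (1 + c) * (l2sq (Pt t r) + ennreal c * l2sq r)"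
    unfolding l2sq_def by (simp add: nn_integral_cmult nn_integral_add)
  also have "\<dots> \<le> ennreal (1 + c) * (l2sq r + ennreal c * l2sq r)"
    using K.l2sq_op_le[OF r] unfolding Pt_def[symmetric] by (intro mult_left_mono add_right_mono) auto
  also have "\<dots> = ennreal (1 + c) * ((1 + ennreal c) * l2sq r)" by (simp add: distrib_right)
  also have "\<dots> = ennreal ((1 + c)\<^sup>2) * l2sq r"
    using c by (simp add: power2_eq_square ennreal_mult ennreal_plus mult.assoc flip: ennreal_1)
  finally show ?thesis unfolding r_def[abs_def] .
qed

lemma one_plus_exp_le: "1 + exp (- l * s) \<le> 2 * exp (\<bar>l\<bar> * s)" if "0 \<le> s" for l s :: real
proof -
  have "- l * s \<le> \<bar>l\<bar> * s" using that by (intro mult_right_mono) auto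
  then have "exp (- l * s) \<le> exp (\<bar>l\<bar> * s)" by simp
  moreover have "1 \<le> exp (\<bar>l\<bar> * s)" using that by simp
  ultimately show ?thesis by linarith
qed

text \<open>By n doublings the squared defect at \<open>t\<close> is at most a bounded multiple of
  \<open>4 ^ n\<close> times the one at \<open>t / 2 ^ n\<close>. The generator makes the latter
  small compared with the square of \<open>t / 2 ^ n\<close>, that is, with
  \<open>t * t / 4 ^ n\<close>. The powers of 4 cancel and the defect is 0.\<close>

lemma eigenfunction_of_semigroup:
  assumes t: "0 < t" and f[measurable]: "f \<in> borel_measurable borel" and fin: "l2sq f < \<infinity>"
    and gen: "((\<lambda>t. l2sq (\<lambda>x. (Pt t f x - f x) / t + l * f x)) \<longlongrightarrow> 0) (at_right 0)"
  shows "AE x in lborel. Pt t f x = exp (- l * t) * f x"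
proof -
  define e where "e t = l2sq (\<lambda>x. Pt t f x - exp (- l * t) * f x)" for t
  have e_half: "e t \<le> ennreal (4 * exp (2 * \<bar>l\<bar> * (t / 2))) * e (t / 2)" if "0 < t" for t
  proof -
    have "e t \<le> ennreal ((1 + exp (- l * (t / 2)))\<^sup>2) * e (t / 2)"
      using eigen_defect_double[of "t / 2" f "exp (- l * (t / 2))"] that fin f
      unfolding e_def by (simp add: exp_double[symmetric])
    also have "\<dots> \<le> ennreal (4 * exp (2 * \<bar>l\<bar> * (t / 2))) * e (t / 2)"
    proof (intro mult_right_mono ennreal_leI)
      have "(1 + exp (- l * (t / 2)))\<^sup>2 \<le> (2 * exp (\<bar>l\<bar> * (t / 2)))\<^sup>2"
        using one_plus_exp_le[of "t / 2" l] that by (intro power_mono) auto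
      also have "\<dots> = 4 * exp (2 * \<bar>l\<bar> * (t / 2))" by (simp add: power_mult_distrib exp_double[symmetric])
      finally show "(1 + exp (- l * (t / 2)))\<^sup>2 \<le> 4 * exp (2 * \<bar>l\<bar> * (t / 2))" .
    qed simp
    finally show ?thesis .
  qed
  \<comment> \<open>Each halving costs a factor 4 and an exponential; the exponents form a geometric
    sum with value \<open>2 * \<bar>l\<bar> * (t - t / 2 ^ n)\<close>, which stays bounded in
    \<open>n\<close>.\<close>
  have e_iter: "e t \<le> ennreal (4 ^ n * exp (2 * \<bar>l\<bar> * (t - t / 2 ^ n))) * e (t / 2 ^ n)" for n
  proof (induction n)
    case (Suc n)
    have pos: "0 < t / 2 ^ n" using t by simp
    have "e t \<le> ennreal (4 ^ n * exp (2 * \<bar>l\<bar> * (t - t / 2 ^ n))) * e (t / 2 ^ n)" by (rule Suc.IH)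
    also have "\<dots> \<le> ennreal (4 ^ n * exp (2 * \<bar>l\<bar> * (t - t / 2 ^ n))) *
        (ennreal (4 * exp (2 * \<bar>l\<bar> * (t / 2 ^ n / 2))) * e (t / 2 ^ n / 2))"
      by (rule mult_left_mono[OF e_half[OF pos]]) simp
    also have "\<dots> = ennreal ((4 ^ n * exp (2 * \<bar>l\<bar> * (t - t / 2 ^ n))) * (4 * exp (2 * \<bar>l\<bar> * (t / 2 ^ n / 2)))) * e (t / 2 ^ Suc n)"
      by (simp add: ennreal_mult mult.assoc mult.commute[of 2])
    also have "(4 ^ n * exp (2 * \<bar>l\<bar> * (t - t / 2 ^ n))) * (4 * exp (2 * \<bar>l\<bar> * (t / 2 ^ n / 2))) =
       4 ^ Suc n * exp (2 * \<bar>l\<bar> * (t - t / 2 ^ Suc n))"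
    proof -
      have "exp (2 * \<bar>l\<bar> * (t - t / 2 ^ n)) * exp (2 * \<bar>l\<bar> * (t / 2 ^ n / 2)) = exp (2 * \<bar>l\<bar> * (t - t / 2 ^ Suc n))"
        unfolding exp_add[symmetric] by (simp add: field_simps)
      then show ?thesis by (simp add: mult_ac)
    qed
    finally show ?case .
  qed (use t in simp)
  have small: "((\<lambda>s. e s / ennreal (s\<^sup>2)) \<longlongrightarrow> 0) (at_right 0)"
  proof (rule tendsto_sandwich[where f="\<lambda>_. 0"])
    \<comment> \<open>The first-order Taylor remainder of \<open>exp (- l * s)\<close>, divided by
      \<open>s\<close>: it accounts for the difference between the generator's quotient and the
      defect \<open>e s\<close>.\<close>
    define w where "w s = (1 - l * s - exp (- l * s)) / s" for s :: real
    have "((\<lambda>s. exp (- l * s)) has_real_derivative - l) (at 0)"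
      by (auto intro!: derivative_eq_intros)
    then have "((\<lambda>s. (exp (- l * s) - 1) / s) \<longlongrightarrow> - l) (at 0)" by (simp add: DERIV_def)
    then have "((\<lambda>s. - l - (exp (- l * s) - 1) / s) \<longlongrightarrow> - l - (- l)) (at 0)" by (intro tendsto_intros)
    then have "((\<lambda>s. - l - (exp (- l * s) - 1) / s) \<longlongrightarrow> 0) (at_right 0)"
      unfolding filterlim_at_split by simp
    then have wlim: "(w \<longlongrightarrow> 0) (at_right 0)"
      by (rule tendsto_cong[THEN iffD1, rotated])
         (auto simp: eventually_at_right_field w_def field_simps intro!: exI[of _ 1])
    then have "((\<lambda>s. ennreal ((w s)\<^sup>2)) \<longlongrightarrow> ennreal (0\<^sup>2)) (at_right 0)"
      by (intro tendsto_intros)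
    then have "((\<lambda>s. l2sq f * ennreal ((w s)\<^sup>2)) \<longlongrightarrow> l2sq f * ennreal (0\<^sup>2)) (at_right 0)"
      using fin by (intro ennreal_tendsto_cmult) auto
    then have w2: "((\<lambda>s. l2sq f * ennreal ((w s)\<^sup>2)) \<longlongrightarrow> 0) (at_right 0)" by simp
    show "((\<lambda>s. 2 * l2sq (\<lambda>x. (Pt s f x - f x) / s + l * f x) + 2 * (l2sq f * ennreal ((w s)\<^sup>2))) \<longlongrightarrow> 0) (at_right 0)"
      using tendsto_add[OF ennreal_tendsto_cmult[OF _ gen, of 2] ennreal_tendsto_cmult[OF _ w2, of 2]] by simp
    show "\<forall>\<^sub>F s in at_right 0. e s / ennreal (s\<^sup>2) \<le>
        2 * l2sq (\<lambda>x. (Pt s f x - f x) / s + l * f x) + 2 * (l2sq f * ennreal ((w s)\<^sup>2))"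
    proof (rule eventually_mono)
      show "\<forall>\<^sub>F s in at_right (0::real). 0 < s" by (simp add: eventually_at_right_less)
      fix s :: real assume s: "0 < s"
      have [measurable]: "Pt s f \<in> borel_measurable borel" using Pt_measurable s f by blast
      have "Pt s f x - exp (- l * s) * f x = s * (((Pt s f x - f x) / s + l * f x) + w s * f x)" for x
        using s by (simp add: w_def field_simps)
      then have "e s = ennreal (s\<^sup>2) * l2sq (\<lambda>x. ((Pt s f x - f x) / s + l * f x) + w s * f x)"
        unfolding e_def by (simp add: l2sq_cmult)
      then have "e s / ennreal (s\<^sup>2) = l2sq (\<lambda>x. ((Pt s f x - f x) / s + l * f x) + w s * f x)"
        using s by (simp only: ennreal_mult_divide_cancel zero_less_power)
      also have "\<dots> \<le> 2 * l2sq (\<lambda>x. (Pt s f x - f x) / s + l * f x) + 2 * l2sq (\<lambda>x. w s * f x)"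
        by (rule l2sq_add_le) measurable
      also have "l2sq (\<lambda>x. w s * f x) = l2sq f * ennreal ((w s)\<^sup>2)" by (subst mult.commute) (rule l2sq_cmult[OF f])
      finally show "e s / ennreal (s\<^sup>2) \<le>
        2 * l2sq (\<lambda>x. (Pt s f x - f x) / s + l * f x) + 2 * (l2sq f * ennreal ((w s)\<^sup>2))" .
    qed
  qed auto
  have seq: "filterlim (\<lambda>n. t / 2 ^ n) (at_right 0) sequentially"
  proof -
    have "(\<lambda>n. t * (1 / 2) ^ n) \<longlonglongrightarrow> t * 0" by (intro tendsto_mult tendsto_const LIMSEQ_power_zero) auto
    then show ?thesis using t by (auto simp: filterlim_at power_one_over divide_simps)
  qed
  have "(\<lambda>n. ennreal (exp (2 * \<bar>l\<bar> * t) * t\<^sup>2) * (e (t / 2 ^ n) / ennreal ((t / 2 ^ n)\<^sup>2))) \<longlonglongrightarrow> ennreal (exp (2 * \<bar>l\<bar> * t) * t\<^sup>2) * 0"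
    by (intro ennreal_tendsto_cmult filterlim_compose[OF small seq]) auto
  moreover have "e t \<le> ennreal (exp (2 * \<bar>l\<bar> * t) * t\<^sup>2) * (e (t / 2 ^ n) / ennreal ((t / 2 ^ n)\<^sup>2))" for n
  proof -
    have sq: "0 < (t / 2 ^ n)\<^sup>2" using t by simp
    have eqe: "e (t / 2 ^ n) = ennreal ((t / 2 ^ n)\<^sup>2) * (e (t / 2 ^ n) / ennreal ((t / 2 ^ n)\<^sup>2))"
      using ennreal_mult_divide_cancel[OF sq] by (simp only: ennreal_times_divide)
    have "e t \<le> ennreal (4 ^ n * exp (2 * \<bar>l\<bar> * (t - t / 2 ^ n))) * e (t / 2 ^ n)" by (rule e_iter)
    also have "\<dots> = ennreal (4 ^ n * exp (2 * \<bar>l\<bar> * (t - t / 2 ^ n)) * (t / 2 ^ n)\<^sup>2) * (e (t / 2 ^ n) / ennreal ((t / 2 ^ n)\<^sup>2))"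
      by (subst eqe) (simp add: ennreal_mult mult.assoc)
    also have "\<dots> \<le> ennreal (exp (2 * \<bar>l\<bar> * t) * t\<^sup>2) * (e (t / 2 ^ n) / ennreal ((t / 2 ^ n)\<^sup>2))"
    proof (intro mult_right_mono ennreal_leI)
      have "4 ^ n * exp (2 * \<bar>l\<bar> * (t - t / 2 ^ n)) * (t / 2 ^ n)\<^sup>2 = exp (2 * \<bar>l\<bar> * (t - t / 2 ^ n)) * t\<^sup>2"
      proof -
        have "(2 ^ n)\<^sup>2 = (4::real) ^ n" by (simp add: power2_eq_square power_mult_distrib[symmetric])
        then have "4 ^ n * (t / 2 ^ n)\<^sup>2 = t\<^sup>2" by (simp add: power_divide)
        then show ?thesis by (metis mult.assoc mult.commute)
      qed
      also have "\<dots> \<le> exp (2 * \<bar>l\<bar> * t) * t\<^sup>2"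
        using t by (intro mult_right_mono) (auto intro!: mult_left_mono)
      finally show "4 ^ n * exp (2 * \<bar>l\<bar> * (t - t / 2 ^ n)) * (t / 2 ^ n)\<^sup>2 \<le> exp (2 * \<bar>l\<bar> * t) * t\<^sup>2" .
    qed simp
    finally show ?thesis .
  qed
  ultimately have "e t \<le> ennreal (exp (2 * \<bar>l\<bar> * t) * t\<^sup>2) * 0"
    by (intro LIMSEQ_le_const[of _ _ "e t"]) auto
  then have "e t = 0" by simp
  moreover have [measurable]: "Pt t f \<in> borel_measurable borel" using Pt_measurable t f by blast
  ultimately have "AE x in lborel. ennreal ((Pt t f x - exp (- l * t) * f x)\<^sup>2) = 0"
    unfolding e_def l2sq_def by (subst (asm) nn_integral_0_iff_AE) auto
  then show ?thesis by eventually_elim simp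
qed

lemma Pt_eq_killed_semigroup:
  assumes "0 < t" "x \<in> B"
  shows "killed_semigroup B p t f x = Pt t (\<lambda>x. indicator B x * f x) x"
proof -
  have p0: "y \<in> B \<Longrightarrow> 0 \<le> p t x y" for y
    using killed assms unfolding killed_transition_density_def by blast
  show ?thesis
    unfolding killed_semigroup_def set_lebesgue_integral_def Pt_eq[OF assms(1)]
    using assms p0 by (intro Bochner_Integration.integral_cong refl) (auto simp: q_def indicator_def)
qed

lemma L2_on_extend:
  assumes "L2_on B f"
  shows "(\<lambda>x. indicator B x * f x) \<in> borel_measurable borel" "l2sq (\<lambda>x. indicator B x * f x) < \<infinity>"
proof -
  show m[measurable]: "(\<lambda>x. indicator B x * f x) \<in> borel_measurable borel"
    using assms by (simp add: L2_on_def set_borel_measurable_def)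
  have "integrable lborel (\<lambda>x. indicator B x * (f x)\<^sup>2)"
    using assms by (simp add: L2_on_def set_integrable_def)
  then have "(\<integral>\<^sup>+x. ennreal (norm (indicator B x * (f x)\<^sup>2)) \<partial>lborel) < \<infinity>"
    by (simp add: integrable_iff_bounded)
  also have "(\<integral>\<^sup>+x. ennreal (norm (indicator B x * (f x)\<^sup>2)) \<partial>lborel) = l2sq (\<lambda>x. indicator B x * f x)"
    unfolding l2sq_def by (intro nn_integral_cong) (auto split: split_indicator)
  finally show "l2sq (\<lambda>x. indicator B x * f x) < \<infinity>" .
qed

text \<open>For the zero extension of \<open>f\<close> the quotient vanishes outside the ball, so
  the limit over \<open>B\<close> in the definition of the generator is an L2 limit on the whole
  space.\<close>

lemma killed_generator_eigenfunction:
  assumes gen: "killed_generator B p f (\<lambda>x. - l * f x)" and t: "0 < t"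
  shows "AE x in lborel. Pt t (\<lambda>x. indicator B x * f x) x = exp (- l * t) * (indicator B x * f x)"
proof (rule eigenfunction_of_semigroup[OF t])
  let ?f = "\<lambda>x. indicator B x * f x"
  have L2: "L2_on B f" using gen by (simp add: killed_generator_def)
  show "?f \<in> borel_measurable borel" "l2sq ?f < \<infinity>" by (rule L2_on_extend[OF L2])+
  have "((\<lambda>t. \<integral>\<^sup>+x\<in>B. ennreal (((killed_semigroup B p t f x - f x) / t - (- l * f x))\<^sup>2) \<partial>lborel) \<longlongrightarrow> 0) (at_right 0)"
    using gen unfolding killed_generator_def by blast
  then show "((\<lambda>t. l2sq (\<lambda>x. (Pt t ?f x - ?f x) / t + l * ?f x)) \<longlongrightarrow> 0) (at_right 0)"
  proof (rule tendsto_cong[THEN iffD1, rotated])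
    show "\<forall>\<^sub>F t in at_right 0. (\<integral>\<^sup>+x\<in>B. ennreal (((killed_semigroup B p t f x - f x) / t - (- l * f x))\<^sup>2) \<partial>lborel) =
        l2sq (\<lambda>x. (Pt t ?f x - ?f x) / t + l * ?f x)"
    proof (rule eventually_mono)
      show "\<forall>\<^sub>F s in at_right (0::real). 0 < s" by (simp add: eventually_at_right_less)
      fix s :: real assume s: "0 < s"
      show "(\<integral>\<^sup>+x\<in>B. ennreal (((killed_semigroup B p s f x - f x) / s - (- l * f x))\<^sup>2) \<partial>lborel) =
        l2sq (\<lambda>x. (Pt s ?f x - ?f x) / s + l * ?f x)"
        unfolding l2sq_def
      proof (rule nn_integral_cong)
        fix x
        show "ennreal (((killed_semigroup B p s f x - f x) / s - (- l * f x))\<^sup>2) * indicator B x =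
          ennreal (((Pt s ?f x - ?f x) / s + l * ?f x)\<^sup>2)"
          using Pt_eq_killed_semigroup[OF s, of x f] Pt_outside[OF s, of x ?f] by (cases "x \<in> B") auto
      qed
    qed
  qed
qed

lemma dirichlet_eigenbasis_first:
  assumes basis: "dirichlet_eigenbasis B p \<nu> \<mu> \<phi>"
  shows "(\<lambda>x. indicator B x * \<phi> 1 x) \<in> borel_measurable borel" "l2sq (\<lambda>x. indicator B x * \<phi> 1 x) < \<infinity>"
proof -
  have "killed_generator B p (\<phi> 1) (\<lambda>x. - \<nu> * \<mu> 1 * \<phi> 1 x)"
    using basis by (simp add: dirichlet_eigenbasis_def)
  then have "L2_on B (\<phi> 1)" by (simp add: killed_generator_def)
  then show "(\<lambda>x. indicator B x * \<phi> 1 x) \<in> borel_measurable borel" "l2sq (\<lambda>x. indicator B x * \<phi> 1 x) < \<infinity>"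
    by (rule L2_on_extend)+
qed

text \<open>Completeness of the eigenfunctions replaces the symmetry of the killed density: the adjoint of
  the semigroup applied to \<open>\<phi> 1\<close> has the same Fourier coefficients as \<open>exp (- (\<nu> * \<mu> 1) * t) * \<phi> 1\<close>.\<close>

lemma dual_eigenfunction:
  assumes basis: "dirichlet_eigenbasis B p \<nu> \<mu> \<phi>" and t: "0 < t"
  shows "AE y in lborel. y \<in> B \<longrightarrow>
    (\<integral>\<^sup>+x. ennreal (\<phi> 1 x) * q t x y \<partial>lborel) = ennreal (exp (- (\<nu> * \<mu> 1) * t) * \<phi> 1 y)"
proof -
  interpret K: substochastic_kernel "q t" by (rule q_kernel[OF t])
  interpret T: substochastic_kernel "\<lambda>x y. q t y x" by (rule K.transpose)
  have gen: "\<And>n. 1 \<le> n \<Longrightarrow> killed_generator B p (\<phi> n) (\<lambda>x. - (\<nu> * \<mu> n) * \<phi> n x)"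
    using basis by (simp add: dirichlet_eigenbasis_def)
  have orth: "\<And>m n. 1 \<le> m \<Longrightarrow> 1 \<le> n \<Longrightarrow> (LINT x:B|lborel. \<phi> m x * \<phi> n x) = (if m = n then 1 else 0)"
    using basis by (simp add: dirichlet_eigenbasis_def)
  have complete: "\<And>h. L2_on B h \<Longrightarrow> (\<And>n. 1 \<le> n \<Longrightarrow> (LINT x:B|lborel. h x * \<phi> n x) = 0) \<Longrightarrow>
        AE x in lborel. x \<in> B \<longrightarrow> h x = 0"
    using basis by (simp add: dirichlet_eigenbasis_def)
  have pos: "\<And>x. x \<in> B \<Longrightarrow> 0 < \<phi> 1 x" using basis by (simp add: dirichlet_eigenbasis_def)
  define f where "f n x = indicator B x * \<phi> n x" for n x
  have L2: "1 \<le> n \<Longrightarrow> L2_on B (\<phi> n)" for n using gen by (simp add: killed_generator_def)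
  have fm[measurable]: "1 \<le> n \<Longrightarrow> f n \<in> borel_measurable borel" and ffin: "1 \<le> n \<Longrightarrow> l2sq (f n) < \<infinity>" for n
    using L2_on_extend[OF L2] unfolding f_def[abs_def] by auto
  have eig: "1 \<le> n \<Longrightarrow> AE x in lborel. Pt t (f n) x = exp (- (\<nu> * \<mu> n) * t) * f n x" for n
    using killed_generator_eigenfunction[OF gen t] unfolding f_def[abs_def] by auto
  have forth: "1 \<le> m \<Longrightarrow> 1 \<le> n \<Longrightarrow> (\<integral>x. f m x * f n x \<partial>lborel) = (if m = n then 1 else 0)" for m n
  proof -
    assume "1 \<le> m" "1 \<le> n"
    have "(\<integral>x. f m x * f n x \<partial>lborel) = (LINT x:B|lborel. \<phi> m x * \<phi> n x)"
      unfolding set_lebesgue_integral_def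
      by (intro Bochner_Integration.integral_cong) (auto simp: f_def split: split_indicator)
    then show ?thesis using orth \<open>1 \<le> m\<close> \<open>1 \<le> n\<close> by simp
  qed
  have f1[measurable]: "f 1 \<in> borel_measurable borel" and f1fin: "l2sq (f 1) < \<infinity>" using fm ffin by auto
  define c where "c = exp (- (\<nu> * \<mu> 1) * t)"
  define h where "h y = T.op (f 1) y - c * f 1 y" for y
  have Tm[measurable]: "T.op (f 1) \<in> borel_measurable borel" by (rule T.op_measurable) simp
  have hm[measurable]: "h \<in> borel_measurable borel" unfolding h_def[abs_def] by measurable
  have Tfin: "l2sq (T.op (f 1)) < \<infinity>" using T.l2sq_op_le[OF f1] f1fin by (rule le_less_trans)
  have hfin: "l2sq h < \<infinity>"
  proof -
    have "l2sq h \<le> 2 * l2sq (T.op (f 1)) + 2 * l2sq (\<lambda>y. (- c) * f 1 y)"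
      using l2sq_add_le[of "T.op (f 1)" "\<lambda>y. (- c) * f 1 y"] by (simp add: h_def[abs_def])
    also have "l2sq (\<lambda>y. (- c) * f 1 y) = ennreal ((- c)\<^sup>2) * l2sq (f 1)" by (rule l2sq_cmult[OF f1])
    also have "2 * l2sq (T.op (f 1)) + 2 * \<dots> < \<infinity>" using Tfin f1fin by (simp add: ennreal_mult_less_top)
    finally show ?thesis .
  qed
  have hout: "h y = 0" if "y \<notin> B" for y
  proof -
    have "q t x y = 0" for x using that by (simp add: q_def)
    then show ?thesis using that by (simp add: h_def f_def T.op_def)
  qed
  have "L2_on B h"
    unfolding L2_on_def set_borel_measurable_def set_integrable_def
  proof
    show "(\<lambda>x. indicator B x *\<^sub>R h x) \<in> borel_measurable lborel" by measurable
    have "integrable lborel (\<lambda>x. (h x)\<^sup>2)" using hfin by (intro integrableI_nonneg) (auto simp: l2sq_def)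
    then show "integrable lborel (\<lambda>x. indicator B x *\<^sub>R (h x)\<^sup>2)" by (rule integrable_mult_indicator[rotated]) simp
  qed
  \<comment> \<open>Moving the semigroup onto \<open>f n\<close> produces
    \<open>exp (- (\<nu> * \<mu> n) * t)\<close> times a Kronecker delta: for \<open>n\<close> other
    than 1 both terms vanish, and for \<open>n = 1\<close> they cancel by the choice of
    \<open>c\<close>.\<close>
  moreover have "(LINT x:B|lborel. h x * \<phi> n x) = 0" if n: "1 \<le> n" for n
  proof -
    have fn[measurable]: "f n \<in> borel_measurable borel" and fnfin: "l2sq (f n) < \<infinity>" using fm ffin n by auto
    have int_prod: "integrable lborel (\<lambda>x. u x * v x)"
      if "u \<in> borel_measurable borel" "v \<in> borel_measurable borel" "l2sq u < \<infinity>" "l2sq v < \<infinity>" for u v :: "'a \<Rightarrow> real"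
    proof (rule integrableI_bounded)
      show "(\<lambda>x. u x * v x) \<in> borel_measurable lborel" using that by simp
      have "(\<integral>\<^sup>+x. ennreal (norm (u x * v x)) \<partial>lborel) \<le> l2sq u + l2sq v"
        using l2sq_prod_le[OF that(1,2)] by (simp add: abs_mult)
      also have "\<dots> < \<infinity>" using that by simp
      finally show "(\<integral>\<^sup>+x. ennreal (norm (u x * v x)) \<partial>lborel) < \<infinity>" .
    qed
    have "(LINT x:B|lborel. h x * \<phi> n x) = (\<integral>x. T.op (f 1) x * f n x - c * (f 1 x * f n x) \<partial>lborel)"
      unfolding set_lebesgue_integral_def
      by (intro Bochner_Integration.integral_cong refl)
         (auto simp: h_def f_def algebra_simps split: split_indicator)
    also have "\<dots> = (\<integral>x. T.op (f 1) x * f n x \<partial>lborel) - c * (\<integral>x. f 1 x * f n x \<partial>lborel)"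
      using int_prod[OF Tm fn Tfin fnfin] int_prod[OF f1 fn f1fin fnfin] by simp
    also have "(\<integral>x. T.op (f 1) x * f n x \<partial>lborel) = (\<integral>x. f 1 x * Pt t (f n) x \<partial>lborel)"
      using K.op_adjoint(2)[OF f1 f1fin fn fnfin] by (simp add: Pt_def)
    also have "\<dots> = (\<integral>x. exp (- (\<nu> * \<mu> n) * t) * (f 1 x * f n x) \<partial>lborel)"
    proof (rule integral_cong_AE)
      show "AE x in lborel. f 1 x * Pt t (f n) x = exp (- (\<nu> * \<mu> n) * t) * (f 1 x * f n x)"
        using eig[OF n] by eventually_elim simp
      have [measurable]: "Pt t (f n) \<in> borel_measurable borel" by (rule Pt_measurable[OF t]) simp
      show "(\<lambda>x. f 1 x * Pt t (f n) x) \<in> borel_measurable lborel" by measurable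
    qed measurable
    also have "\<dots> = exp (- (\<nu> * \<mu> n) * t) * (if 1 = n then 1 else 0)" using forth[of 1 n] n by simp
    finally show ?thesis using forth[of 1 n] n by (auto simp: c_def)
  qed
  ultimately have h0: "AE y in lborel. y \<in> B \<longrightarrow> h y = 0" by (rule complete)
  show ?thesis
    using h0 T.AE_abs_finite[OF f1 f1fin]
  proof eventually_elim
    case (elim y)
    show ?case
    proof
      assume y: "y \<in> B"
      \<comment> \<open>Positivity of \<open>\<phi> 1\<close> removes the negative part, so the
        signed identity becomes one between integrals in [0, infinity].\<close>
      have f1p: "0 \<le> f 1 x" for x using pos[of x] by (auto simp: f_def split: split_indicator)
      have eq: "(\<integral>\<^sup>+x. ennreal (\<phi> 1 x) * q t x y \<partial>lborel) = (\<integral>\<^sup>+x. q t x y * ennreal (f 1 x) \<partial>lborel)"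
        by (intro nn_integral_cong) (auto simp: q_def f_def mult.commute split: split_indicator)
      have "T.op (f 1) y = enn2real (\<integral>\<^sup>+x. q t x y * ennreal (f 1 x) \<partial>lborel)"
        using T.op_eq_diff[OF f1 elim(2)] f1p by (simp add: ennreal_neg)
      moreover have "(\<integral>\<^sup>+x. q t x y * ennreal (f 1 x) \<partial>lborel) < \<infinity>"
        using elim(2) f1p by simp
      ultimately have "(\<integral>\<^sup>+x. q t x y * ennreal (f 1 x) \<partial>lborel) = ennreal (T.op (f 1) y)" by simp
      also have "T.op (f 1) y = c * \<phi> 1 y" using elim(1) y by (simp add: h_def f_def)
      finally show "(\<integral>\<^sup>+x. ennreal (\<phi> 1 x) * q t x y \<partial>lborel) = ennreal (exp (- (\<nu> * \<mu> 1) * t) * \<phi> 1 y)"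
        unfolding eq c_def .
    qed
  qed
qed

end

section \<open>The inverse subordinator and the Green function\<close>

lemma one_minus_exp_ge_half: "z / 2 \<le> 1 - exp (- z)" if "0 \<le> z" "z \<le> 1" for z :: real
proof -
  have "exp (- z) \<le> 1 / (1 + z)"
    using exp_ge_add_one_self[of z] that by (simp add: exp_minus field_simps)
  also have "1 / (1 + z) \<le> 1 - z / 2"
    using that mult_left_mono[of z 1 z] by (simp add: field_simps)
  finally show ?thesis by simp
qed

lemma stable_subordinator_nonneg:
  assumes "stable_subordinator \<beta> N D" "0 \<le> t"
  shows "AE \<omega> in N. 0 \<le> D t \<omega>"
proof -
  have "AE \<omega> in N. mono_on {0..} (\<lambda>t. D t \<omega>)" "AE \<omega> in N. D 0 \<omega> = 0"
    using assms by (auto simp: stable_subordinator_def levy_process_def)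
  then show ?thesis
    by eventually_elim (use assms(2) mono_onD in fastforce)
qed

text \<open>For y = \<open>D 1 \<omega> / T\<close>, the quantity 1 - exp (-e y) is at most 1, and
  at most 2 e (1 - exp (-y)) when y is at most 1. Taking means turns both exponentials into known
  Laplace transforms: the left side is at least \<open>e powr \<beta> * a / 2\<close>, the last term
  at most \<open>2 * e * a\<close>. Since \<open>\<beta> < 1\<close>, a small \<open>e\<close> makes
  the first dominate, and the remainder is a lower bound for the tail.\<close>

lemma stable_subordinator_tail:
  assumes sub: "stable_subordinator \<beta> N D" and \<beta>: "0 < \<beta>" "\<beta> < 1"
  shows "\<exists>c>0. \<forall>t\<ge>0. c * (1 + t) powr (- \<beta>) \<le> measure N {\<omega> \<in> space N. t < D 1 \<omega>}"
proof -
  interpret prob_space N using sub by (simp add: stable_subordinator_def levy_process_def)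
  have Dm[measurable]: "D 1 \<in> borel_measurable N" using sub by (simp add: stable_subordinator_def levy_process_def)
  have D0: "AE \<omega> in N. 0 \<le> D 1 \<omega>" by (rule stable_subordinator_nonneg[OF sub]) simp
  have laplace: "(\<integral>\<omega>. exp (- l * D 1 \<omega>) \<partial>N) = exp (- (l powr \<beta>))" if "0 \<le> l" for l
    using sub that by (simp add: stable_subordinator_def)
  \<comment> \<open>Chosen so that \<open>2 * e\<close> equals \<open>e powr \<beta> / 4\<close>,
    one half of the coefficient \<open>e powr \<beta> / 2\<close> of the lower bound.\<close>
  define e :: real where "e = (1 / 8) powr (1 / (1 - \<beta>))"
  have e0: "0 < e" by (simp add: e_def)
  have e1: "e powr (1 - \<beta>) = 1 / 8" using \<beta> by (simp add: e_def powr_powr)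
  have ele: "e \<le> 1" unfolding e_def using \<beta> by (intro powr_le1) auto
  have eb: "e = e powr \<beta> / 8"
  proof -
    have "e = e powr (\<beta> + (1 - \<beta>))" using e0 by simp
    also have "\<dots> = e powr \<beta> * e powr (1 - \<beta>)" by (rule powr_add)
    finally show ?thesis using e1 by simp
  qed
  show ?thesis
  proof (intro exI[of _ "e powr \<beta> / 4"] conjI allI impI)
    show "0 < e powr \<beta> / 4" using e0 by simp
    fix t :: real assume t: "0 \<le> t"
    \<comment> \<open>The shift by 1 gives \<open>a \<le> 1\<close>, so the exponent
      \<open>e powr \<beta> * a\<close> stays at most 1, where \<open>one_minus_exp_ge_half\<close>
      applies, uniformly down to \<open>t = 0\<close>.\<close>
    define T where "T = 1 + t"
    have T: "1 \<le> T" using t by (simp add: T_def)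
    define a where "a = T powr (- \<beta>)"
    have a: "0 < a" "a \<le> 1" using T \<beta> by (auto simp: a_def powr_minus inverse_le_1_iff intro!: ge_one_powr_ge_zero)
    have pw: "(e / T) powr \<beta> = e powr \<beta> * a" "(1 / T) powr \<beta> = a"
      using e0 T by (simp_all add: powr_divide a_def powr_minus_divide)
    have i1: "integrable N (\<lambda>\<omega>. exp (- l * D 1 \<omega>))" if "0 \<le> l" for l
      using D0 that by (intro integrable_const_bound[where B=1]) (auto elim!: eventually_mono)
    have E1: "(\<integral>\<omega>. 1 - exp (- (e / T) * D 1 \<omega>) \<partial>N) = 1 - exp (- (e powr \<beta> * a))"
      using i1[of "e / T"] laplace[of "e / T"] e0 T pw by (simp add: prob_space)
    have E2: "(\<integral>\<omega>. 1 - exp (- (1 / T) * D 1 \<omega>) \<partial>N) = 1 - exp (- a)"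
      using i1[of "1 / T"] laplace[of "1 / T"] T pw by (simp add: prob_space)
    let ?S = "{\<omega> \<in> space N. T < D 1 \<omega>}"
    have iS: "integrable N (indicator ?S :: _ \<Rightarrow> real)" by (intro integrable_real_indicator) (auto simp: less_top[symmetric])
    have "e powr \<beta> * a / 2 \<le> 1 - exp (- (e powr \<beta> * a))"
      using a e0 ele \<beta> by (intro one_minus_exp_ge_half mult_le_one powr_le1) auto
    also have "\<dots> = (\<integral>\<omega>. 1 - exp (- (e / T) * D 1 \<omega>) \<partial>N)" by (simp only: E1)
    also have "\<dots> \<le> (\<integral>\<omega>. indicator ?S \<omega> + 2 * e * (1 - exp (- (1 / T) * D 1 \<omega>)) \<partial>N)"
    proof (rule integral_mono_AE)
      show "integrable N (\<lambda>\<omega>. 1 - exp (- (e / T) * D 1 \<omega>))" using i1[of "e / T"] e0 T by simp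
      show "integrable N (\<lambda>\<omega>. indicator ?S \<omega> + 2 * e * (1 - exp (- (1 / T) * D 1 \<omega>)))"
        using i1[of "1 / T"] iS T by simp
      show "AE \<omega> in N. 1 - exp (- (e / T) * D 1 \<omega>) \<le> indicator ?S \<omega> + 2 * e * (1 - exp (- (1 / T) * D 1 \<omega>))"
        using D0 AE_space
      proof eventually_elim
        case (elim \<omega>)
        define y where "y = D 1 \<omega> / T"
        have y0: "0 \<le> y" using elim T by (simp add: y_def)
        have r: "- (e / T) * D 1 \<omega> = - (e * y)" "- (1 / T) * D 1 \<omega> = - y" by (simp_all add: y_def)
        show ?case
        proof (cases "T < D 1 \<omega>")
          case True
          have "0 \<le> 2 * e * (1 - exp (- y))" using e0 y0 by simp
          then show ?thesis unfolding r using True elim by (simp add: add_increasing2)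
        next
          case False
          then have "y \<le> 1" using T by (simp add: y_def)
          then have "y / 2 \<le> 1 - exp (- y)" using y0 one_minus_exp_ge_half by blast
          then have "e * y \<le> 2 * e * (1 - exp (- y))" using e0 mult_left_mono[of "y / 2" "1 - exp (- y)" "2 * e"] by simp
          moreover have "1 - exp (- (e * y)) \<le> e * y" using exp_ge_add_one_self[of "- (e * y)"] by simp
          ultimately show ?thesis unfolding r using False by simp
        qed
      qed
    qed
    also have "\<dots> = measure N ?S + 2 * e * (1 - exp (- a))"
      using i1[of "1 / T"] iS T E2 by simp
    also have "\<dots> \<le> measure N ?S + 2 * e * a"
      using exp_ge_add_one_self[of "- a"] e0 by simp
    finally have "e powr \<beta> * a / 2 \<le> measure N ?S + 2 * e * a" .
    moreover have "2 * e * a = e powr \<beta> * a / 4" by (subst eb) simp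
    ultimately have "e powr \<beta> * a / 4 \<le> measure N ?S" by linarith
    then have "e powr \<beta> / 4 * a \<le> measure N ?S" by simp
    also have "\<dots> \<le> measure N {\<omega> \<in> space N. t < D 1 \<omega>}"
      by (intro finite_measure_mono) (auto simp: T_def)
    finally show "e powr \<beta> / 4 * (1 + t) powr (- \<beta>) \<le> measure N {\<omega> \<in> space N. t < D 1 \<omega>}"
      by (simp add: a_def T_def)
  qed
qed

section \<open>First passage times and the subordinated kernel\<close>

locale subordinated_killed_levy = killed_levy N X p R
  for N :: "'v measure" and X :: "real \<Rightarrow> 'v \<Rightarrow> 'a::euclidean_space" and p R +
  fixes D :: "real \<Rightarrow> 'v \<Rightarrow> real" and fE :: "real \<Rightarrow> real \<Rightarrow> real" and \<beta> :: real
  assumes subordinator: "stable_subordinator \<beta> N D"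
    and density: "first_passage_density N D fE"
    and \<beta>: "0 < \<beta>" "\<beta> < 1"
begin

text \<open>An everywhere jointly measurable version of the first passage time.\<close>

definition passage :: "real \<Rightarrow> 'v \<Rightarrow> ereal" where
  "passage t \<omega> = (INF r\<in>\<rat> \<inter> {0..}. if t < D r \<omega> then ereal r else \<infinity>)"

text \<open>On a path that never exceeds \<open>t\<close> the real infimum in
  \<open>first_passage\<close> is \<open>Inf {}\<close>, a fixed but unspecified number; the same
  term is used here so that both agree on every monotone path.\<close>

definition passage_time :: "real \<Rightarrow> 'v \<Rightarrow> real" where
  "passage_time t \<omega> = (if passage t \<omega> = \<infinity> then Inf {} else real_of_ereal (passage t \<omega>))"

lemma D_measurable[measurable]: "0 \<le> r \<Longrightarrow> D r \<in> borel_measurable N"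
  using subordinator by (simp add: stable_subordinator_def levy_process_def)

lemma passage_time_pair_measurable:
  "(\<lambda>z. passage_time (fst z) (snd z)) \<in> borel_measurable (borel \<Otimes>\<^sub>M N)"
proof -
  have "(\<lambda>z. passage (fst z) (snd z)) \<in> borel_measurable (borel \<Otimes>\<^sub>M N)"
    unfolding passage_def
  proof (rule borel_measurable_INF)
    show "countable (\<rat> \<inter> {0::real..})" using countable_rat by (rule countable_Int1)
    fix r :: real assume "r \<in> \<rat> \<inter> {0..}"
    then have [measurable]: "D r \<in> borel_measurable N" by simp
    show "(\<lambda>z. if fst z < D r (snd z) then ereal r else \<infinity>) \<in> borel_measurable (borel \<Otimes>\<^sub>M N)"
      by measurable
  qed
  then show ?thesis unfolding passage_time_def by measurable
qed

lemma passage_time_measurable[measurable (raw)]: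
  assumes "f \<in> borel_measurable M" "g \<in> M \<rightarrow>\<^sub>M N"
  shows "(\<lambda>z. passage_time (f z) (g z)) \<in> borel_measurable M"
  using measurable_compose[OF measurable_Pair[OF assms] passage_time_pair_measurable] by simp

text \<open>On a monotone path the set of times above level \<open>t\<close> is closed upwards, so
  its rational members determine the infimum and countably many coordinates suffice.\<close>

lemma passage_time_eq:
  assumes mono: "mono_on {0..} (\<lambda>t. D t \<omega>)"
  shows "first_passage D t \<omega> = passage_time t \<omega>"
proof (cases "{r. 0 \<le> r \<and> D r \<omega> > t} = {}")
  case True
  then have "passage t \<omega> = (INF r\<in>\<rat> \<inter> {0::real..}. \<infinity>)"
    unfolding passage_def by (intro INF_cong refl) auto
  also have "\<dots> = \<infinity>"
    by (rule INF_const) (metis Int_iff Rats_0 atLeast_iff empty_iff order_refl)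
  finally show ?thesis unfolding first_passage_def passage_time_def True by simp
next
  case False
  let ?A = "{r. 0 \<le> r \<and> D r \<omega> > t}"
  have bdd: "bdd_below ?A" by (intro bdd_belowI[of _ 0]) auto
  have up: "r' \<in> ?A" if "r \<in> ?A" "r \<le> r'" for r r'
    using mono_onD[OF mono, of r r'] that by auto
  have "passage t \<omega> = ereal (Inf ?A)"
  proof (rule antisym)
    show "ereal (Inf ?A) \<le> passage t \<omega>"
      unfolding passage_def using bdd by (intro INF_greatest) (auto intro: cInf_lower)
    show "passage t \<omega> \<le> ereal (Inf ?A)"
    proof (rule ereal_le_epsilon2)
      fix e :: real assume e: "0 < e"
      obtain r where r: "r \<in> ?A" "r < Inf ?A + e"
        using cInf_lessD[of ?A "Inf ?A + e"] False e by auto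
      obtain s where s: "s \<in> \<rat>" "r < s" "s < Inf ?A + e"
        using Rats_dense_in_real[OF r(2)] by auto
      have sA: "s \<in> ?A" using up[OF r(1)] s by simp
      have "passage t \<omega> \<le> (if t < D s \<omega> then ereal s else \<infinity>)"
        unfolding passage_def using s sA by (intro INF_lower) auto
      also have "\<dots> = ereal s" using sA by simp
      also have "\<dots> \<le> ereal (Inf ?A) + ereal e" using s by simp
      finally show "passage t \<omega> \<le> ereal (Inf ?A) + ereal e" .
    qed
  qed
  then show ?thesis unfolding first_passage_def passage_time_def by simp
qed

lemma AE_passage_time: "AE \<omega> in N. \<forall>t. first_passage D t \<omega> = passage_time t \<omega>"
proof -
  have "AE \<omega> in N. mono_on {0..} (\<lambda>t. D t \<omega>)"
    using subordinator by (simp add: stable_subordinator_def)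
  then show ?thesis by eventually_elim (use passage_time_eq in blast)
qed

lemma fE_properties:
  assumes t: "0 < t"
  shows "0 \<le> fE t s" "fE t \<in> borel_measurable borel"
    and "g \<in> borel_measurable borel \<Longrightarrow> (\<integral>\<^sup>+s. ennreal (fE t s) * g s \<partial>lborel) = (\<integral>\<^sup>+\<omega>. g (passage_time t \<omega>) \<partial>N)"
proof -
  have d: "distributed (completion N) lborel (first_passage D t) (\<lambda>s. ennreal (fE t s))"
    and nn: "\<And>s. 0 \<le> fE t s"
    using density t by (auto simp: first_passage_density_def)
  show "0 \<le> fE t s" by (rule nn)
  have "(\<lambda>s. enn2real (ennreal (fE t s))) \<in> borel_measurable lborel"
    using distributed_borel_measurable[OF d] by measurable
  then show "fE t \<in> borel_measurable borel" using nn by simp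
  assume g[measurable]: "g \<in> borel_measurable borel"
  have "(\<integral>\<^sup>+s. ennreal (fE t s) * g s \<partial>lborel) = (\<integral>\<^sup>+\<omega>. g (first_passage D t \<omega>) \<partial>completion N)"
    using distributed_nn_integral[OF d, of g] by simp
  also have "\<dots> = (\<integral>\<^sup>+\<omega>. g (passage_time t \<omega>) \<partial>completion N)"
    using AE_completion[OF AE_passage_time] by (intro nn_integral_cong_AE) (auto elim!: eventually_mono)
  also have "\<dots> = (\<integral>\<^sup>+\<omega>. g (passage_time t \<omega>) \<partial>N)"
    by (rule nn_integral_completion) 
  finally show "(\<integral>\<^sup>+s. ennreal (fE t s) * g s \<partial>lborel) = (\<integral>\<^sup>+\<omega>. g (passage_time t \<omega>) \<partial>N)" .
qed

text \<open>The Green function as an expectation over the passage time. The density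
  \<open>fE t s\<close> is known to be measurable in \<open>s\<close> for each \<open>t\<close>,
  whereas this form is jointly measurable in time and both space variables, as Tonelli in time
  requires.\<close>

definition Gn :: "real \<Rightarrow> 'a \<Rightarrow> 'a \<Rightarrow> ennreal" where
  "Gn t x y = (\<integral>\<^sup>+\<omega>. q (passage_time t \<omega>) x y \<partial>N)"

lemma Gn_measurable[measurable (raw)]:
  assumes [measurable]: "f \<in> borel_measurable M" "g \<in> M \<rightarrow>\<^sub>M borel" "h \<in> M \<rightarrow>\<^sub>M borel"
  shows "(\<lambda>z. Gn (f z) (g z) (h z)) \<in> borel_measurable M"
  unfolding Gn_def by measurable

lemma Gn_mass_le_1: "(\<integral>\<^sup>+y. Gn t x y \<partial>lborel) \<le> 1"
proof -
  interpret NL: pair_sigma_finite N "lborel :: 'a measure" ..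
  have "(\<integral>\<^sup>+y. Gn t x y \<partial>lborel) = (\<integral>\<^sup>+\<omega>. \<integral>\<^sup>+y. q (passage_time t \<omega>) x y \<partial>lborel \<partial>N)"
    unfolding Gn_def by (rule NL.Fubini') measurable
  also have "\<dots> \<le> (\<integral>\<^sup>+\<omega>. 1 \<partial>N)" by (intro nn_integral_mono q_mass_le_1)
  also have "\<dots> = 1" by (simp add: emeasure_space_1)
  finally show ?thesis .
qed

text \<open>The identity holds at every pair of points: where the integral is infinite,
  \<open>enn2real\<close> and the Bochner integral both return 0.\<close>

lemma green_function_eq:
  assumes "0 < t" "x \<in> B" "y \<in> B"
  shows "green_function p fE t x y = enn2real (Gn t x y)"
proof -
  note fE = fE_properties[OF assms(1)]
  have p0: "0 < s \<Longrightarrow> 0 \<le> p s x y" for s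
    using killed assms unfolding killed_transition_density_def by blast
  have [measurable]: "fE t \<in> borel_measurable borel" by (rule fE)
  have eq: "ennreal (indicator {0<..} s *\<^sub>R (p s x y * fE t s)) = ennreal (fE t s) * q s x y" for s
    using p0[of s] fE(1)[of s] assms by (auto simp: q_def ennreal_mult mult.commute split: split_indicator)
  have qm[measurable]: "(\<lambda>s. q s x y) \<in> borel_measurable borel" by measurable
  have rm: "(\<lambda>s. indicator {0<..} s *\<^sub>R (p s x y * fE t s)) \<in> borel_measurable lborel"
  proof -
    have "(\<lambda>s. enn2real (ennreal (indicator {0<..} s *\<^sub>R (p s x y * fE t s)))) \<in> borel_measurable lborel"
      unfolding eq by measurable
    then show ?thesis using p0 fE(1) by (subst (asm) enn2real_ennreal) (auto split: split_indicator)
  qed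
  have "green_function p fE t x y = enn2real (\<integral>\<^sup>+s. ennreal (indicator {0<..} s *\<^sub>R (p s x y * fE t s)) \<partial>lborel)"
    unfolding green_function_def set_lebesgue_integral_def
    by (rule integral_eq_nn_integral[OF rm]) (use p0 fE(1) in \<open>auto split: split_indicator\<close>)
  then show ?thesis unfolding eq Gn_def using fE(3)[OF qm] by simp
qed

text \<open>The default value at infinite kernel values does no harm under the integral:
  \<open>Gn t x\<close> has mass at most 1 and is therefore finite almost everywhere.\<close>

lemma nn_integral_green:
  assumes "0 < t" "x \<in> B"
  shows "(\<integral>\<^sup>+y\<in>B. ennreal (green_function p fE t x y) * g y \<partial>lborel) = (\<integral>\<^sup>+y. Gn t x y * g y \<partial>lborel)"
proof (rule nn_integral_cong_AE)
  have "AE y in lborel. Gn t x y \<noteq> \<infinity>"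
  proof (rule nn_integral_PInf_AE)
    show "(\<integral>\<^sup>+y. Gn t x y \<partial>lborel) \<noteq> \<infinity>" using Gn_mass_le_1[of t x] by (auto simp: top_unique)
  qed measurable
  then show "AE y in lborel. ennreal (green_function p fE t x y) * g y * indicator B y = Gn t x y * g y"
  proof eventually_elim
    case (elim y)
    show ?case
    proof (cases "y \<in> B")
      case True
      then show ?thesis using assms elim green_function_eq[of t x y] by (simp add: less_top[symmetric])
    next
      case False
      then have "Gn t x y = 0" by (simp add: Gn_def q_def)
      then show ?thesis using False by simp
    qed
  qed
qed

text \<open>If \<open>D 1\<close> exceeds \<open>t\<close>, the level \<open>t\<close> has been
  passed by time 1. The passage time is nonzero almost surely because its law has a density and
  hence no atom at 0.\<close>

lemma passage_time_small_prob:
  assumes t: "0 < t"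
  shows "measure N {\<omega> \<in> space N. t < D 1 \<omega>} \<le> measure N {\<omega> \<in> space N. 0 < passage_time t \<omega> \<and> passage_time t \<omega> \<le> 1}"
proof -
  have [measurable]: "D 1 \<in> borel_measurable N" by simp
  have "(\<integral>\<^sup>+\<omega>. indicator {0} (passage_time t \<omega>) \<partial>N) = (\<integral>\<^sup>+s. ennreal (fE t s) * indicator {0} s \<partial>lborel)"
    by (rule fE_properties(3)[OF t, symmetric]) simp
  also have "\<dots> = 0"
    using fE_properties(2)[OF t] by (subst nn_integral_0_iff_AE) (auto intro!: AE_I'[of "{0}"] simp: indicator_def)
  finally have "AE \<omega> in N. indicator {0} (passage_time t \<omega>) = (0::ennreal)"
    by (subst (asm) nn_integral_0_iff_AE) measurable
  then have nz: "AE \<omega> in N. passage_time t \<omega> \<noteq> 0" by eventually_elim (auto simp: indicator_def split: if_splits)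
  show ?thesis
  proof (rule finite_measure_mono_AE)
    show "AE \<omega> in N. \<omega> \<in> {\<omega> \<in> space N. t < D 1 \<omega>} \<longrightarrow> \<omega> \<in> {\<omega> \<in> space N. 0 < passage_time t \<omega> \<and> passage_time t \<omega> \<le> 1}"
      using nz AE_passage_time
    proof eventually_elim
      case (elim \<omega>)
      show ?case
      proof
        assume w: "\<omega> \<in> {\<omega> \<in> space N. t < D 1 \<omega>}"
        let ?A = "{r. 0 \<le> r \<and> D r \<omega> > t}"
        have one: "1 \<in> ?A" using w by simp
        have "first_passage D t \<omega> \<le> 1" unfolding first_passage_def
          using one by (intro cInf_lower) (auto intro!: bdd_belowI[of _ 0])
        moreover have "0 \<le> first_passage D t \<omega>" unfolding first_passage_def
          using one by (intro cInf_greatest) blast+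
        ultimately show "\<omega> \<in> {\<omega> \<in> space N. 0 < passage_time t \<omega> \<and> passage_time t \<omega> \<le> 1}"
          using w elim by auto
      qed
    qed
  qed measurable
qed

text \<open>The adjoint eigenvalue equation is used path by path at the time
  \<open>passage_time t \<omega>\<close>. Only passage times in (0, 1] are kept: there
  \<open>exp (- l * s)\<close> is at least \<open>exp (- \<bar>l\<bar>)\<close> whichever sign
  \<open>l\<close> has. One constant serves all \<open>t\<close> and \<open>g\<close>, hence the
  initial datum and the drift alike.\<close>

lemma weighted_green_lower_bound:
  assumes basis: "dirichlet_eigenbasis B p \<nu> \<mu> \<phi>"
  shows "\<exists>c>0. \<forall>t>0. \<forall>g\<in>borel_measurable borel.
     ennreal (c * (1 + t) powr (- \<beta>)) * (\<integral>\<^sup>+y\<in>B. ennreal (\<phi> 1 y) * g y \<partial>lborel)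
     \<le> (\<integral>\<^sup>+x\<in>B. ennreal (\<phi> 1 x) * (\<integral>\<^sup>+y. Gn t x y * g y \<partial>lborel) \<partial>lborel)"
proof -
  obtain c0 where c0: "0 < c0" "\<And>t. 0 \<le> t \<Longrightarrow> c0 * (1 + t) powr (- \<beta>) \<le> measure N {\<omega> \<in> space N. t < D 1 \<omega>}"
    using stable_subordinator_tail[OF subordinator \<beta>] by blast
  define l where "l = \<nu> * \<mu> 1"
  note fm[measurable] = dirichlet_eigenbasis_first(1)[OF basis]
  define f where "f x = ennreal (indicator B x * \<phi> 1 x)" for x
  have [measurable]: "f \<in> borel_measurable borel" unfolding f_def[abs_def] by measurable
  have fB: "ennreal (\<phi> 1 x) * v * indicator B x = f x * v" for x v
    by (auto simp: f_def split: split_indicator)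
  show ?thesis
  proof (intro exI[of _ "exp (- \<bar>l\<bar>) * c0"] conjI allI impI ballI)
    show "0 < exp (- \<bar>l\<bar>) * c0" using c0 by simp
    fix t :: real and g :: "'a \<Rightarrow> ennreal" assume t: "0 < t" and g[measurable]: "g \<in> borel_measurable borel"
    interpret NL: pair_sigma_finite N "lborel :: 'a measure" ..
    define J where "J = (\<integral>\<^sup>+y. f y * g y \<partial>lborel)"
    have dual: "(\<integral>\<^sup>+x. f x * (\<integral>\<^sup>+y. q s x y * g y \<partial>lborel) \<partial>lborel) = ennreal (exp (- l * s)) * J" if s: "0 < s" for s
    proof -
      have "(\<integral>\<^sup>+x. f x * (\<integral>\<^sup>+y. q s x y * g y \<partial>lborel) \<partial>lborel) = (\<integral>\<^sup>+x. \<integral>\<^sup>+y. f x * q s x y * g y \<partial>lborel \<partial>lborel)"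
        by (simp add: nn_integral_cmult mult.assoc)
      also have "\<dots> = (\<integral>\<^sup>+y. \<integral>\<^sup>+x. f x * q s x y * g y \<partial>lborel \<partial>lborel)"
        by (rule lborel_pair.Fubini') measurable
      also have "\<dots> = (\<integral>\<^sup>+y. (\<integral>\<^sup>+x. f x * q s x y \<partial>lborel) * g y \<partial>lborel)"
        by (simp add: nn_integral_multc)
      also have "\<dots> = (\<integral>\<^sup>+y. ennreal (exp (- l * s)) * (f y * g y) \<partial>lborel)"
      proof (rule nn_integral_cong_AE)
        show "AE y in lborel. (\<integral>\<^sup>+x. f x * q s x y \<partial>lborel) * g y = ennreal (exp (- l * s)) * (f y * g y)"
          using dual_eigenfunction[OF basis s]
        proof eventually_elim
          case (elim y)
          have eq: "f x * q s x y = ennreal (\<phi> 1 x) * q s x y" for x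
            by (auto simp: f_def q_def split: split_indicator)
          show ?case
          proof (cases "y \<in> B")
            case True
            then show ?thesis unfolding eq using elim by (simp add: f_def l_def ennreal_mult' mult.assoc)
          next
            case False
            then show ?thesis by (simp add: f_def q_def)
          qed
        qed
      qed
      also have "\<dots> = ennreal (exp (- l * s)) * J" unfolding J_def by (simp add: nn_integral_cmult)
      finally show ?thesis .
    qed
    let ?P = "{\<omega> \<in> space N. 0 < passage_time t \<omega> \<and> passage_time t \<omega> \<le> 1}"
    have [measurable]: "?P \<in> sets N" by measurable
    have "ennreal (exp (- \<bar>l\<bar>) * c0 * (1 + t) powr (- \<beta>)) \<le> ennreal (exp (- \<bar>l\<bar>) * measure N ?P)"
      using c0(2)[of t] passage_time_small_prob[OF t] t by (intro ennreal_leI) (simp add: mult.assoc)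
    also have "\<dots> = ennreal (exp (- \<bar>l\<bar>)) * emeasure N ?P"
      by (simp add: ennreal_mult emeasure_eq_measure)
    finally have "ennreal (exp (- \<bar>l\<bar>) * c0 * (1 + t) powr (- \<beta>)) * J \<le> ennreal (exp (- \<bar>l\<bar>)) * emeasure N ?P * J"
      by (rule mult_right_mono) simp
    also have "\<dots> = (\<integral>\<^sup>+\<omega>. ennreal (exp (- \<bar>l\<bar>)) * J * indicator ?P \<omega> \<partial>N)"
      by (subst nn_integral_cmult_indicator) (simp_all add: mult_ac)
    also have "\<dots> \<le> (\<integral>\<^sup>+\<omega>. \<integral>\<^sup>+x. f x * (\<integral>\<^sup>+y. q (passage_time t \<omega>) x y * g y \<partial>lborel) \<partial>lborel \<partial>N)"
    proof (rule nn_integral_mono)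
      fix \<omega>
      show "ennreal (exp (- \<bar>l\<bar>)) * J * indicator ?P \<omega> \<le> (\<integral>\<^sup>+x. f x * (\<integral>\<^sup>+y. q (passage_time t \<omega>) x y * g y \<partial>lborel) \<partial>lborel)"
      proof (cases "\<omega> \<in> ?P")
        case True
        then have s: "0 < passage_time t \<omega>" "passage_time t \<omega> \<le> 1" by auto
        have "l * passage_time t \<omega> \<le> \<bar>l\<bar> * passage_time t \<omega>" using s by (intro mult_right_mono) auto
        also have "\<dots> \<le> \<bar>l\<bar>" using s by (intro mult_left_le) auto
        finally have "exp (- \<bar>l\<bar>) \<le> exp (- l * passage_time t \<omega>)" by simp
        then show ?thesis using True unfolding dual[OF s(1)] by (simp add: mult_right_mono ennreal_leI)
      qed simp
    qed
    also have "\<dots> = (\<integral>\<^sup>+x. \<integral>\<^sup>+\<omega>. f x * (\<integral>\<^sup>+y. q (passage_time t \<omega>) x y * g y \<partial>lborel) \<partial>N \<partial>lborel)"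
      by (rule NL.Fubini'[symmetric]) measurable
    also have "\<dots> = (\<integral>\<^sup>+x. f x * (\<integral>\<^sup>+y. Gn t x y * g y \<partial>lborel) \<partial>lborel)"
    proof (rule nn_integral_cong)
      fix x
      have "(\<integral>\<^sup>+\<omega>. f x * (\<integral>\<^sup>+y. q (passage_time t \<omega>) x y * g y \<partial>lborel) \<partial>N) =
        f x * (\<integral>\<^sup>+\<omega>. \<integral>\<^sup>+y. q (passage_time t \<omega>) x y * g y \<partial>lborel \<partial>N)"
        by (rule nn_integral_cmult) measurable
      also have "(\<integral>\<^sup>+\<omega>. \<integral>\<^sup>+y. q (passage_time t \<omega>) x y * g y \<partial>lborel \<partial>N) =
         (\<integral>\<^sup>+y. \<integral>\<^sup>+\<omega>. q (passage_time t \<omega>) x y * g y \<partial>N \<partial>lborel)"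
        by (rule NL.Fubini'[symmetric]) measurable
      also have "\<dots> = (\<integral>\<^sup>+y. Gn t x y * g y \<partial>lborel)" by (simp add: Gn_def nn_integral_multc)
      finally show "(\<integral>\<^sup>+\<omega>. f x * (\<integral>\<^sup>+y. q (passage_time t \<omega>) x y * g y \<partial>lborel) \<partial>N) = f x * (\<integral>\<^sup>+y. Gn t x y * g y \<partial>lborel)" .
    qed
    finally show "ennreal (exp (- \<bar>l\<bar>) * c0 * (1 + t) powr (- \<beta>)) * (\<integral>\<^sup>+y\<in>B. ennreal (\<phi> 1 y) * g y \<partial>lborel)
     \<le> (\<integral>\<^sup>+x\<in>B. ennreal (\<phi> 1 x) * (\<integral>\<^sup>+y. Gn t x y * g y \<partial>lborel) \<partial>lborel)"
      unfolding fB J_def .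
  qed
qed

end

section \<open>A nonlinear Volterra inequality\<close>

text \<open>The graph of the convex power \<open>1 + \<eta>\<close> lies above its tangent at
  \<open>z\<close>; this is Young's inequality for the conjugate exponents \<open>1 + \<eta>\<close>
  and \<open>(1 + \<eta>) / \<eta>\<close>.\<close>

lemma powr_tangent:
  fixes a z \<eta> :: real
  assumes "0 \<le> a" "0 < z" "0 < \<eta>"
  shows "(1 + \<eta>) * z powr \<eta> * a \<le> a powr (1 + \<eta>) + \<eta> * z powr (1 + \<eta>)"
proof -
  define q where "q = (1 + \<eta>) / \<eta>"
  have q: "1 / (1 + \<eta>) + 1 / q = 1" "q > 1" using assms by (auto simp: q_def field_simps)
  have zq: "(z powr \<eta>) powr q = z powr (1 + \<eta>)" using assms by (simp add: powr_powr q_def)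
  have "a * z powr \<eta> \<le> a powr (1 + \<eta>) / (1 + \<eta>) + (z powr \<eta>) powr q / q"
    using assms q by (intro Youngs_inequality) auto
  then have "(1 + \<eta>) * (a * z powr \<eta>) \<le> (1 + \<eta>) * (a powr (1 + \<eta>) / (1 + \<eta>) + z powr (1 + \<eta>) / q)"
    unfolding zq using assms by (intro mult_left_mono) auto
  also have "\<dots> = (1 + \<eta>) / (1 + \<eta>) * a powr (1 + \<eta>) + (1 + \<eta>) / q * z powr (1 + \<eta>)"
    by (simp add: distrib_left)
  also have "\<dots> = a powr (1 + \<eta>) + \<eta> * z powr (1 + \<eta>)" using assms by (simp add: q_def)
  finally show ?thesis by (simp add: mult_ac)
qed

text \<open>The tangent inequality at the mean \<open>k / m\<close>, integrated. A general mass
  \<open>m\<close> covers both the probability measure of the noise and the weight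
  \<open>\<phi> 1\<close>, and the right-hand side may be infinite.\<close>

lemma nn_integral_powr_jensen:
  assumes f[measurable]: "f \<in> borel_measurable M" and f0: "\<And>x. 0 \<le> f x"
    and mass: "emeasure M (space M) = ennreal m" and m: "0 < m"
    and k: "(\<integral>\<^sup>+x. ennreal (f x) \<partial>M) = ennreal k" "0 \<le> k" and \<eta>: "0 < \<eta>"
  shows "ennreal (m powr (- \<eta>) * k powr (1 + \<eta>)) \<le> (\<integral>\<^sup>+x. ennreal (f x powr (1 + \<eta>)) \<partial>M)"
proof (cases "k = 0")
  case False
  define z where "z = k / m"
  have z: "0 < z" using False k(2) m by (simp add: z_def)
  show ?thesis
  proof (cases "\<integral>\<^sup>+x. ennreal (f x powr (1 + \<eta>)) \<partial>M")
    case (real r)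
    have "ennreal ((1 + \<eta>) * z powr \<eta>) * ennreal k = (\<integral>\<^sup>+x. ennreal ((1 + \<eta>) * z powr \<eta>) * ennreal (f x) \<partial>M)"
      unfolding k(1)[symmetric] by (rule nn_integral_cmult[symmetric]) measurable
    also have "\<dots> \<le> (\<integral>\<^sup>+x. ennreal (f x powr (1 + \<eta>)) + ennreal (\<eta> * z powr (1 + \<eta>)) \<partial>M)"
    proof (rule nn_integral_mono)
      fix x
      have "ennreal ((1 + \<eta>) * z powr \<eta> * f x) \<le> ennreal (f x powr (1 + \<eta>) + \<eta> * z powr (1 + \<eta>))"
        using powr_tangent[OF f0 z \<eta>] by (rule ennreal_leI)
      then show "ennreal ((1 + \<eta>) * z powr \<eta>) * ennreal (f x) \<le> ennreal (f x powr (1 + \<eta>)) + ennreal (\<eta> * z powr (1 + \<eta>))"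
        using \<eta> f0 by (simp add: ennreal_mult ennreal_plus)
    qed
    also have "\<dots> = ennreal r + ennreal (\<eta> * z powr (1 + \<eta>)) * ennreal m"
      using real mass by (simp add: nn_integral_add)
    finally have "ennreal ((1 + \<eta>) * z powr \<eta> * k) \<le> ennreal (r + \<eta> * z powr (1 + \<eta>) * m)"
      using \<eta> k m real by (simp add: ennreal_mult ennreal_plus)
    then have le: "(1 + \<eta>) * z powr \<eta> * k \<le> r + \<eta> * z powr (1 + \<eta>) * m"
      using \<eta> m real by (subst (asm) ennreal_le_iff) auto
    have "z powr (1 + \<eta>) * m = z powr \<eta> * k"
    proof -
      have "z * m = k" using m by (simp add: z_def)
      then show ?thesis using z by (simp add: powr_add mult_ac)
    qed
    then have "z powr \<eta> * k \<le> r" using le by (simp add: distrib_right mult.assoc)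
    moreover have "z powr \<eta> * k = m powr (- \<eta>) * k powr (1 + \<eta>)"
      using k False m by (simp add: z_def powr_divide powr_minus_divide powr_add)
    ultimately show ?thesis using real by (simp add: ennreal_leI)
  qed simp
qed simp

text \<open>The hypothesis is the integrated form of a differential inequality with weight (1 + s)
  to the power \<open>- (\<beta> * (1 + \<eta>))\<close>, to be solved by separating variables. As
  \<open>k\<close> is merely bounded and measurable, its left-hand side \<open>Y\<close> is
  continuous but need not be differentiable, so calculus is applied to a minorant instead.\<close>

lemma volterra_blow_up_bound:
  fixes k :: "real \<Rightarrow> real"
  assumes T: "0 < T" and a: "0 < a" and C: "0 < C" and \<eta>: "0 < \<eta>" and \<beta>: "0 < \<beta>"
    and k[measurable]: "k \<in> borel_measurable borel"
    and k0: "\<And>t. 0 \<le> k t" and kM: "\<And>t. k t \<le> Mx"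
    and ineq: "\<And>t. 0 < t \<Longrightarrow> t \<le> T \<Longrightarrow>
       a + C * (LINT s:{0..t}|lborel. k s powr (1 + \<eta>)) \<le> (1 + t) powr \<beta> * k t"
  shows "\<eta> * C * integral {0..T} (\<lambda>s. (1 + s) powr (- (\<beta> * (1 + \<eta>)))) < a powr (- \<eta>)"
proof -
  define h where "h s = k s powr (1 + \<eta>)" for s
  define w where "w s = (1 + s) powr (- (\<beta> * (1 + \<eta>)))" for s :: real
  have hset: "set_integrable lborel {0..t} h" if "t \<le> T" for t
    unfolding set_integrable_def
  proof (rule integrableI_bounded_set_indicator[where B="Mx powr (1 + \<eta>)"])
    show "h \<in> borel_measurable lborel" unfolding h_def[abs_def] by measurable
    show "AE x in lborel. x \<in> {0..t} \<longrightarrow> norm (h x) \<le> Mx powr (1 + \<eta>)"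
      using k0 kM \<eta> by (auto simp: h_def intro!: powr_mono2)
  qed (auto simp: emeasure_lborel_Icc_eq)
  have hHK: "h integrable_on {0..t}" "(LINT s:{0..t}|lborel. h s) = integral {0..t} h" if "t \<le> T" for t
    using set_borel_integral_eq_integral[OF hset[OF that]] by auto
  define Y where "Y t = a + C * integral {0..t} h" for t
  have Ycont: "continuous_on {0..T} Y"
    unfolding Y_def using hHK(1)[of T] by (intro continuous_intros indefinite_integral_continuous_1) auto
  have int_h_nonneg: "0 \<le> integral {0..t} h" if "t \<le> T" for t
    using hHK(1)[OF that] by (intro Henstock_Kurzweil_Integration.integral_nonneg) (auto simp: h_def)
  have Ya: "a \<le> Y t" if "t \<le> T" for t
    unfolding Y_def using int_h_nonneg[OF that] C by simp
  have Yk: "Y t \<le> (1 + t) powr \<beta> * k t" if "0 < t" "t \<le> T" for t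
    using ineq[OF that] hHK(2)[OF that(2)] unfolding Y_def h_def by simp
  have hw: "w t * Y t powr (1 + \<eta>) \<le> h t" if "0 < t" "t \<le> T" for t
  proof -
    have "Y t powr (1 + \<eta>) \<le> ((1 + t) powr \<beta> * k t) powr (1 + \<eta>)"
      using Yk[OF that] Ya[OF that(2)] a \<eta> by (intro powr_mono2) auto
    also have "\<dots> = (1 + t) powr (\<beta> * (1 + \<eta>)) * h t"
      using k0 that by (simp add: powr_mult h_def powr_powr)
    finally have "w t * Y t powr (1 + \<eta>) \<le> w t * ((1 + t) powr (\<beta> * (1 + \<eta>)) * h t)"
      by (intro mult_left_mono) (auto simp: w_def)
    also have "\<dots> = h t" 
    proof -
      have "w t * (1 + t) powr (\<beta> * (1 + \<eta>)) = 1"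
        unfolding w_def powr_add[symmetric] using that by simp
      then show ?thesis by (simp add: mult.assoc[symmetric])
    qed
    finally show ?thesis .
  qed
  have wcont: "continuous_on {0..T} w"
    unfolding w_def by (intro continuous_intros) auto
  have wYcont: "continuous_on {0..T} (\<lambda>s. w s * Y s powr (1 + \<eta>))"
  proof (intro continuous_intros wcont Ycont ballI)
    fix s assume "s \<in> {0..T}"
    then show "Y s \<noteq> 0" using Ya[of s] a by auto
  qed
  have sub: "{0..t} \<subseteq> {0..T}" if "t \<le> T" for t using that by auto
  \<comment> \<open>Replacing \<open>h\<close> by its continuous lower bound yields a differentiable
    minorant of \<open>Y\<close> with the same initial value \<open>a\<close>.\<close>
  define W where "W t = a + C * integral {0..t} (\<lambda>s. w s * Y s powr (1 + \<eta>))" for t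
  have wYint: "(\<lambda>s. w s * Y s powr (1 + \<eta>)) integrable_on {0..t}" if "t \<le> T" for t
    using continuous_on_subset[OF wYcont sub[OF that]] by (rule integrable_continuous_real)
  have WY: "W t \<le> Y t" if "t \<le> T" for t
  proof -
    \<comment> \<open>The lower bound for \<open>h\<close> is known at positive times only; changing
      the value at 0 makes it hold on the closed interval.\<close>
    define f where "f s = (if s = 0 then 0 else w s * Y s powr (1 + \<eta>))" for s
    have "integral {0..t} (\<lambda>s. w s * Y s powr (1 + \<eta>)) = integral {0..t} f"
      by (rule integral_spike[of "{0}"]) (auto simp: f_def)
    moreover have "f integrable_on {0..t}"
      by (rule integrable_spike[OF wYint[OF that], of "{0}"]) (auto simp: f_def)
    then have "integral {0..t} f \<le> integral {0..t} h"
      using hHK(1)[OF that] hw that by (intro Henstock_Kurzweil_Integration.integral_le) (auto simp: f_def h_def)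
    ultimately have "integral {0..t} (\<lambda>s. w s * Y s powr (1 + \<eta>)) \<le> integral {0..t} h" by simp
    then show ?thesis unfolding W_def Y_def using C by simp
  qed
  have Wa: "a \<le> W t" if "t \<le> T" for t
    unfolding W_def using C wYint[OF that]
    by (auto intro!: mult_nonneg_nonneg Henstock_Kurzweil_Integration.integral_nonneg simp: w_def)
  \<comment> \<open>Because \<open>W \<le> Y\<close>, the derivative of
    \<open>W t powr (- \<eta>)\<close> is at most \<open>- \<eta> * C * w t\<close>, so
    \<open>V\<close> does not increase. The strict inequality at the end comes from
    \<open>W T powr (- \<eta>) > 0\<close>.\<close>
  define V where "V t = W t powr (- \<eta>) + \<eta> * C * integral {0..t} w" for t
  have "V T \<le> V 0"
  proof (rule DERIV_nonpos_imp_decreasing_open[of 0 T V])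
    show "0 \<le> T" using T by simp
    have W1: "(W has_real_derivative C * (w t * Y t powr (1 + \<eta>))) (at t within {0..T})" if "t \<in> {0..T}" for t
      unfolding W_def using integral_has_real_derivative[OF wYcont that] by (auto intro!: derivative_eq_intros)
    have V1: "(V has_real_derivative
        (- \<eta> * W t powr (- \<eta> - 1) * (C * (w t * Y t powr (1 + \<eta>))) + \<eta> * C * w t)) (at t within {0..T})" if "t \<in> {0..T}" for t
      unfolding V_def using W1[OF that] integral_has_real_derivative[OF wcont that] Wa[of t] a that
      by (auto intro!: derivative_eq_intros)
    have contV: "continuous_on {0..T} V"
      unfolding continuous_on_eq_continuous_within by (blast intro: DERIV_continuous V1)
    show "continuous_on {0..T} V" by (rule contV)
    fix t assume t: "0 < t" "t < T"
    have Wp: "0 < W t" using Wa[of t] a t by simp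
    have "1 = W t powr (- \<eta> - 1) * W t powr (1 + \<eta>)" using Wp by (simp add: powr_add[symmetric])
    also have "\<dots> \<le> W t powr (- \<eta> - 1) * Y t powr (1 + \<eta>)"
      using WY[of t] Wp t \<eta> by (intro mult_left_mono powr_mono2) auto
    finally have "\<eta> * C * w t * 1 \<le> \<eta> * C * w t * (W t powr (- \<eta> - 1) * Y t powr (1 + \<eta>))"
      using \<eta> C by (intro mult_left_mono) (auto simp: w_def)
    then have "- \<eta> * W t powr (- \<eta> - 1) * (C * (w t * Y t powr (1 + \<eta>))) + \<eta> * C * w t \<le> 0"
      by (simp add: mult_ac)
    moreover have "(V has_real_derivative
        (- \<eta> * W t powr (- \<eta> - 1) * (C * (w t * Y t powr (1 + \<eta>))) + \<eta> * C * w t)) (at t)"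
      using V1[of t] t by (simp add: at_within_Icc_at)
    ultimately show "\<exists>y. (V has_real_derivative y) (at t) \<and> y \<le> 0" by blast
  qed
  moreover have "V 0 = a powr (- \<eta>)" by (simp add: V_def W_def)
  moreover have "0 < W T powr (- \<eta>)" using Wa[of T] a by simp
  ultimately have "V T - W T powr (- \<eta>) < a powr (- \<eta>)" by linarith
  then show ?thesis by (simp add: V_def w_def[abs_def])
qed

section \<open>The mean of a solution\<close>

lemma measurable_extend_by_zero:
  fixes u :: "'s \<Rightarrow> 't \<Rightarrow> 'w \<Rightarrow> real"
  assumes u: "(\<lambda>(t, x, \<omega>). u t x \<omega>)
      \<in> borel_measurable (restrict_space S A \<Otimes>\<^sub>M restrict_space L C \<Otimes>\<^sub>M M)"
    and [measurable]: "A \<in> sets S" "C \<in> sets L"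
  shows "(\<lambda>(t, x, \<omega>). indicator A t * indicator C x * u t x \<omega>) \<in> borel_measurable (S \<Otimes>\<^sub>M L \<Otimes>\<^sub>M M)"
proof -
  let ?P = "S \<Otimes>\<^sub>M L \<Otimes>\<^sub>M M"
  let ?\<Omega> = "{z \<in> space ?P. fst z \<in> A \<and> fst (snd z) \<in> C}"
  have \<Omega>: "?\<Omega> \<in> sets ?P" by measurable
  have "(\<lambda>z. (fst z, fst (snd z), snd (snd z)))
      \<in> restrict_space ?P ?\<Omega> \<rightarrow>\<^sub>M restrict_space S A \<Otimes>\<^sub>M restrict_space L C \<Otimes>\<^sub>M M"
    by (intro measurable_Pair measurable_restrict_space2 measurable_restrict_space1)
       (auto simp: space_restrict_space space_pair_measure)
  from measurable_compose[OF this u]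
  have "(\<lambda>z. u (fst z) (fst (snd z)) (snd (snd z))) \<in> borel_measurable (restrict_space ?P ?\<Omega>)"
    by (simp only: split_beta' fst_conv snd_conv)
  then have "(\<lambda>z. indicator ?\<Omega> z *\<^sub>R u (fst z) (fst (snd z)) (snd (snd z))) \<in> borel_measurable ?P"
    by (subst (asm) borel_measurable_restrict_space_iff) (use \<Omega> in auto)
  then show ?thesis
    by (rule measurable_cong[THEN iffD1, rotated]) (auto simp: space_pair_measure split: split_indicator)
qed

context subordinated_killed_levy
begin

context
  fixes M :: "'w measure" and \<kappa> :: "'a noise_kind" and F :: "(real \<times> 'a) set \<Rightarrow> 'w \<Rightarrow> real"
    and b \<sigma> :: "real \<Rightarrow> real" and \<eta> :: real and u0 :: "'a \<Rightarrow> real" and T :: real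
    and u :: "real \<Rightarrow> 'a \<Rightarrow> 'w \<Rightarrow> real"
  assumes noise: "gaussian_noise M \<kappa> F"
    and \<eta>: "0 < \<eta>" and b: "\<And>x. \<bar>x\<bar> powr (1 + \<eta>) \<le> b x"
    and u0: "initial_condition B u0" and T: "0 < T"
    and sol: "random_field_solution B (green_function p fE) b \<sigma> M \<kappa> F u0 T u"
begin

interpretation W: gaussian_noise_space M \<kappa> F
proof (intro gaussian_noise_space.intro gaussian_noise_space_axioms.intro)
  show "prob_space M" using noise by (simp add: gaussian_noise_def)
qed (rule noise)

text \<open>A mild solution is measurable on the restricted product only, while the Tonelli
  arguments run over the full one.\<close>

definition u_ext :: "real \<Rightarrow> 'a \<Rightarrow> 'w \<Rightarrow> real" where
  "u_ext t x \<omega> = indicator {0..T} t * indicator B x * u t x \<omega>"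

definition mean_field :: "real \<Rightarrow> 'a \<Rightarrow> real" where
  "mean_field t x = (\<integral>\<omega>. u_ext t x \<omega> \<partial>M)"

lemma mild: "mild_solution B (green_function p fE) b \<sigma> M \<kappa> F u0 T u"
  using sol by (simp add: random_field_solution_def)

lemma u_ext_measurable[measurable (raw)]:
  assumes "f \<in> borel_measurable Q" "g \<in> Q \<rightarrow>\<^sub>M borel" "h \<in> Q \<rightarrow>\<^sub>M M"
  shows "(\<lambda>z. u_ext (f z) (g z) (h z)) \<in> borel_measurable Q"
proof -
  have "(\<lambda>(t, x, \<omega>). u_ext t x \<omega>) \<in> borel_measurable (borel \<Otimes>\<^sub>M borel \<Otimes>\<^sub>M M)"
    unfolding u_ext_def using mild unfolding mild_solution_def by (intro measurable_extend_by_zero) auto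
  from measurable_compose[OF measurable_Pair[OF assms(1) measurable_Pair[OF assms(2,3)]] this]
  show ?thesis by simp
qed

lemma mean_field_measurable[measurable (raw)]:
  assumes [measurable]: "f \<in> borel_measurable Q" "g \<in> Q \<rightarrow>\<^sub>M borel"
  shows "(\<lambda>z. mean_field (f z) (g z)) \<in> borel_measurable Q"
  unfolding mean_field_def by measurable

text \<open>One constant works for all times and points, by comparing |z| with 1 + z^2 and using the
  second moments.\<close>

lemma u_ext_moment: "\<exists>C. 0 \<le> C \<and> (\<forall>t x. (\<integral>\<^sup>+\<omega>. ennreal \<bar>u_ext t x \<omega>\<bar> \<partial>M) \<le> ennreal C)"
proof -
  define S2 where "S2 = (SUP x\<in>B. SUP t\<in>{0..T}. \<integral>\<^sup>+\<omega>. ennreal (\<bar>u t x \<omega>\<bar> powr 2) \<partial>M)"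
  have "\<forall>k\<ge>2. (SUP x\<in>B. SUP t\<in>{0..T}. \<integral>\<^sup>+\<omega>. ennreal (\<bar>u t x \<omega>\<bar> powr k) \<partial>M) < \<infinity>"
    using sol unfolding random_field_solution_def by blast
  then have S2: "S2 < \<infinity>" unfolding S2_def by blast
  have "(\<integral>\<^sup>+\<omega>. ennreal \<bar>u_ext t x \<omega>\<bar> \<partial>M) \<le> 1 + S2" for t x
  proof (cases "t \<in> {0..T} \<and> x \<in> B")
    case True
    have "(\<integral>\<^sup>+\<omega>. ennreal \<bar>u_ext t x \<omega>\<bar> \<partial>M) \<le> (\<integral>\<^sup>+\<omega>. 1 + ennreal ((u_ext t x \<omega>)\<^sup>2) \<partial>M)"
    proof (rule nn_integral_mono)
      fix \<omega>
      have "\<bar>u_ext t x \<omega>\<bar> \<le> 1 + (u_ext t x \<omega>)\<^sup>2"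
        using sum_squares_bound[of 1 "\<bar>u_ext t x \<omega>\<bar>"] by simp
      then have "ennreal \<bar>u_ext t x \<omega>\<bar> \<le> ennreal (1 + (u_ext t x \<omega>)\<^sup>2)" by (rule ennreal_leI)
      then show "ennreal \<bar>u_ext t x \<omega>\<bar> \<le> 1 + ennreal ((u_ext t x \<omega>)\<^sup>2)" by (simp add: ennreal_plus)
    qed
    also have "\<dots> = 1 + (\<integral>\<^sup>+\<omega>. ennreal ((u_ext t x \<omega>)\<^sup>2) \<partial>M)"
      by (subst nn_integral_add) (auto simp: W.emeasure_space_1)
    also have "(\<integral>\<^sup>+\<omega>. ennreal ((u_ext t x \<omega>)\<^sup>2) \<partial>M) = (\<integral>\<^sup>+\<omega>. ennreal (\<bar>u t x \<omega>\<bar> powr 2) \<partial>M)"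
      using True by (simp add: u_ext_def)
    also have "\<dots> \<le> S2" unfolding S2_def using True by (intro SUP_upper2[of x] SUP_upper2[of t]) auto
    finally show ?thesis by (simp add: add_left_mono)
  qed (auto simp: u_ext_def)
  moreover obtain C where "1 + S2 = ennreal C" "0 \<le> C" using S2 by (cases "1 + S2") auto
  ultimately show ?thesis by auto
qed

lemma u_ext_integrable: "integrable M (u_ext t x)"
proof -
  obtain C where "(\<integral>\<^sup>+\<omega>. ennreal \<bar>u_ext t x \<omega>\<bar> \<partial>M) \<le> ennreal C" using u_ext_moment by blast
  also have "\<dots> < \<infinity>" by simp
  finally show ?thesis by (intro integrableI_bounded) simp_all
qed

lemma mean_field_bounded: "\<exists>C\<ge>0. \<forall>t x. \<bar>mean_field t x\<bar> \<le> C"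
proof -
  obtain C where C: "0 \<le> C" "\<And>t x. (\<integral>\<^sup>+\<omega>. ennreal \<bar>u_ext t x \<omega>\<bar> \<partial>M) \<le> ennreal C" using u_ext_moment by blast
  have "\<bar>mean_field t x\<bar> \<le> C" for t x
  proof -
    have "ennreal \<bar>mean_field t x\<bar> \<le> (\<integral>\<^sup>+\<omega>. ennreal \<bar>u_ext t x \<omega>\<bar> \<partial>M)"
      using integral_norm_bound_ennreal[OF u_ext_integrable[of t x]] by (simp add: mean_field_def)
    also have "\<dots> \<le> ennreal C" by (rule C)
    finally show ?thesis using C(1) by (simp add: ennreal_le_iff)
  qed
  then show ?thesis using C(1) by blast
qed

lemma mean_field_powr_le: "ennreal (\<bar>mean_field t x\<bar> powr (1 + \<eta>)) \<le> (\<integral>\<^sup>+\<omega>. ennreal (\<bar>u_ext t x \<omega>\<bar> powr (1 + \<eta>)) \<partial>M)"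
proof -
  have i: "integrable M (\<lambda>\<omega>. \<bar>u_ext t x \<omega>\<bar>)" using u_ext_integrable by simp
  have eq: "(\<integral>\<^sup>+\<omega>. ennreal \<bar>u_ext t x \<omega>\<bar> \<partial>M) = ennreal (\<integral>\<omega>. \<bar>u_ext t x \<omega>\<bar> \<partial>M)"
    by (rule nn_integral_eq_integral[OF i]) simp
  have "\<bar>mean_field t x\<bar> powr (1 + \<eta>) \<le> (\<integral>\<omega>. \<bar>u_ext t x \<omega>\<bar> \<partial>M) powr (1 + \<eta>)"
    unfolding mean_field_def using \<eta> by (intro powr_mono2 integral_abs_bound) auto
  then have "ennreal (\<bar>mean_field t x\<bar> powr (1 + \<eta>)) \<le> ennreal (1 powr (- \<eta>) * (\<integral>\<omega>. \<bar>u_ext t x \<omega>\<bar> \<partial>M) powr (1 + \<eta>))"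
    by (simp add: ennreal_leI)
  also have "\<dots> \<le> (\<integral>\<^sup>+\<omega>. ennreal (\<bar>u_ext t x \<omega>\<bar> powr (1 + \<eta>)) \<partial>M)"
    by (rule nn_integral_powr_jensen[OF _ _ _ _ eq]) (use \<eta> in \<open>auto simp: W.emeasure_space_1\<close>)
  finally show ?thesis .
qed

definition Gz :: "real \<Rightarrow> 'a \<Rightarrow> 'a \<Rightarrow> real" where
  "Gz t x y = enn2real (Gn t x y)"

lemma Gz_measurable[measurable (raw)]:
  assumes [measurable]: "f \<in> borel_measurable Q" "g \<in> Q \<rightarrow>\<^sub>M borel" "h \<in> Q \<rightarrow>\<^sub>M borel"
  shows "(\<lambda>z. Gz (f z) (g z) (h z)) \<in> borel_measurable Q"
  unfolding Gz_def by measurable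

lemma nn_integral_Gz:
  assumes "0 < t" "x \<in> B"
  shows "(\<integral>\<^sup>+y. ennreal (Gz t x y) * (g y * indicator B y) \<partial>lborel) = (\<integral>\<^sup>+y. Gn t x y * g y \<partial>lborel)"
proof -
  have "(\<integral>\<^sup>+y. ennreal (Gz t x y) * (g y * indicator B y) \<partial>lborel) =
      (\<integral>\<^sup>+y\<in>B. ennreal (green_function p fE t x y) * g y \<partial>lborel)"
    using green_function_eq[OF assms] by (intro nn_integral_cong) (auto simp: Gz_def split: split_indicator)
  then show ?thesis using nn_integral_green[OF assms] by simp
qed

lemma u0_measurable: "(\<lambda>y. indicator B y * u0 y) \<in> borel_measurable borel"
  using u0 by (simp add: initial_condition_def set_borel_measurable_def)

lemma initial_term:
  assumes t: "0 < t" and x: "x \<in> B"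
  shows "ennreal (LINT y:B|lborel. green_function p fE t x y * u0 y) = (\<integral>\<^sup>+y. Gn t x y * ennreal (indicator B y * u0 y) \<partial>lborel)"
proof -
  note [measurable] = u0_measurable
  obtain C where C: "\<And>y. y \<in> B \<Longrightarrow> u0 y \<le> C" "0 \<le> C"
  proof -
    obtain C where C: "\<forall>z\<in>u0 ` B. norm z \<le> C"
      using u0 unfolding initial_condition_def bounded_iff by blast
    have "u0 y \<le> \<bar>C\<bar>" if "y \<in> B" for y
      using bspec[OF C, of "u0 y"] that by auto
    then show ?thesis by (intro that[of "\<bar>C\<bar>"]) auto
  qed
  have u00: "0 \<le> indicator B y * u0 y" for y using u0 by (auto simp: initial_condition_def split: split_indicator)
  have eq: "(\<integral>\<^sup>+y. ennreal (Gz t x y * (indicator B y * u0 y)) \<partial>lborel) = (\<integral>\<^sup>+y. Gn t x y * ennreal (indicator B y * u0 y) \<partial>lborel)"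
    unfolding nn_integral_Gz[OF t x, symmetric]
    using u00 by (intro nn_integral_cong) (auto simp: ennreal_mult Gz_def split: split_indicator)
  have "(\<integral>\<^sup>+y. Gn t x y * ennreal (indicator B y * u0 y) \<partial>lborel) \<le> (\<integral>\<^sup>+y. Gn t x y * ennreal C \<partial>lborel)"
    using C by (intro nn_integral_mono mult_left_mono ennreal_leI) (auto split: split_indicator)
  also have "\<dots> \<le> 1 * ennreal C" by (simp add: nn_integral_multc Gn_mass_le_1 mult_right_mono del: mult_1)
  also have "\<dots> < \<infinity>" by simp
  finally have fin: "(\<integral>\<^sup>+y. Gn t x y * ennreal (indicator B y * u0 y) \<partial>lborel) < \<infinity>" .
  have "(LINT y:B|lborel. green_function p fE t x y * u0 y) = (\<integral>y. Gz t x y * (indicator B y * u0 y) \<partial>lborel)"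
    unfolding set_lebesgue_integral_def using green_function_eq[OF t x]
    by (intro Bochner_Integration.integral_cong) (auto simp: Gz_def split: split_indicator)
  also have "\<dots> = enn2real (\<integral>\<^sup>+y. ennreal (Gz t x y * (indicator B y * u0 y)) \<partial>lborel)"
    using u00 by (intro integral_eq_nn_integral) (auto simp: Gz_def)
  finally show ?thesis using fin unfolding eq by simp
qed

text \<open>Integrability on the product is part of a mild solution and allows the iterated integral
  to be read as a single one; \<open>b\<close> is nonnegative, and bounding it below by the power
  under this integral gives the second claim.\<close>

lemma drift_term:
  assumes int: "set_integrable lborel ({0<..<t} \<times> B) (\<lambda>(s, y). b (u s y \<omega>) * green_function p fE (t - s) x y)"
    and x: "x \<in> B" and t: "t \<le> T"
  shows "0 \<le> (LINT y:B|lborel. LINT s:{0<..<t}|lborel. b (u s y \<omega>) * green_function p fE (t - s) x y)"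
    and "(\<integral>\<^sup>+s. \<integral>\<^sup>+y. indicator {0<..<t} s * (ennreal (Gz (t - s) x y) * (ennreal (\<bar>u_ext s y \<omega>\<bar> powr (1 + \<eta>)) * indicator B y)) \<partial>lborel \<partial>lborel)
      \<le> ennreal (LINT y:B|lborel. LINT s:{0<..<t}|lborel. b (u s y \<omega>) * green_function p fE (t - s) x y)"
proof -
  define w where "w = (\<lambda>(s, y). indicator ({0<..<t} \<times> B) (s, y) *\<^sub>R (b (u s y \<omega>) * green_function p fE (t - s) x y))"
  have wi: "integrable (lborel \<Otimes>\<^sub>M lborel) w"
    using int unfolding set_integrable_def lborel_prod w_def by (simp add: case_prod_beta')
  have b0: "0 \<le> b z" for z using b[of z] by (rule order_trans[OF powr_ge_zero])
  have wG: "w (s, y) = (if s \<in> {0<..<t} \<and> y \<in> B then b (u s y \<omega>) * Gz (t - s) x y else 0)" for s y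
    using green_function_eq[of "t - s" x y] x by (auto simp: w_def Gz_def)
  have w0: "0 \<le> w z" for z using b0 by (cases z) (auto simp: wG Gz_def)
  have "(LINT y:B|lborel. LINT s:{0<..<t}|lborel. b (u s y \<omega>) * green_function p fE (t - s) x y) =
     (\<integral>y. \<integral>s. w (s, y) \<partial>lborel \<partial>lborel)"
    unfolding set_lebesgue_integral_def w_def
    by (intro Bochner_Integration.integral_cong refl)
       (auto intro!: Bochner_Integration.integral_cong split: split_indicator simp flip: integral_scaleR_right)
  also have "\<dots> = (\<integral>z. w z \<partial>(lborel \<Otimes>\<^sub>M lborel))"
    using lborel_pair.integral_snd[of "\<lambda>s y. w (s, y)"] wi by simp
  finally have eq: "(LINT y:B|lborel. LINT s:{0<..<t}|lborel. b (u s y \<omega>) * green_function p fE (t - s) x y) =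
    (\<integral>z. w z \<partial>(lborel \<Otimes>\<^sub>M lborel))" .
  show "0 \<le> (LINT y:B|lborel. LINT s:{0<..<t}|lborel. b (u s y \<omega>) * green_function p fE (t - s) x y)"
    unfolding eq using w0 by (intro Bochner_Integration.integral_nonneg) auto
  have wm: "(\<lambda>z. ennreal (w z)) \<in> borel_measurable (lborel \<Otimes>\<^sub>M lborel)"
    using borel_measurable_integrable[OF wi] by measurable
  have "(\<integral>\<^sup>+s. \<integral>\<^sup>+y. indicator {0<..<t} s * (ennreal (Gz (t - s) x y) * (ennreal (\<bar>u_ext s y \<omega>\<bar> powr (1 + \<eta>)) * indicator B y)) \<partial>lborel \<partial>lborel)
     \<le> (\<integral>\<^sup>+s. \<integral>\<^sup>+y. ennreal (w (s, y)) \<partial>lborel \<partial>lborel)"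
  proof (intro nn_integral_mono)
    fix s y
    show "indicator {0<..<t} s * (ennreal (Gz (t - s) x y) * (ennreal (\<bar>u_ext s y \<omega>\<bar> powr (1 + \<eta>)) * indicator B y)) \<le> ennreal (w (s, y))"
    proof (cases "s \<in> {0<..<t} \<and> y \<in> B")
      case True
      then have "u_ext s y \<omega> = u s y \<omega>" using t by (auto simp: u_ext_def)
      then have "ennreal (Gz (t - s) x y * \<bar>u_ext s y \<omega>\<bar> powr (1 + \<eta>)) \<le> ennreal (w (s, y))"
        using True b[of "u s y \<omega>"] unfolding wG by (intro ennreal_leI) (auto simp: mult.commute Gz_def intro!: mult_right_mono)
      then show ?thesis using True by (simp add: ennreal_mult Gz_def)
    qed auto
  qed
  also have "\<dots> = (\<integral>\<^sup>+z. ennreal (w z) \<partial>(lborel \<Otimes>\<^sub>M lborel))"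
    by (rule lborel.nn_integral_fst[OF wm])
  also have "\<dots> = ennreal (\<integral>z. w z \<partial>(lborel \<Otimes>\<^sub>M lborel))"
    by (rule nn_integral_eq_integral[OF wi]) (use w0 in auto)
  finally show "(\<integral>\<^sup>+s. \<integral>\<^sup>+y. indicator {0<..<t} s * (ennreal (Gz (t - s) x y) * (ennreal (\<bar>u_ext s y \<omega>\<bar> powr (1 + \<eta>)) * indicator B y)) \<partial>lborel \<partial>lborel)
      \<le> ennreal (LINT y:B|lborel. LINT s:{0<..<t}|lborel. b (u s y \<omega>) * green_function p fE (t - s) x y)"
    unfolding eq .
qed

lemma mean_lower_bound:
  assumes t: "0 < t" "t \<le> T" and x: "x \<in> B"
  shows "(\<integral>\<^sup>+y. Gn t x y * ennreal (indicator B y * u0 y) \<partial>lborel) +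
     (\<integral>\<^sup>+s. indicator {0<..<t} s * (\<integral>\<^sup>+y. Gn (t - s) x y * ennreal (\<bar>mean_field s y\<bar> powr (1 + \<eta>)) \<partial>lborel) \<partial>lborel)
     \<le> ennreal \<bar>mean_field t x\<bar>"
proof -
  interpret MT: pair_sigma_finite M "lborel :: real measure" ..
  interpret MLa: pair_sigma_finite M "lborel :: 'a measure" ..
  define A where "A = (LINT y:B|lborel. green_function p fE t x y * u0 y)"
  define J where "J \<omega> = (LINT y:B|lborel. LINT s:{0<..<t}|lborel. b (u s y \<omega>) * green_function p fE (t - s) x y)" for \<omega>
  have tT: "t \<in> {0<..T}" using t by simp
  have "\<forall>t\<in>{0<..T}. \<forall>x\<in>B.
        (\<exists>I. has_walsh_integral M \<kappa> F
               (\<lambda>s y \<omega>. indicator {0<..<t} s * indicator B y * (green_function p fE (t - s) x y * \<sigma> (u s y \<omega>))) I \<and>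
           (AE \<omega> in M.
              set_integrable lborel ({0<..<t} \<times> B) (\<lambda>(s, y). b (u s y \<omega>) * green_function p fE (t - s) x y) \<and>
              u t x \<omega> =
                (LINT y:B|lborel. green_function p fE t x y * u0 y)
                + (LINT y:B|lborel. LINT s:{0<..<t}|lborel. b (u s y \<omega>) * green_function p fE (t - s) x y)
                + I \<omega>))"
    using mild unfolding mild_solution_def by (elim conjE)
  then obtain I where I: "has_walsh_integral M \<kappa> F
               (\<lambda>s y \<omega>. indicator {0<..<t} s * indicator B y * (green_function p fE (t - s) x y * \<sigma> (u s y \<omega>))) I"
    and ae: "AE \<omega> in M. set_integrable lborel ({0<..<t} \<times> B) (\<lambda>(s, y). b (u s y \<omega>) * green_function p fE (t - s) x y) \<and>
              u t x \<omega> = A + J \<omega> + I \<omega>"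
    using tT x unfolding A_def J_def by blast
  note I0 = W.walsh_integral_mean_zero[OF I]
  \<comment> \<open>The drift \<open>J\<close> is not known to be measurable in
    \<open>\<omega>\<close>. Solving the equation for it gives an integrable variable that equals
    \<open>J\<close> almost surely.\<close>
  define J' where "J' \<omega> = u_ext t x \<omega> - A - I \<omega>" for \<omega>
  have J'i: "integrable M J'" unfolding J'_def[abs_def] using u_ext_integrable[of t x] I0(1) by auto
  have vJ: "mean_field t x = A + (\<integral>\<omega>. J' \<omega> \<partial>M)"
    using u_ext_integrable[of t x] I0 by (simp add: mean_field_def J'_def W.prob_space)
  define Q where "Q \<omega> = (\<integral>\<^sup>+s. \<integral>\<^sup>+y. indicator {0<..<t} s * (ennreal (Gz (t - s) x y) * (ennreal (\<bar>u_ext s y \<omega>\<bar> powr (1 + \<eta>)) * indicator B y)) \<partial>lborel \<partial>lborel)" for \<omega>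
  have JQ: "AE \<omega> in M. 0 \<le> J' \<omega> \<and> Q \<omega> \<le> ennreal (J' \<omega>)"
    using ae
  proof eventually_elim
    case (elim \<omega>)
    have "J' \<omega> = J \<omega>" using elim t x by (simp add: J'_def u_ext_def)
    then show ?case using drift_term[OF elim[THEN conjunct1] x t(2)] by (simp add: J_def Q_def)
  qed
  have "(\<integral>\<^sup>+s. indicator {0<..<t} s * (\<integral>\<^sup>+y. Gn (t - s) x y * ennreal (\<bar>mean_field s y\<bar> powr (1 + \<eta>)) \<partial>lborel) \<partial>lborel)
      = (\<integral>\<^sup>+s. indicator {0<..<t} s * (\<integral>\<^sup>+y. ennreal (Gz (t - s) x y) * (ennreal (\<bar>mean_field s y\<bar> powr (1 + \<eta>)) * indicator B y) \<partial>lborel) \<partial>lborel)"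
    using x by (intro nn_integral_cong) (auto simp: nn_integral_Gz split: split_indicator)
  also have "\<dots> \<le> (\<integral>\<^sup>+s. indicator {0<..<t} s * (\<integral>\<^sup>+y. ennreal (Gz (t - s) x y) * ((\<integral>\<^sup>+\<omega>. ennreal (\<bar>u_ext s y \<omega>\<bar> powr (1 + \<eta>)) \<partial>M) * indicator B y) \<partial>lborel) \<partial>lborel)"
    by (intro nn_integral_mono mult_left_mono mult_right_mono mean_field_powr_le) auto
  also have "\<dots> = (\<integral>\<^sup>+s. \<integral>\<^sup>+y. \<integral>\<^sup>+\<omega>. indicator {0<..<t} s * (ennreal (Gz (t - s) x y) * (ennreal (\<bar>u_ext s y \<omega>\<bar> powr (1 + \<eta>)) * indicator B y)) \<partial>M \<partial>lborel \<partial>lborel)"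
    by (simp add: nn_integral_cmult nn_integral_multc)
  also have "\<dots> = (\<integral>\<^sup>+s. \<integral>\<^sup>+\<omega>. \<integral>\<^sup>+y. indicator {0<..<t} s * (ennreal (Gz (t - s) x y) * (ennreal (\<bar>u_ext s y \<omega>\<bar> powr (1 + \<eta>)) * indicator B y)) \<partial>lborel \<partial>M \<partial>lborel)"
    by (intro nn_integral_cong MLa.Fubini') measurable
  also have "\<dots> = (\<integral>\<^sup>+\<omega>. Q \<omega> \<partial>M)"
    unfolding Q_def by (rule MT.Fubini') measurable
  also have "\<dots> \<le> (\<integral>\<^sup>+\<omega>. ennreal (J' \<omega>) \<partial>M)"
    using JQ by (intro nn_integral_mono_AE) (auto elim!: eventually_mono)
  also have "\<dots> = ennreal (\<integral>\<omega>. J' \<omega> \<partial>M)"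
    using JQ by (intro nn_integral_eq_integral[OF J'i]) (auto elim!: eventually_mono)
  finally have drift: "(\<integral>\<^sup>+s. indicator {0<..<t} s * (\<integral>\<^sup>+y. Gn (t - s) x y * ennreal (\<bar>mean_field s y\<bar> powr (1 + \<eta>)) \<partial>lborel) \<partial>lborel)
      \<le> ennreal (\<integral>\<omega>. J' \<omega> \<partial>M)" .
  have A0: "0 \<le> A"
    unfolding A_def set_lebesgue_integral_def
    using green_function_eq[OF t(1) x] u0
    by (intro Bochner_Integration.integral_nonneg) (auto simp: initial_condition_def split: split_indicator)
  have J0: "0 \<le> (\<integral>\<omega>. J' \<omega> \<partial>M)"
    using JQ by (intro Bochner_Integration.integral_nonneg_AE) (auto elim!: eventually_mono)
  have "(\<integral>\<^sup>+y. Gn t x y * ennreal (indicator B y * u0 y) \<partial>lborel) = ennreal A"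
    unfolding A_def using initial_term[OF t(1) x] by simp
  then show ?thesis using drift A0 J0 unfolding vJ by (simp add: ennreal_plus add_left_mono)
qed

lemma global_bound:
  fixes c :: real
  assumes basis: "dirichlet_eigenbasis B p \<nu> \<mu> \<phi>"
    and c: "0 < c" "\<And>t g. 0 < t \<Longrightarrow> g \<in> borel_measurable borel \<Longrightarrow>
     ennreal (c * (1 + t) powr (- \<beta>)) * (\<integral>\<^sup>+y\<in>B. ennreal (\<phi> 1 y) * g y \<partial>lborel)
     \<le> (\<integral>\<^sup>+x\<in>B. ennreal (\<phi> 1 x) * (\<integral>\<^sup>+y. Gn t x y * g y \<partial>lborel) \<partial>lborel)"
    and mass: "(\<integral>\<^sup>+x\<in>B. ennreal (\<phi> 1 x) \<partial>lborel) = ennreal m" "0 < m"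
    and K: "0 < K" "ennreal K \<le> (\<integral>\<^sup>+y\<in>B. ennreal (\<phi> 1 y) * ennreal (indicator B y * u0 y) \<partial>lborel)"
  shows "\<eta> * (c * m powr (- \<eta>)) * integral {0..T} (\<lambda>s. (1 + s) powr (- (\<beta> * (1 + \<eta>)))) < (c * K) powr (- \<eta>)"
proof -
  note [measurable] = u0_measurable
  note fm[measurable] = dirichlet_eigenbasis_first(1)[OF basis]
  define f where "f x = ennreal (indicator B x * \<phi> 1 x)" for x
  have fmeas[measurable]: "f \<in> borel_measurable borel" unfolding f_def[abs_def] by measurable
  have fB: "ennreal (\<phi> 1 x) * z * indicator B x = f x * z" for x z
    by (auto simp: f_def split: split_indicator)
  have fB1: "ennreal (\<phi> 1 x) * indicator B x = f x" for x
    by (auto simp: f_def split: split_indicator)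
  have fmass: "(\<integral>\<^sup>+x. f x \<partial>lborel) = ennreal m" using mass(1) unfolding fB1 .
  note c2 = c(2)[unfolded fB]
  obtain V where V: "0 \<le> V" "\<And>t x. \<bar>mean_field t x\<bar> \<le> V" using mean_field_bounded by blast
  \<comment> \<open>The projection onto \<open>\<phi> 1\<close> starts as an integral in
    [0, infinity]; the uniform bound \<open>V\<close> on the mean makes it finite and identifies it
    with the real function \<open>k\<close>.\<close>
  define kn where "kn t = (\<integral>\<^sup>+x. f x * ennreal \<bar>mean_field t x\<bar> \<partial>lborel)" for t
  define k where "k t = enn2real (kn t)" for t
  have kn_le: "kn t \<le> ennreal (m * V)" for t
  proof -
    have "kn t \<le> (\<integral>\<^sup>+x. f x * ennreal V \<partial>lborel)"
      unfolding kn_def using V by (intro nn_integral_mono mult_left_mono ennreal_leI) auto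
    also have "\<dots> = ennreal (m * V)"
      using fmass mass(2) V by (simp add: nn_integral_multc ennreal_mult)
    finally show ?thesis .
  qed
  have kn_k: "kn t = ennreal (k t)" for t
    unfolding k_def using le_less_trans[OF kn_le, of \<infinity> t] by simp
  have k_meas[measurable]: "k \<in> borel_measurable borel" unfolding k_def[abs_def] kn_def by measurable
  have k0: "0 \<le> k t" for t by (simp add: k_def)
  have kV: "k t \<le> m * V" for t
    using kn_le[of t] mass V unfolding kn_k by (simp add: ennreal_le_iff)
  have jensen: "ennreal (m powr (- \<eta>) * k s powr (1 + \<eta>)) \<le> (\<integral>\<^sup>+x. f x * ennreal (\<bar>mean_field s x\<bar> powr (1 + \<eta>)) \<partial>lborel)" for s
  proof -
    have "ennreal (m powr (- \<eta>) * k s powr (1 + \<eta>)) \<le> (\<integral>\<^sup>+x. ennreal (\<bar>mean_field s x\<bar> powr (1 + \<eta>)) \<partial>density lborel f)"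
    proof (rule nn_integral_powr_jensen)
      show "emeasure (density lborel f) (space (density lborel f)) = ennreal m"
        using fmass by (simp add: emeasure_density)
      show "(\<integral>\<^sup>+x. ennreal \<bar>mean_field s x\<bar> \<partial>density lborel f) = ennreal (k s)"
        by (simp add: nn_integral_density kn_k[symmetric] kn_def)
    qed (use mass \<eta> k0 in auto)
    then show ?thesis by (simp add: nn_integral_density)
  qed
  show ?thesis
  proof (rule volterra_blow_up_bound[OF T _ _ \<eta> \<beta>(1) k_meas k0 kV])
    show "0 < c * K" "0 < c * m powr (- \<eta>)" using c K mass by auto
    fix t assume t: "0 < t" "t \<le> T"
    define e where "e = c * (1 + t) powr (- \<beta>)"
    have e0: "0 < e" using c t by (simp add: e_def)
    define H where "H s = (\<integral>\<^sup>+x. f x * (\<integral>\<^sup>+y. Gn (t - s) x y * ennreal (\<bar>mean_field s y\<bar> powr (1 + \<eta>)) \<partial>lborel) \<partial>lborel)" for s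
    have He: "ennreal e * ennreal (m powr (- \<eta>) * k s powr (1 + \<eta>)) \<le> H s" if s: "0 < s" "s < t" for s
    proof -
      \<comment> \<open>The factor at time \<open>t - s\<close> is weakened to the one at time
        \<open>t\<close>. It then leaves the time integral, and the convolution inequality becomes
        one to which \<open>volterra_blow_up_bound\<close> applies.\<close>
      have "e \<le> c * (1 + (t - s)) powr (- \<beta>)"
        unfolding e_def using s t c \<beta> by (intro mult_left_mono powr_mono2') auto
      then have "ennreal e * ennreal (m powr (- \<eta>) * k s powr (1 + \<eta>)) \<le>
          ennreal (c * (1 + (t - s)) powr (- \<beta>)) * (\<integral>\<^sup>+x. f x * ennreal (\<bar>mean_field s x\<bar> powr (1 + \<eta>)) \<partial>lborel)"
        by (intro mult_mono ennreal_leI jensen) auto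
      also have "\<dots> \<le> H s" unfolding H_def using s by (intro c2) auto
      finally show ?thesis .
    qed
    define L where "L = (LINT s:{0..t}|lborel. k s powr (1 + \<eta>))"
    have si: "set_integrable lborel {0..t} (\<lambda>s. k s powr (1 + \<eta>))"
      unfolding set_integrable_def
    proof (rule integrableI_bounded_set_indicator[where B="(m * V) powr (1 + \<eta>)"])
      show "AE x in lborel. x \<in> {0..t} \<longrightarrow> norm (k x powr (1 + \<eta>)) \<le> (m * V) powr (1 + \<eta>)"
        using k0 kV \<eta> by (auto intro!: powr_mono2)
    qed (auto simp: emeasure_lborel_Icc_eq)
    have L0: "0 \<le> L" unfolding L_def set_lebesgue_integral_def
      by (intro Bochner_Integration.integral_nonneg) auto
    have Leq: "ennreal L = (\<integral>\<^sup>+s. ennreal (k s powr (1 + \<eta>)) * indicator {0<..<t} s \<partial>lborel)"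
    proof -
      have "ennreal L = (\<integral>\<^sup>+s. ennreal (indicator {0..t} s *\<^sub>R k s powr (1 + \<eta>)) \<partial>lborel)"
        using si unfolding L_def set_lebesgue_integral_def set_integrable_def
        by (intro nn_integral_eq_integral[symmetric]) auto
      also have "\<dots> = (\<integral>\<^sup>+s. ennreal (k s powr (1 + \<eta>)) * indicator {0<..<t} s \<partial>lborel)"
      proof (rule nn_integral_cong_AE)
        show "AE s in lborel. ennreal (indicator {0..t} s *\<^sub>R k s powr (1 + \<eta>)) = ennreal (k s powr (1 + \<eta>)) * indicator {0<..<t} s"
          using AE_lborel_singleton[of 0] AE_lborel_singleton[of t]
          by eventually_elim (auto split: split_indicator)
      qed
      finally show ?thesis .
    qed
    have "ennreal (e * (K + m powr (- \<eta>) * L)) = ennreal e * ennreal K + ennreal e * ennreal (m powr (- \<eta>)) * ennreal L"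
      using e0 K L0 by (simp add: ennreal_mult ennreal_plus distrib_left mult.assoc)
    also have "ennreal e * ennreal (m powr (- \<eta>)) * ennreal L =
        (\<integral>\<^sup>+s. ennreal e * ennreal (m powr (- \<eta>) * k s powr (1 + \<eta>)) * indicator {0<..<t} s \<partial>lborel)"
      unfolding Leq by (simp add: ennreal_mult mult.assoc nn_integral_cmult)
    also have "\<dots> \<le> (\<integral>\<^sup>+s. H s * indicator {0<..<t} s \<partial>lborel)"
      using He by (intro nn_integral_mono) (auto split: split_indicator)
    also have "ennreal e * ennreal K + \<dots> \<le>
       (\<integral>\<^sup>+x. f x * (\<integral>\<^sup>+y. Gn t x y * ennreal (indicator B y * u0 y) \<partial>lborel) \<partial>lborel) + (\<integral>\<^sup>+s. H s * indicator {0<..<t} s \<partial>lborel)"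
    proof (rule add_right_mono)
      have "ennreal e * ennreal K \<le> ennreal e * (\<integral>\<^sup>+y. f y * ennreal (indicator B y * u0 y) \<partial>lborel)"
        using K(2) unfolding fB by (rule mult_left_mono) simp
      also have "\<dots> \<le> (\<integral>\<^sup>+x. f x * (\<integral>\<^sup>+y. Gn t x y * ennreal (indicator B y * u0 y) \<partial>lborel) \<partial>lborel)"
        unfolding e_def using t by (intro c2) auto
      finally show "ennreal e * ennreal K \<le> (\<integral>\<^sup>+x. f x * (\<integral>\<^sup>+y. Gn t x y * ennreal (indicator B y * u0 y) \<partial>lborel) \<partial>lborel)" .
    qed
    also have "(\<integral>\<^sup>+s. H s * indicator {0<..<t} s \<partial>lborel) =
        (\<integral>\<^sup>+s. \<integral>\<^sup>+x. indicator {0<..<t} s * (f x * (\<integral>\<^sup>+y. Gn (t - s) x y * ennreal (\<bar>mean_field s y\<bar> powr (1 + \<eta>)) \<partial>lborel)) \<partial>lborel \<partial>lborel)"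
      unfolding H_def by (simp add: nn_integral_cmult mult.commute)
    also have "\<dots> = (\<integral>\<^sup>+x. \<integral>\<^sup>+s. indicator {0<..<t} s * (f x * (\<integral>\<^sup>+y. Gn (t - s) x y * ennreal (\<bar>mean_field s y\<bar> powr (1 + \<eta>)) \<partial>lborel)) \<partial>lborel \<partial>lborel)"
      by (rule lborel_pair.Fubini'[symmetric]) measurable
    also have "\<dots> = (\<integral>\<^sup>+x. f x * (\<integral>\<^sup>+s. indicator {0<..<t} s * (\<integral>\<^sup>+y. Gn (t - s) x y * ennreal (\<bar>mean_field s y\<bar> powr (1 + \<eta>)) \<partial>lborel) \<partial>lborel) \<partial>lborel)"
      by (simp add: nn_integral_cmult[symmetric] mult_ac)
    also have "(\<integral>\<^sup>+x. f x * (\<integral>\<^sup>+y. Gn t x y * ennreal (indicator B y * u0 y) \<partial>lborel) \<partial>lborel) + \<dots> =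
       (\<integral>\<^sup>+x. f x * ((\<integral>\<^sup>+y. Gn t x y * ennreal (indicator B y * u0 y) \<partial>lborel) +
         (\<integral>\<^sup>+s. indicator {0<..<t} s * (\<integral>\<^sup>+y. Gn (t - s) x y * ennreal (\<bar>mean_field s y\<bar> powr (1 + \<eta>)) \<partial>lborel) \<partial>lborel)) \<partial>lborel)"
      by (subst nn_integral_add[symmetric]) (auto simp: distrib_left)
    also have "\<dots> \<le> kn t"
      unfolding kn_def
    proof (rule nn_integral_mono)
      fix x
      show "f x * ((\<integral>\<^sup>+y. Gn t x y * ennreal (indicator B y * u0 y) \<partial>lborel) +
         (\<integral>\<^sup>+s. indicator {0<..<t} s * (\<integral>\<^sup>+y. Gn (t - s) x y * ennreal (\<bar>mean_field s y\<bar> powr (1 + \<eta>)) \<partial>lborel) \<partial>lborel))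
        \<le> f x * ennreal \<bar>mean_field t x\<bar>"
      proof (cases "x \<in> B")
        case True
        then show ?thesis by (intro mult_left_mono mean_lower_bound t) auto
      next
        case False
        then show ?thesis by (simp add: f_def)
      qed
    qed
    finally have "e * (K + m powr (- \<eta>) * L) \<le> k t"
      unfolding kn_k using k0 by (simp add: ennreal_le_iff)
    then have "(1 + t) powr \<beta> * (e * (K + m powr (- \<eta>) * L)) \<le> (1 + t) powr \<beta> * k t"
      by (intro mult_left_mono) auto
    moreover have "(1 + t) powr \<beta> * e = c"
      using t by (simp add: e_def powr_minus field_simps)
    then have "(1 + t) powr \<beta> * (e * (K + m powr (- \<eta>) * L)) = c * K + c * m powr (- \<eta>) * L"
      by (simp add: mult.assoc[symmetric] distrib_left)
    ultimately show "c * K + c * m powr (- \<eta>) * (LINT s:{0..t}|lborel. k s powr (1 + \<eta>)) \<le> (1 + t) powr \<beta> * k t"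
      unfolding L_def by simp
  qed
qed

end

end

section \<open>Blow-up\<close>

text \<open>Comparison with the borderline exponent 1, whose integral still diverges.\<close>

lemma integral_one_plus_powr_ge_ln:
  fixes \<gamma> T :: real
  assumes "\<gamma> \<le> 1" "0 \<le> T"
  shows "ln (1 + T) \<le> integral {0..T} (\<lambda>s. (1 + s) powr (- \<gamma>))"
proof -
  have "((\<lambda>s. 1 / (1 + s)) has_integral (ln (1 + T) - ln (1 + 0))) {0..T}"
    using assms by (intro fundamental_theorem_of_calculus)
      (auto intro!: derivative_eq_intros simp flip: has_real_derivative_iff_has_vector_derivative)
  then have "((\<lambda>s. 1 / (1 + s)) has_integral ln (1 + T)) {0..T}" by simp
  moreover have "(\<lambda>s. (1 + s) powr (- \<gamma>)) integrable_on {0..T}"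
    by (intro integrable_continuous_real continuous_intros) auto
  moreover have "1 / (1 + s) \<le> (1 + s) powr (- \<gamma>)" if "s \<in> {0..T}" for s
  proof -
    have "(1 + s) powr (- 1) \<le> (1 + s) powr (- \<gamma>)" using that assms by (intro powr_mono) auto
    then show ?thesis using that by (simp add: powr_minus_divide)
  qed
  ultimately show ?thesis
    by (intro has_integral_le[OF _ integrable_integral]) auto
qed

text \<open>The integrand decreases to its value at 1. The fixed horizon 1 suffices for large
  initial data.\<close>

lemma integral_one_plus_powr_ge:
  fixes \<gamma> :: real
  assumes "0 \<le> \<gamma>"
  shows "2 powr (- \<gamma>) \<le> integral {0..1} (\<lambda>s. (1 + s) powr (- \<gamma>))"
proof -
  have "integral {0..1::real} (\<lambda>s. 2 powr (- \<gamma>)) \<le> integral {0..1} (\<lambda>s. (1 + s) powr (- \<gamma>))"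
  proof (rule Henstock_Kurzweil_Integration.integral_le)
    show "(\<lambda>s. (1 + s) powr (- \<gamma>)) integrable_on {0..1::real}"
      by (intro integrable_continuous_real continuous_intros) auto
    show "2 powr (- \<gamma>) \<le> (1 + s) powr (- \<gamma>)" if "s \<in> {0..1}" for s :: real
      using that assms by (intro powr_mono2') auto
  qed auto
  then show ?thesis by simp
qed

text \<open>Finiteness comes from comparing z with 1 + z^2 on a ball of finite measure; zero mass
  would make \<open>\<phi> 1\<close> vanish almost everywhere on the ball, against its normalisation
  in L2.\<close>

lemma (in killed_levy) first_eigenfunction_mass:
  assumes basis: "dirichlet_eigenbasis B p \<nu> \<mu> \<phi>"
  obtains m where "0 < m" "(\<integral>\<^sup>+x\<in>B. ennreal (\<phi> 1 x) \<partial>lborel) = ennreal m"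
proof -
  have norm: "(LINT x:B|lborel. \<phi> 1 x * \<phi> 1 x) = 1"
    using basis by (simp add: dirichlet_eigenbasis_def)
  note L2 = dirichlet_eigenbasis_first[OF basis]
  note [measurable] = L2(1)
  have eq: "(\<integral>\<^sup>+x\<in>B. ennreal (\<phi> 1 x) \<partial>lborel) = (\<integral>\<^sup>+x. ennreal (indicator B x * \<phi> 1 x) \<partial>lborel)"
    by (intro nn_integral_cong) (auto split: split_indicator)
  have "(\<integral>\<^sup>+x. ennreal (indicator B x * \<phi> 1 x) \<partial>lborel) \<le>
      (\<integral>\<^sup>+x. indicator B x + ennreal ((indicator B x * \<phi> 1 x)\<^sup>2) \<partial>lborel)"
  proof (rule nn_integral_mono)
    fix x
    have "\<phi> 1 x \<le> 1 + (\<phi> 1 x)\<^sup>2" using sum_squares_bound[of 1 "\<phi> 1 x"] by (simp add: power2_eq_square) (smt (verit) zero_le_square)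
    then have "ennreal (\<phi> 1 x) \<le> ennreal (1 + (\<phi> 1 x)\<^sup>2)" by (rule ennreal_leI)
    also have "\<dots> = 1 + ennreal ((\<phi> 1 x)\<^sup>2)" by (simp add: ennreal_plus)
    finally show "ennreal (indicator B x * \<phi> 1 x) \<le> indicator B x + ennreal ((indicator B x * \<phi> 1 x)\<^sup>2)"
      by (auto split: split_indicator)
  qed
  also have "\<dots> = emeasure lborel B + l2sq (\<lambda>x. indicator B x * \<phi> 1 x)"
    unfolding l2sq_def using L2(1) by (subst nn_integral_add) (simp_all del: One_nat_def)
  also have "\<dots> < \<infinity>"
    using L2(2) emeasure_bounded_finite[of B] by simp
  finally obtain m where m: "0 \<le> m" "(\<integral>\<^sup>+x. ennreal (indicator B x * \<phi> 1 x) \<partial>lborel) = ennreal m"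
    by (cases "\<integral>\<^sup>+x. ennreal (indicator B x * \<phi> 1 x) \<partial>lborel") auto
  have "m \<noteq> 0"
  proof
    assume "m = 0"
    then have "(\<integral>\<^sup>+x. ennreal (indicator B x * \<phi> 1 x) \<partial>lborel) = 0"
      unfolding m(2) by simp
    then have "AE x in lborel. ennreal (indicator B x * \<phi> 1 x) = 0"
      by (subst (asm) nn_integral_0_iff_AE) measurable
    moreover have "0 \<le> indicator B x * \<phi> 1 x" for x
      using basis by (auto simp: dirichlet_eigenbasis_def less_imp_le split: split_indicator)
    ultimately have "AE x in lborel. indicator B x *\<^sub>R (\<phi> 1 x * \<phi> 1 x) = 0"
      by (auto elim!: eventually_mono split: split_indicator)
    then have "(LINT x:B|lborel. \<phi> 1 x * \<phi> 1 x) = 0"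
      unfolding set_lebesgue_integral_def by (rule integral_eq_zero_AE)
    then show False using norm by simp
  qed
  then show ?thesis using that[of m] m unfolding eq by simp
qed

theorem theorem1p16:
  fixes \<alpha> \<beta> \<nu> R \<eta> :: real
    and b \<sigma> :: "real \<Rightarrow> real"
    and N :: "'v measure"
    and X :: "real \<Rightarrow> 'v \<Rightarrow> 'a::euclidean_space"
    and D :: "real \<Rightarrow> 'v \<Rightarrow> real"
    and p :: "real \<Rightarrow> 'a \<Rightarrow> 'a \<Rightarrow> real"
    and fE :: "real \<Rightarrow> real \<Rightarrow> real"
    and \<mu> :: "nat \<Rightarrow> real"
    and \<phi> :: "nat \<Rightarrow> 'a \<Rightarrow> real"
    and M :: "'w measure"
    and \<kappa> :: "'a noise_kind"
    and F :: "(real \<times> 'a) set \<Rightarrow> 'w \<Rightarrow> real"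
  defines "B \<equiv> ball (0::'a) R"
    and "G \<equiv> green_function p fE"
  assumes "0 < \<nu>" and "0 < \<beta>" and "\<beta> < 1" and "0 < \<alpha>" and "\<alpha> < 2" and "0 < R"
    and "isotropic_stable_process \<alpha> \<nu> N X"
    and "stable_subordinator \<beta> N D"
    and "indep_processes N X D"
    and "killed_transition_density B N X p"
    and "first_passage_density N D fE"
    and "dirichlet_eigenbasis B p \<nu> \<mu> \<phi>"
    and "\<exists>L. L-lipschitz_on UNIV \<sigma>"
    and "local_lipschitz (UNIV :: real set) UNIV (\<lambda>_. b)"
    and "0 < \<eta>" and "\<And>x. b x \<ge> \<bar>x\<bar> powr (1 + \<eta>)"
    and "gaussian_noise M \<kappa> F"
    and "case \<kappa> of White \<Rightarrow> real DIM('a) < min 2 (1 / \<beta>) * \<alpha>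
           | Colored f \<Rightarrow> colored_covariance \<alpha> f"
  shows "(\<beta> * (1 + \<eta>) \<le> 1 \<longrightarrow>
           (\<forall>u0. initial_condition B u0 \<and> (LINT x:B|lborel. u0 x * \<phi> 1 x) > 0 \<longrightarrow>
              \<not> (\<exists>u. global_random_field_solution B G b \<sigma> M \<kappa> F u0 u)))
       \<and> (\<beta> * (1 + \<eta>) > 1 \<longrightarrow>
           (\<exists>K>0. \<forall>u0. initial_condition B u0 \<and> (LINT x:B|lborel. u0 x * \<phi> 1 x) > K \<longrightarrow>
              \<not> (\<exists>u. global_random_field_solution B G b \<sigma> M \<kappa> F u0 u)))"
proof -
  interpret S: subordinated_killed_levy N X p R D fE \<beta>
  proof (intro subordinated_killed_levy.intro killed_levy.intro killed_levy_axioms.intro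
      subordinated_killed_levy_axioms.intro)
    show "levy_process N X" "prob_space N"
      using assms(9) by (simp_all add: isotropic_stable_process_def levy_process_def)
  qed (use assms in \<open>auto simp: B_def\<close>)
  have basis: "dirichlet_eigenbasis (ball 0 R) p \<nu> \<mu> \<phi>" using assms by (simp add: B_def)
  have "0 < \<eta>" and b: "\<And>x. \<bar>x\<bar> powr (1 + \<eta>) \<le> b x" and noise: "gaussian_noise M \<kappa> F" by fact+
  have \<beta>: "0 < \<beta>" by fact
  \<comment> \<open>\<open>c\<close> and \<open>m\<close> are fixed before any initial condition is
    considered, which makes the threshold \<open>K0\<close> below uniform in
    \<open>u0\<close>.\<close>
  obtain c where c: "0 < c" "\<And>t g. 0 < t \<Longrightarrow> g \<in> borel_measurable borel \<Longrightarrow>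
     ennreal (c * (1 + t) powr (- \<beta>)) * (\<integral>\<^sup>+y\<in>S.B. ennreal (\<phi> 1 y) * g y \<partial>lborel)
     \<le> (\<integral>\<^sup>+x\<in>S.B. ennreal (\<phi> 1 x) * (\<integral>\<^sup>+y. S.Gn t x y * g y \<partial>lborel) \<partial>lborel)"
    using S.weighted_green_lower_bound[OF basis] by blast
  obtain m where m: "0 < m" "(\<integral>\<^sup>+x\<in>S.B. ennreal (\<phi> 1 x) \<partial>lborel) = ennreal m"
    using S.first_eigenfunction_mass[OF basis] .
  define C where "C = \<eta> * (c * m powr (- \<eta>))"
  have C: "0 < C" using \<open>0 < \<eta>\<close> c m by (simp add: C_def)
  define \<gamma> where "\<gamma> = \<beta> * (1 + \<eta>)"
  have bound: "C * integral {0..T} (\<lambda>s. (1 + s) powr (- \<gamma>)) < (c * K) powr (- \<eta>)"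
    if u0: "initial_condition B u0" and K: "K = (LINT x:B|lborel. u0 x * \<phi> 1 x)" "0 < K"
      and u: "global_random_field_solution B G b \<sigma> M \<kappa> F u0 u" and T: "0 < T" for u0 u K T
  proof -
    have pos: "\<And>x. x \<in> B \<Longrightarrow> 0 < \<phi> 1 x \<and> 0 \<le> u0 x"
      using basis u0 by (auto simp: dirichlet_eigenbasis_def initial_condition_def B_def)
    \<comment> \<open>The Bochner integral of a nonintegrable function is 0, so \<open>0 < K\<close>
      forces integrability.\<close>
    have "integrable lborel (\<lambda>x. indicator B x *\<^sub>R (u0 x * \<phi> 1 x))"
      using K not_integrable_integral_eq unfolding set_lebesgue_integral_def by fastforce
    then have "ennreal K = (\<integral>\<^sup>+x. ennreal (indicator B x *\<^sub>R (u0 x * \<phi> 1 x)) \<partial>lborel)"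
      unfolding K(1) set_lebesgue_integral_def using pos
      by (intro nn_integral_eq_integral[symmetric]) (auto simp: less_imp_le split: split_indicator)
    also have "\<dots> = (\<integral>\<^sup>+y\<in>S.B. ennreal (\<phi> 1 y) * ennreal (indicator S.B y * u0 y) \<partial>lborel)"
      using pos by (intro nn_integral_cong)
        (auto simp: B_def ennreal_mult less_imp_le mult.commute split: split_indicator)
    finally have K': "ennreal K \<le> (\<integral>\<^sup>+y\<in>S.B. ennreal (\<phi> 1 y) * ennreal (indicator S.B y * u0 y) \<partial>lborel)"
      by simp
    have "random_field_solution S.B (green_function p fE) b \<sigma> M \<kappa> F u0 T u"
      using u T by (simp add: global_random_field_solution_def B_def G_def)
    from S.global_bound[OF noise \<open>0 < \<eta>\<close> b u0[unfolded B_def] T this basis c m(2,1) K(2) K']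
    show ?thesis by (simp only: C_def \<gamma>_def)
  qed
  show ?thesis
  proof (intro conjI impI)
    assume "\<beta> * (1 + \<eta>) \<le> 1"
    then have \<gamma>: "\<gamma> \<le> 1" by (simp add: \<gamma>_def)
    show "\<forall>u0. initial_condition B u0 \<and> (LINT x:B|lborel. u0 x * \<phi> 1 x) > 0 \<longrightarrow>
        \<not> (\<exists>u. global_random_field_solution B G b \<sigma> M \<kappa> F u0 u)"
    proof (intro allI impI notI, elim conjE exE)
      fix u0 u
      assume u0: "initial_condition B u0" and pos: "(LINT x:B|lborel. u0 x * \<phi> 1 x) > 0"
        and u: "global_random_field_solution B G b \<sigma> M \<kappa> F u0 u"
      define K where "K = (LINT x:B|lborel. u0 x * \<phi> 1 x)"
      \<comment> \<open>At the horizon \<open>exp Z - 1\<close> the logarithmic lower bound equals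
        \<open>C * Z\<close>, which is exactly \<open>(c * K) powr (- \<eta>)\<close>.\<close>
      define Z where "Z = (c * K) powr (- \<eta>) / C"
      have Z: "0 < Z" using pos c C by (simp add: Z_def K_def)
      have "C * ln (1 + (exp Z - 1)) \<le> C * integral {0..exp Z - 1} (\<lambda>s. (1 + s) powr (- \<gamma>))"
        using C Z \<gamma> by (intro mult_left_mono integral_one_plus_powr_ge_ln) auto
      also have "\<dots> < (c * K) powr (- \<eta>)"
        using bound[OF u0 K_def _ u, of "exp Z - 1"] pos Z by (simp add: K_def)
      finally show False using C by (simp add: Z_def)
    qed
  next
    assume "1 < \<beta> * (1 + \<eta>)"
    then have \<gamma>: "0 \<le> \<gamma>" by (simp add: \<gamma>_def)
    \<comment> \<open>The solution of
      \<open>(c * K0) powr (- \<eta>) = C * 2 powr (- \<gamma>)\<close>, whose right-hand side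
      bounds \<open>C\<close> times the integral over [0, 1] from below.\<close>
    define K0 where "K0 = (C * 2 powr (- \<gamma>)) powr (- 1 / \<eta>) / c"
    show "\<exists>K>0. \<forall>u0. initial_condition B u0 \<and> (LINT x:B|lborel. u0 x * \<phi> 1 x) > K \<longrightarrow>
        \<not> (\<exists>u. global_random_field_solution B G b \<sigma> M \<kappa> F u0 u)"
    proof (intro exI[of _ K0] conjI allI impI notI, goal_cases)
      case 1
      show ?case using c C by (simp add: K0_def)
    next
      case (2 u0)
      then obtain u where u0: "initial_condition B u0" and large: "(LINT x:B|lborel. u0 x * \<phi> 1 x) > K0"
        and u: "global_random_field_solution B G b \<sigma> M \<kappa> F u0 u" by blast
      define K where "K = (LINT x:B|lborel. u0 x * \<phi> 1 x)"
      have K0: "0 < K0" using c C by (simp add: K0_def)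
      have "(c * K) powr (- \<eta>) \<le> (c * K0) powr (- \<eta>)"
        using c K0 large \<open>0 < \<eta>\<close> by (intro powr_mono2') (auto simp: K_def)
      also have "\<dots> = C * 2 powr (- \<gamma>)"
        using c C \<open>0 < \<eta>\<close> by (simp add: K0_def powr_powr)
      also have "\<dots> \<le> C * integral {0..1} (\<lambda>s. (1 + s) powr (- \<gamma>))"
        using C \<gamma> by (intro mult_left_mono integral_one_plus_powr_ge) auto
      also have "\<dots> < (c * K) powr (- \<eta>)"
        using bound[OF u0 K_def _ u, of 1] large K0 by (simp add: K_def)
      finally show False by simp
    qed
  qed
qed

end
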